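(* Let $\Sigma$ be a fan in $N_{\mathbb R}$ and let $U$ be an open subset of $N_\Sigma$. A function $\varphi:U\to\mathbb R_{-\infty}$ is psh if and only if $\varphi$ is locally a decreasing limit of smooth psh functions, i.e. every point of $U$ has an open neighbourhood $V\subset U$ on which $\varphi|_V$ is the pointwise limit of a decreasing sequence of smooth psh functions on $V$.
   Context: $N$ is a free abelian group of finite rank $n$, $N_{\mathbb R}=N\otimes\mathbb R$, $\mathbb R_{-\infty}=\mathbb R\cup\{-\infty\}$ topologized so that $\exp:\mathbb R_{-\infty}\to[0,\infty)$ is a homeomorphism. A fan $\Sigma$ in $N_{\mathbb R}$ is a finite polyhedral complex of strictly convex rational polyhedral cones, with support $|\Sigma|$. $N_\Sigma=\coprod_{\sigma\in\Sigma}N(\sigma)$, $N(\sigma)=N_{\mathbb R}/\langle\sigma\rangle_{\mathbb R}$, with quotient maps $\pi_\sigma:N_{\mathbb R}\to N(\sigma)$ and $\pi_{\sigma,\tau}:N(\tau)\to N(\sigma)$ for faces $\tau\prec\sigma$; a basis of open neighbourhoods of $p\in N(\sigma)$ is given by $\coprod_{\tau\prec\sigma}\pi_\tau(\Omega+\sigma)$, where $\Omega$ runs over bounded open convex subsets of $N_{\mathbb R}$ with $p\in\pi_\sigma(\Omega)$. $\varphi:U\to\mathbb R_{-\infty}$ is psh if (1) it is upper semicontinuous; (2) $\varphi|_{U\cap N_{\mathbb R}}$ is convex along every segment contained in $U\cap N_{\mathbb R}$; (3) for $p\in N_{\mathbb R}$, $v\in|\Sigma|$ with $\{p+\mu v\mid\mu\in[0,\infty]\}\subset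 U$ one has $\varphi(p+\infty v)\le\varphi(p)$, where $p+\infty v=\lim_{\mu\to\infty}(p+\mu v)$ in $N_\Sigma$. A function $f:U\to\mathbb R$ is smooth if $f|_{U\cap N(\sigma)}$ is $C^\infty$ for each $\sigma\in\Sigma$ and $f$ is constant towards the boundary: each $x\in U\cap N(\sigma)$ has an open neighbourhood $V\subset U$ such that for all $\tau\prec\sigma$ one has $V\cap N(\tau)=(\pi_{\sigma,\tau}|_{V\cap N(\tau)})^{-1}(V\cap N(\sigma))$ and $f=f\circ\pi_{\sigma,\tau}$ on $V\cap N(\tau)$. *)

theory Defs
  imports "HOL-Analysis.Analysis"
begin

section \<open>Fans\<close>

text \<open>
  The space \<open>N\<^sub>\<real> = N \<otimes> \<real>\<close> is a type \<open>'a\<close> of class \<open>real_normed_vector\<close>, and \<open>N\<close> is the set of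
  integral combinations of one of its finite bases.  This makes \<open>'a\<close> finite-dimensional, so that
  the topology, the bounded sets and the differentiable functions do not depend on the norm.
  Rank 0 is included (\<open>B = {}\<close>, \<open>'a\<close> a one-point type).
\<close>

definition full_lattice :: "'a::real_vector set \<Rightarrow> bool" where
  "full_lattice N \<longleftrightarrow>
     (\<exists>B. finite B \<and> independent B \<and> span B = UNIV \<and>
          N = range (\<lambda>c. \<Sum>b\<in>B. real_of_int (c b) *\<^sub>R b))"

definition rational_cone :: "'a::real_vector set \<Rightarrow> 'a set \<Rightarrow> bool" where
  "rational_cone N \<sigma> \<longleftrightarrow> (\<exists>S. finite S \<and> S \<subseteq> N \<and> \<sigma> = convex_cone hull S)"

definition strictly_convex_cone :: "'a::real_vector set \<Rightarrow> bool" where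
  "strictly_convex_cone \<sigma> \<longleftrightarrow> \<sigma> \<inter> uminus ` \<sigma> = {0}"

text \<open>The empty set counts as a face for \<^const>\<open>face_of\<close>; it is not a cone.\<close>

definition fan :: "'a::real_vector set \<Rightarrow> 'a set set \<Rightarrow> bool" where
  "fan N \<Sigma> \<longleftrightarrow>
     finite \<Sigma> \<and>
     (\<forall>\<sigma>\<in>\<Sigma>. rational_cone N \<sigma> \<and> strictly_convex_cone \<sigma>) \<and>
     (\<forall>\<sigma>\<in>\<Sigma>. \<forall>\<tau>. \<tau> face_of \<sigma> \<and> \<tau> \<noteq> {} \<longrightarrow> \<tau> \<in> \<Sigma>) \<and>
     (\<forall>\<sigma>\<in>\<Sigma>. \<forall>\<tau>\<in>\<Sigma>. \<sigma> \<inter> \<tau> face_of \<sigma> \<and> \<sigma> \<inter> \<tau> face_of \<tau>)"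


section \<open>The space \<open>N\<^sub>\<Sigma>\<close>\<close>

text \<open>
  A point of the stratum \<open>N(\<sigma>) = N\<^sub>\<real>/\<langle>\<sigma>\<rangle>\<close> is a coset of \<open>span \<sigma>\<close>, paired with \<open>\<sigma>\<close> because
  distinct cones may have the same span.
\<close>

type_synonym 'a point = "'a set \<times> 'a set"

definition quot :: "'a::real_vector set \<Rightarrow> 'a \<Rightarrow> 'a point" where
  "quot \<sigma> x = (\<sigma>, (+) x ` span \<sigma>)"

abbreviation stratum :: "'a::real_vector set \<Rightarrow> 'a point set" where
  "stratum \<sigma> \<equiv> range (quot \<sigma>)"

text \<open>\<open>quot_map \<sigma>\<close>, restricted to \<open>stratum \<tau>\<close> for a face \<open>\<tau>\<close> of \<open>\<sigma>\<close>, is \<open>\<pi>\<^bsub>\<sigma>,\<tau>\<^esub> : N(\<tau>) \<rightarrow> N(\<sigma>)\<close>.\<close>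

definition quot_map :: "'a::real_vector set \<Rightarrow> 'a point \<Rightarrow> 'a point" where
  "quot_map \<sigma> p = (\<sigma>, snd p + span \<sigma>)"

lemma quot_map_quot: "\<tau> \<subseteq> \<sigma> \<Longrightarrow> quot_map \<sigma> (quot \<tau> x) = quot \<sigma> x"
proof -
  assume "\<tau> \<subseteq> \<sigma>"
  then have "span \<tau> \<subseteq> span \<sigma>" by (rule span_mono)
  have "(+) x ` span \<tau> + span \<sigma> = (+) x ` span \<sigma>"
  proof (intro equalityI subsetI)
    fix y assume "y \<in> (+) x ` span \<tau> + span \<sigma>"
    then obtain a b where "a \<in> span \<tau>" "b \<in> span \<sigma>" "y = x + (a + b)"
      by (auto simp: set_plus_def add.assoc)
    then show "y \<in> (+) x ` span \<sigma>"
      using \<open>span \<tau> \<subseteq> span \<sigma>\<close> by (auto intro: span_add)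
  next
    fix y assume "y \<in> (+) x ` span \<sigma>"
    then obtain b where "b \<in> span \<sigma>" "y = (x + 0) + b"
      by auto
    moreover have "x + 0 \<in> (+) x ` span \<tau>"
      using span_zero by (rule imageI)
    ultimately show "y \<in> (+) x ` span \<tau> + span \<sigma>"
      by (blast intro: set_plus_intro)
  qed
  then show ?thesis by (simp add: quot_def quot_map_def)
qed

text \<open>The inclusion of \<open>N\<^sub>\<real>\<close>, identified with \<open>N({0})\<close>.\<close>

abbreviation incl :: "'a::real_vector \<Rightarrow> 'a point" where
  "incl \<equiv> quot {0}"

definition basic_nbhd :: "'a::real_vector set set \<Rightarrow> 'a set \<Rightarrow> 'a set \<Rightarrow> 'a point set" where
  "basic_nbhd \<Sigma> \<sigma> \<Omega> = (\<Union>\<tau>\<in>{\<tau>\<in>\<Sigma>. \<tau> face_of \<sigma>}. quot \<tau> ` (\<Omega> + \<sigma>))"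

definition NS_topology :: "'a::real_normed_vector set set \<Rightarrow> 'a point topology" where
  "NS_topology \<Sigma> = topology_generated_by
     {basic_nbhd \<Sigma> \<sigma> \<Omega> | \<sigma> \<Omega>. \<sigma> \<in> \<Sigma> \<and> bounded \<Omega> \<and> open \<Omega> \<and> convex \<Omega>}"

lemma fan_convex_cone: "fan N \<Sigma> \<Longrightarrow> \<sigma> \<in> \<Sigma> \<Longrightarrow> convex_cone \<sigma>"
  by (auto simp: fan_def rational_cone_def convex_cone_convex_cone_hull dest!: bspec)

lemma span_convex_cone:
  assumes "convex_cone \<sigma>" "v \<in> span \<sigma>"
  obtains s t where "s \<in> \<sigma>" "t \<in> \<sigma>" "v = s - t"
proof -
  have "subspace {s - t | s t. s \<in> \<sigma> \<and> t \<in> \<sigma>}"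
  proof (rule subspaceI)
    show "0 \<in> {s - t | s t. s \<in> \<sigma> \<and> t \<in> \<sigma>}"
      using convex_cone_contains_0[OF assms(1)] by force
  next
    fix x y assume "x \<in> {s - t | s t. s \<in> \<sigma> \<and> t \<in> \<sigma>}" "y \<in> {s - t | s t. s \<in> \<sigma> \<and> t \<in> \<sigma>}"
    then obtain s t s' t' where st: "s \<in> \<sigma>" "t \<in> \<sigma>" "x = s - t" "s' \<in> \<sigma>" "t' \<in> \<sigma>" "y = s' - t'"
      by blast
    have "x + y = (s + s') - (t + t')" unfolding st(3) st(6) by (simp add: algebra_simps)
    moreover have "s + s' \<in> \<sigma>" "t + t' \<in> \<sigma>" using st convex_cone_add[OF assms(1)] by blast+
    ultimately show "x + y \<in> {s - t | s t. s \<in> \<sigma> \<and> t \<in> \<sigma>}" by blast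
  next
    fix c :: real and x assume "x \<in> {s - t | s t. s \<in> \<sigma> \<and> t \<in> \<sigma>}"
    then obtain s t where st: "s \<in> \<sigma>" "t \<in> \<sigma>" "x = s - t" by auto
    show "c *\<^sub>R x \<in> {s - t | s t. s \<in> \<sigma> \<and> t \<in> \<sigma>}"
    proof (cases "c \<ge> 0")
      case True
      then have "c *\<^sub>R x = c *\<^sub>R s - c *\<^sub>R t" "c *\<^sub>R s \<in> \<sigma>" "c *\<^sub>R t \<in> \<sigma>"
        using st convex_cone_scaleR[OF assms(1)] by (auto simp: algebra_simps)
      then show ?thesis by blast
    next
      case False
      then have "c *\<^sub>R x = (-c) *\<^sub>R t - (-c) *\<^sub>R s" "(-c) *\<^sub>R s \<in> \<sigma>" "(-c) *\<^sub>R t \<in> \<sigma>"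
        using st convex_cone_scaleR[OF assms(1), of "-c"] by (auto simp: algebra_simps)
      then show ?thesis by blast
    qed
  qed
  moreover have "\<sigma> \<subseteq> {s - t | s t. s \<in> \<sigma> \<and> t \<in> \<sigma>}"
    using convex_cone_contains_0[OF assms(1)] by force
  ultimately have "span \<sigma> \<subseteq> {s - t | s t. s \<in> \<sigma> \<and> t \<in> \<sigma>}" by (rule span_minimal[rotated])
  then show thesis using assms(2) that by auto
qed

text \<open>The generating sets contain a neighbourhood basis of every point.\<close>

lemma openin_NS_topology:
  assumes "fan N \<Sigma>"
  shows "openin (NS_topology \<Sigma>) W \<longleftrightarrow>
    W \<subseteq> (\<Union>\<sigma>\<in>\<Sigma>. stratum \<sigma>) \<and>
    (\<forall>\<sigma>\<in>\<Sigma>. \<forall>p \<in> W \<inter> stratum \<sigma>.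
       \<exists>\<Omega>. bounded \<Omega> \<and> open \<Omega> \<and> convex \<Omega> \<and> p \<in> quot \<sigma> ` \<Omega> \<and> basic_nbhd \<Sigma> \<sigma> \<Omega> \<subseteq> W)"
    (is "_ \<longleftrightarrow> ?P W")
proof
  note cc = fan_convex_cone[OF assms]
  show "openin (NS_topology \<Sigma>) W" if W: "?P W"
  proof (subst openin_subopen, intro ballI)
    fix p assume "p \<in> W"
    then obtain \<sigma> where \<sigma>: "\<sigma> \<in> \<Sigma>" "p \<in> stratum \<sigma>" using W by blast
    then obtain \<Omega> where \<Omega>: "bounded \<Omega>" "open \<Omega>" "convex \<Omega>" "p \<in> quot \<sigma> ` \<Omega>"
        "basic_nbhd \<Sigma> \<sigma> \<Omega> \<subseteq> W"
      using W \<open>p \<in> W\<close> by blast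
    have "\<sigma> face_of \<sigma>"
      using cc[OF \<sigma>(1)] by (auto simp: convex_cone_def intro: face_of_refl)
    moreover have "\<Omega> \<subseteq> \<Omega> + \<sigma>"
      using convex_cone_contains_0[OF cc[OF \<sigma>(1)]] by (force simp: set_plus_def)
    ultimately have "p \<in> basic_nbhd \<Sigma> \<sigma> \<Omega>"
      using \<sigma>(1) \<Omega>(4) unfolding basic_nbhd_def by blast
    moreover have "openin (NS_topology \<Sigma>) (basic_nbhd \<Sigma> \<sigma> \<Omega>)"
      unfolding NS_topology_def using \<sigma>(1) \<Omega> by (intro topology_generated_by_Basis) blast
    ultimately show "\<exists>T. openin (NS_topology \<Sigma>) T \<and> p \<in> T \<and> T \<subseteq> W"
      using \<Omega>(5) by blast
  qed
  show "?P W" if "openin (NS_topology \<Sigma>) W"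
    using that unfolding NS_topology_def openin_topology_generated_by_iff
  proof (induction rule: generate_topology_on.induct)
    case Empty
    show ?case by simp
  next
    case (Int A B)
    show ?case
    proof (intro conjI ballI)
      show "A \<inter> B \<subseteq> (\<Union>\<sigma>\<in>\<Sigma>. stratum \<sigma>)" using Int.IH by blast
    next
      fix \<sigma> p assume \<sigma>: "\<sigma> \<in> \<Sigma>" and p: "p \<in> (A \<inter> B) \<inter> stratum \<sigma>"
      have pA: "p \<in> A \<inter> stratum \<sigma>" and pB: "p \<in> B \<inter> stratum \<sigma>" using p by auto
      from bspec[OF bspec[OF conjunct2[OF Int.IH(1)] \<sigma>] pA]
      obtain \<Omega>1 where 1: "bounded \<Omega>1" "open \<Omega>1" "convex \<Omega>1" "p \<in> quot \<sigma> ` \<Omega>1"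
          "basic_nbhd \<Sigma> \<sigma> \<Omega>1 \<subseteq> A" by (elim exE conjE)
      from bspec[OF bspec[OF conjunct2[OF Int.IH(2)] \<sigma>] pB]
      obtain \<Omega>2 where 2: "bounded \<Omega>2" "open \<Omega>2" "convex \<Omega>2" "p \<in> quot \<sigma> ` \<Omega>2"
          "basic_nbhd \<Sigma> \<sigma> \<Omega>2 \<subseteq> B" by (elim exE conjE)
      obtain x y where x: "x \<in> \<Omega>1" "p = quot \<sigma> x" and y: "y \<in> \<Omega>2" "p = quot \<sigma> y"
        using 1(4) 2(4) by blast
      then have "x + 0 \<in> (+) y ` span \<sigma>"
        using imageI[OF span_zero, of "(+) x" \<sigma>] by (simp add: quot_def)
      then obtain v where v: "v \<in> span \<sigma>" "x = y + v" by auto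
      obtain s t where st: "s \<in> \<sigma>" "t \<in> \<sigma>" "v = s - t"
        by (rule span_convex_cone[OF cc[OF \<sigma>] v(1)])
      define \<Omega> where "\<Omega> = (+) t ` \<Omega>1 \<inter> (+) s ` \<Omega>2"
      have "t + x = s + y" using v st by simp
      then have "t + x \<in> \<Omega>"
        unfolding \<Omega>_def by (metis IntI imageI x(1) y(1))
      moreover have "p = quot \<sigma> (t + x)"
      proof -
        have t: "t \<in> span \<sigma>" by (rule span_base[OF st(2)])
        have "(+) t ` span \<sigma> = span \<sigma>"
        proof (intro equalityI subsetI)
          fix z assume "z \<in> span \<sigma>"
          then have "z - t \<in> span \<sigma>" "z = t + (z - t)" using t by (auto intro: span_diff)
          then show "z \<in> (+) t ` span \<sigma>" by blast
        qed (use t in \<open>auto intro: span_add\<close>)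
        then have "(+) x ` span \<sigma> = (+) x ` (+) t ` span \<sigma>" by simp
        also have "\<dots> = (+) (t + x) ` span \<sigma>" by (simp add: image_image algebra_simps)
        finally show ?thesis using x(2) by (simp add: quot_def)
      qed
      ultimately have "p \<in> quot \<sigma> ` \<Omega>" by blast
      moreover have "bounded \<Omega>" "open \<Omega>" "convex \<Omega>"
        unfolding \<Omega>_def using 1 2
        by (auto intro: bounded_translation bounded_Int open_translation convex_translation convex_Int)
      moreover have "\<Omega> + \<sigma> \<subseteq> \<Omega>1 + \<sigma>" "\<Omega> + \<sigma> \<subseteq> \<Omega>2 + \<sigma>"
      proof -
        show "\<Omega> + \<sigma> \<subseteq> \<Omega>1 + \<sigma>"
        proof
          fix z assume "z \<in> \<Omega> + \<sigma>"
          then obtain w r where "w \<in> \<Omega>1" "r \<in> \<sigma>" "z = w + (t + r)"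
            by (auto simp: \<Omega>_def set_plus_def algebra_simps)
          moreover have "t + r \<in> \<sigma>" using convex_cone_add[OF cc[OF \<sigma>] st(2) \<open>r \<in> \<sigma>\<close>] .
          ultimately show "z \<in> \<Omega>1 + \<sigma>" by (auto intro: set_plus_intro)
        qed
        show "\<Omega> + \<sigma> \<subseteq> \<Omega>2 + \<sigma>"
        proof
          fix z assume "z \<in> \<Omega> + \<sigma>"
          then obtain w r where wr: "w \<in> \<Omega>" "r \<in> \<sigma>" "z = w + r" by (auto simp: set_plus_def)
          then obtain w' where "w' \<in> \<Omega>2" "w = s + w'" by (auto simp: \<Omega>_def)
          moreover have "s + r \<in> \<sigma>" using convex_cone_add[OF cc[OF \<sigma>] st(1) \<open>r \<in> \<sigma>\<close>] .
          moreover have "z = w' + (s + r)" using wr calculation by (simp add: algebra_simps)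
          ultimately show "z \<in> \<Omega>2 + \<sigma>" by (auto intro: set_plus_intro)
        qed
      qed
      then have "basic_nbhd \<Sigma> \<sigma> \<Omega> \<subseteq> basic_nbhd \<Sigma> \<sigma> \<Omega>1" "basic_nbhd \<Sigma> \<sigma> \<Omega> \<subseteq> basic_nbhd \<Sigma> \<sigma> \<Omega>2"
        unfolding basic_nbhd_def by blast+
      then have "basic_nbhd \<Sigma> \<sigma> \<Omega> \<subseteq> A \<inter> B" using 1(5) 2(5) by blast
      ultimately show "\<exists>\<Omega>. bounded \<Omega> \<and> open \<Omega> \<and> convex \<Omega> \<and> p \<in> quot \<sigma> ` \<Omega> \<and>
          basic_nbhd \<Sigma> \<sigma> \<Omega> \<subseteq> A \<inter> B" by blast
    qed
  next
    case (UN K)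
    show ?case
    proof (intro conjI ballI)
      show "\<Union>K \<subseteq> (\<Union>\<sigma>\<in>\<Sigma>. stratum \<sigma>)" using UN.IH by blast
    next
      fix \<sigma> p assume \<sigma>: "\<sigma> \<in> \<Sigma>" and p: "p \<in> \<Union>K \<inter> stratum \<sigma>"
      then obtain k where k: "k \<in> K" "p \<in> k \<inter> stratum \<sigma>" by blast
      from bspec[OF bspec[OF conjunct2[OF UN.IH[OF k(1)]] \<sigma>] k(2)]
      obtain \<Omega> where \<Omega>: "bounded \<Omega>" "open \<Omega>" "convex \<Omega>" "p \<in> quot \<sigma> ` \<Omega>"
          "basic_nbhd \<Sigma> \<sigma> \<Omega> \<subseteq> k" by (elim exE conjE)
      moreover have "basic_nbhd \<Sigma> \<sigma> \<Omega> \<subseteq> \<Union>K" using \<Omega>(5) k(1) by blast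
      ultimately show "\<exists>\<Omega>. bounded \<Omega> \<and> open \<Omega> \<and> convex \<Omega> \<and> p \<in> quot \<sigma> ` \<Omega> \<and>
          basic_nbhd \<Sigma> \<sigma> \<Omega> \<subseteq> \<Union>K" by (intro exI[of _ \<Omega>] conjI)
    qed
  next
    case (Basis W)
    then obtain \<sigma> \<Omega> where W: "W = basic_nbhd \<Sigma> \<sigma> \<Omega>" "\<sigma> \<in> \<Sigma>" "bounded \<Omega>" "open \<Omega>" "convex \<Omega>"
      by blast
    show ?case
    proof (intro conjI ballI)
      show "W \<subseteq> (\<Union>\<sigma>\<in>\<Sigma>. stratum \<sigma>)" unfolding W(1) basic_nbhd_def by blast
    next
      fix \<tau> p assume \<tau>: "\<tau> \<in> \<Sigma>" and p: "p \<in> W \<inter> stratum \<tau>"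
      then have "\<tau> face_of \<sigma>" "p \<in> quot \<tau> ` (\<Omega> + \<sigma>)"
        unfolding W(1) basic_nbhd_def by (auto simp: quot_def)
      then obtain w s where ws: "w \<in> \<Omega>" "s \<in> \<sigma>" "p = quot \<tau> (s + w)"
        by (auto simp: set_plus_def add.commute)
      have "(+) s ` \<Omega> + \<tau> \<subseteq> \<Omega> + \<sigma>"
      proof
        fix z assume "z \<in> (+) s ` \<Omega> + \<tau>"
        then obtain w r where "w \<in> \<Omega>" "r \<in> \<tau>" "z = w + (s + r)"
          by (auto simp: set_plus_def algebra_simps)
        moreover have "s + r \<in> \<sigma>"
          using convex_cone_add[OF cc[OF W(2)] ws(2)] \<open>r \<in> \<tau>\<close> face_of_imp_subset[OF \<open>\<tau> face_of \<sigma>\<close>]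
          by blast
        ultimately show "z \<in> \<Omega> + \<sigma>" by (auto intro: set_plus_intro)
      qed
      then have "basic_nbhd \<Sigma> \<tau> ((+) s ` \<Omega>) \<subseteq> W"
        unfolding W(1) basic_nbhd_def using face_of_trans[OF _ \<open>\<tau> face_of \<sigma>\<close>] by blast
      moreover have "bounded ((+) s ` \<Omega>)" "open ((+) s ` \<Omega>)" "convex ((+) s ` \<Omega>)"
        using W by (auto intro: bounded_translation open_translation convex_translation)
      moreover have "p \<in> quot \<tau> ` (+) s ` \<Omega>" using ws by blast
      ultimately show "\<exists>\<Omega>. bounded \<Omega> \<and> open \<Omega> \<and> convex \<Omega> \<and> p \<in> quot \<tau> ` \<Omega> \<and>
          basic_nbhd \<Sigma> \<tau> \<Omega> \<subseteq> W" by blast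
    qed
  qed
qed


section \<open>Psh and smooth functions\<close>

text \<open>
  \<open>\<real>\<^bsub>-\<infinity>\<^esub>\<close> is the subspace \<open>{..<\<infinity>}\<close> of \<^typ>\<open>ereal\<close>.  In the convexity condition the weights lie
  strictly between 0 and 1, so that no product of 0 with an infinite value occurs.
\<close>

definition psh_on :: "'a::real_normed_vector set set \<Rightarrow> 'a point set \<Rightarrow> ('a point \<Rightarrow> ereal) \<Rightarrow> bool"
  where
  "psh_on \<Sigma> U \<phi> \<longleftrightarrow>
     (\<forall>p\<in>U. \<phi> p < \<infinity>) \<and>
     (\<forall>a::real. openin (subtopology (NS_topology \<Sigma>) U) {p \<in> U. \<phi> p < ereal a}) \<and>
     (\<forall>x y. incl ` closed_segment x y \<subseteq> U \<longrightarrow>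
        (\<forall>t\<in>{0<..<1}. \<phi> (incl ((1 - t) *\<^sub>R x + t *\<^sub>R y))
                       \<le> ereal (1 - t) * \<phi> (incl x) + ereal t * \<phi> (incl y))) \<and>
     (\<forall>p q. \<forall>v\<in>\<Union>\<Sigma>.
        (\<forall>\<mu>\<ge>0. incl (p + \<mu> *\<^sub>R v) \<in> U) \<and>
        limitin (NS_topology \<Sigma>) (\<lambda>\<mu>::real. incl (p + \<mu> *\<^sub>R v)) q at_top \<and> q \<in> U \<longrightarrow>
        \<phi> q \<le> \<phi> (incl p))"

text \<open>\<open>k\<close>-times continuous differentiability on an open subset of a finite-dimensional space.\<close>

primrec Ck_on :: "nat \<Rightarrow> 'a::real_normed_vector set \<Rightarrow> ('a \<Rightarrow> real) \<Rightarrow> bool" where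
  "Ck_on 0 W f \<longleftrightarrow> continuous_on W f"
| "Ck_on (Suc k) W f \<longleftrightarrow>
     (\<forall>x\<in>W. f differentiable (at x)) \<and> (\<forall>v. Ck_on k W (\<lambda>x. frechet_derivative f (at x) v))"

definition C_infinity_on :: "'a::real_normed_vector set \<Rightarrow> ('a \<Rightarrow> real) \<Rightarrow> bool" where
  "C_infinity_on W f \<longleftrightarrow> (\<forall>k. Ck_on k W f)"

text \<open>
  The manifold structure of the quotient space \<open>N(\<sigma>)\<close>: a function on an open subset is smooth iff
  its pullback along the linear surjection \<open>quot \<sigma>\<close> is.
\<close>

definition C_infinity_on_stratum ::
    "'a::real_normed_vector set \<Rightarrow> 'a point set \<Rightarrow> ('a point \<Rightarrow> real) \<Rightarrow> bool" where
  "C_infinity_on_stratum \<sigma> U f \<longleftrightarrow> C_infinity_on (quot \<sigma> -` U) (f \<circ> quot \<sigma>)"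

definition constant_towards_boundary ::
    "'a::real_normed_vector set set \<Rightarrow> 'a point set \<Rightarrow> ('a point \<Rightarrow> real) \<Rightarrow> bool" where
  "constant_towards_boundary \<Sigma> U f \<longleftrightarrow>
     (\<forall>\<sigma>\<in>\<Sigma>. \<forall>x \<in> U \<inter> stratum \<sigma>. \<exists>V. openin (NS_topology \<Sigma>) V \<and> x \<in> V \<and> V \<subseteq> U \<and>
        (\<forall>\<tau>\<in>\<Sigma>. \<tau> face_of \<sigma> \<longrightarrow>
           V \<inter> stratum \<tau> = {q \<in> V \<inter> stratum \<tau>. quot_map \<sigma> q \<in> V \<inter> stratum \<sigma>} \<and>
           (\<forall>q \<in> V \<inter> stratum \<tau>. f q = f (quot_map \<sigma> q))))"

definition smooth_on ::
    "'a::real_normed_vector set set \<Rightarrow> 'a point set \<Rightarrow> ('a point \<Rightarrow> real) \<Rightarrow> bool" where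
  "smooth_on \<Sigma> U f \<longleftrightarrow>
     (\<forall>\<sigma>\<in>\<Sigma>. C_infinity_on_stratum \<sigma> U f) \<and> constant_towards_boundary \<Sigma> U f"

definition decreasing_limit_of_smooth_psh ::
    "'a::real_normed_vector set set \<Rightarrow> 'a point set \<Rightarrow> ('a point \<Rightarrow> ereal) \<Rightarrow> bool" where
  "decreasing_limit_of_smooth_psh \<Sigma> V \<phi> \<longleftrightarrow>
     (\<exists>f :: nat \<Rightarrow> 'a point \<Rightarrow> real.
        (\<forall>k. smooth_on \<Sigma> V (f k) \<and> psh_on \<Sigma> V (\<lambda>p. ereal (f k p))) \<and>
        (\<forall>p\<in>V. decseq (\<lambda>k. f k p) \<and> (\<lambda>k. ereal (f k p)) \<longlonglongrightarrow> \<phi> p))"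

end

theory Submission
  imports Defs
begin

text \<open>
  Near a point of the stratum \<open>N(\<sigma>)\<close> everything is governed by the convex open set \<open>W = \<Omega> + \<sigma>\<close> in
  \<open>N\<^sub>\<real>\<close>.  A psh function \<open>\<phi>\<close> restricts to a convex function on \<open>W\<close>.  It is bounded above near the
  boundary by upper semicontinuity, and a convex function bounded above along a ray is nonincreasing
  along it; hence \<open>\<phi>\<close> decreases in the directions of \<open>\<sigma>\<close>.  Upper semicontinuity and the condition on
  rays together say that the value at a boundary point is the infimum of the values on the fibre of
  \<open>W\<close> over it (\<open>psh_boundary_le\<close>, \<open>psh_boundary_approx\<close>, \<open>psh_nonincreasing_along_cone\<close>).

  For the approximation, sample \<open>max \<phi> (-k)\<close> at a finite set \<open>D\<^sub>k \<subseteq> W\<close>, where \<open>D\<^sub>k\<close> increases to a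
  dense set.  Among the convex functions that decrease along \<open>\<sigma>\<close> and do not exceed the samples there
  is a largest one.  It lies above \<open>\<phi>\<close>, it decreases with \<open>k\<close>, and it tends to \<open>\<phi>\<close> because every
  point of \<open>W\<close> is a convex combination of nearby points of the dense set.  Its epigraph is generated
  by finitely many points and directions, so by Weyl's theorem on finitely generated cones it is the
  maximum of finitely many affine forms, whose linear parts are nonpositive on \<open>\<sigma>\<close>
  (\<open>finitely_generated_cone_polyhedral\<close>, \<open>polyhedral_interpolation\<close>).

  Such a maximum, cut off from below by a constant, does not change along a face \<open>\<tau>\<close> of \<open>\<sigma>\<close> once one
  is far out in the direction of \<open>\<tau>\<close>: there the forms that do not vanish on \<open>\<tau>\<close> have dropped below
  the constant.  To make it smooth the maximum is replaced by iterating
  \<open>b + \<epsilon> h((a - b)/\<epsilon>)\<close> with \<open>h(t) = t exp(-1/t)\<close> for \<open>t > 0\<close> and \<open>h(t) = 0\<close> otherwise.  This \<open>h\<close> is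
  smooth and convex, stays within 1 of the positive part, and vanishes identically on the negative
  half line.  So the regularised maximum is smooth and convex, is within \<open>\<epsilon>\<close> of the maximum, and
  still drops dominated forms exactly; it is constant towards the boundary and extends to a smooth
  psh function (\<open>smooth_toric_reg_max\<close>, \<open>psh_toric_reg_max\<close>).  Adding \<open>2\<epsilon>\<^sub>k\<close> with \<open>\<epsilon>\<^sub>k = 2\<^sup>-\<^sup>k\<close> restores
  monotonicity in \<open>k\<close>.

  Conversely let \<open>\<phi>\<close> be a local decreasing limit of psh functions.  Upper semicontinuity and convexity
  on short segments pass to the limit.  Local convexity implies convexity on whole segments by a
  maximum argument, and the condition on rays holds near the endpoint and spreads along the ray
  since a convex function bounded above on the ray is nonincreasing.
\<close>

section \<open>Smooth functions\<close>

lemma Ck_on_SucI: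
  assumes "\<And>x. (f has_derivative D x) (at x)" "\<And>v. Ck_on k UNIV (\<lambda>x. D x v)"
  shows "Ck_on (Suc k) UNIV f"
proof -
  have "(\<lambda>x. frechet_derivative f (at x) v) = (\<lambda>x. D x v)" for v
    using frechet_derivative_at[OF assms(1)] by metis
  then show ?thesis
    using assms by (auto simp: differentiable_def)
qed

lemma Ck_on_SucD:
  assumes "Ck_on (Suc k) UNIV f"
  shows "\<exists>D. (\<forall>x. (f has_derivative D x) (at x)) \<and> (\<forall>v. Ck_on k UNIV (\<lambda>x. D x v))"
  using assms frechet_derivative_works by fastforce

lemma Ck_on_pred: "Ck_on (Suc k) UNIV f \<Longrightarrow> Ck_on k UNIV f"
proof (induction k arbitrary: f)
  case 0
  then show ?case
    by (auto intro!: continuous_at_imp_continuous_on differentiable_imp_continuous_within)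
next
  case (Suc k)
  show ?case
  proof -
    obtain D where D: "\<And>x. (f has_derivative D x) (at x)" "\<And>v. Ck_on (Suc k) UNIV (\<lambda>x. D x v)"
      using Ck_on_SucD[OF Suc.prems] by blast
    show ?thesis by (rule Ck_on_SucI[OF D(1) Suc.IH[OF D(2)]])
  qed
qed

lemma Ck_on_subset: "Ck_on k W f \<Longrightarrow> W' \<subseteq> W \<Longrightarrow> Ck_on k W' f"
  by (induction k arbitrary: f) (auto intro: continuous_on_subset)

lemma Ck_on_const: "Ck_on k UNIV (\<lambda>x. c)"
proof (induction k arbitrary: c)
  case (Suc k)
  show ?case by (rule Ck_on_SucI[where D = "\<lambda>x v. 0"]) (auto intro: derivative_intros Suc)
qed simp

lemma Ck_on_bounded_linear: "bounded_linear f \<Longrightarrow> Ck_on k UNIV f"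
  by (cases k) (auto intro!: Ck_on_SucI[where D = "\<lambda>x. f"] bounded_linear_imp_has_derivative
      Ck_on_const linear_continuous_on simp del: Ck_on.simps(2))

lemma Ck_on_add:
  "Ck_on k UNIV f \<Longrightarrow> Ck_on k UNIV g \<Longrightarrow> Ck_on k UNIV (\<lambda>x. f x + g x)"
proof (induction k arbitrary: f g)
  case 0
  then show ?case by (auto intro: continuous_on_add)
next
  case (Suc k)
  obtain D where D: "\<And>x. (f has_derivative D x) (at x)" "\<And>v. Ck_on k UNIV (\<lambda>x. D x v)"
    using Ck_on_SucD[OF Suc.prems(1)] by blast
  obtain E where E: "\<And>x. (g has_derivative E x) (at x)" "\<And>v. Ck_on k UNIV (\<lambda>x. E x v)"
    using Ck_on_SucD[OF Suc.prems(2)] by blast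
  show ?case
    by (rule Ck_on_SucI[where D = "\<lambda>x v. D x v + E x v"])
      (auto intro: has_derivative_add D E Suc.IH)
qed

lemma Ck_on_mult:
  "Ck_on k UNIV f \<Longrightarrow> Ck_on k UNIV g \<Longrightarrow> Ck_on k UNIV (\<lambda>x. f x * g x)"
proof (induction k arbitrary: f g)
  case 0
  then show ?case by (auto intro: continuous_on_mult)
next
  case (Suc k)
  obtain D where D: "\<And>x. (f has_derivative D x) (at x)" "\<And>v. Ck_on k UNIV (\<lambda>x. D x v)"
    using Ck_on_SucD[OF Suc.prems(1)] by blast
  obtain E where E: "\<And>x. (g has_derivative E x) (at x)" "\<And>v. Ck_on k UNIV (\<lambda>x. E x v)"
    using Ck_on_SucD[OF Suc.prems(2)] by blast
  show ?case
    by (rule Ck_on_SucI[OF has_derivative_mult[OF D(1) E(1)]])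
      (intro Ck_on_add Suc.IH D(2) E(2) Suc.prems[THEN Ck_on_pred])
qed

text \<open>
  Up to linear combinations this family is closed under differentiation, which is why the power of
  \<open>1 / t\<close> is carried along: one induction then gives smoothness of all its members.
\<close>

definition flat :: "nat \<Rightarrow> real \<Rightarrow> real" where
  "flat m t = (if t \<le> 0 then 0 else (1 / t) ^ m * exp (- (1 / t)))"

lemma flat_nonneg: "0 \<le> flat m t"
  by (simp add: flat_def)

lemma flat_mult: "t * flat (Suc m) t = flat m t"
  by (simp add: flat_def)

lemma flat_tendsto_0: "(flat m \<longlongrightarrow> 0) (at 0)"
proof (rule filterlim_split_at)
  have "\<forall>\<^sub>F t in at_left 0. flat m t = 0"
    by (auto simp: eventually_at_filter flat_def)
  then show "(flat m \<longlongrightarrow> 0) (at_left 0)"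
    by (rule tendsto_eventually)
  have "((\<lambda>t. inverse t ^ m / exp (inverse t)) \<longlongrightarrow> (0::real)) (at_right 0)"
    by (rule filterlim_compose[OF tendsto_power_div_exp_0 filterlim_inverse_at_top_right])
  moreover have "\<forall>\<^sub>F t in at_right 0. inverse t ^ m / exp (inverse t) = flat m t"
    by (auto simp: eventually_at_filter flat_def exp_minus field_simps)
  ultimately show "(flat m \<longlongrightarrow> 0) (at_right 0)"
    by (rule Lim_transform_eventually)
qed

lemma flat_derivative:
  "(flat m has_real_derivative flat (m + 2) t - real m * flat (Suc m) t) (at t)"
proof -
  consider "t < 0" | "t = 0" | "t > 0" by linarith
  then show ?thesis
  proof cases
    case 1
    have "((\<lambda>t. 0) has_real_derivative 0) (at t)" by simp
    then have "(flat m has_real_derivative 0) (at t)"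
      by (rule has_field_derivative_transform_within_open[where S = "{..<0}"])
        (use 1 in \<open>auto simp: flat_def\<close>)
    then show ?thesis using 1 by (simp add: flat_def)
  next
    case 2
    have "(\<lambda>h. (flat m (0 + h) - flat m 0) / h) = flat (Suc m)"
      by (auto simp: flat_def fun_eq_iff)
    then have "DERIV (flat m) 0 :> 0"
      using flat_tendsto_0[of "Suc m"] unfolding DERIV_def by simp
    then show ?thesis using 2 by (simp add: flat_def)
  next
    case 3
    have i: "((\<lambda>t. 1 / t) has_real_derivative - ((1 / t) ^ 2)) (at t)"
      using 3 by (auto intro!: derivative_eq_intros simp: power2_eq_square)
    have "((\<lambda>t. (1 / t) ^ m * exp (- (1 / t))) has_real_derivative
        (real m * (- ((1 / t) ^ 2) * (1 / t) ^ (m - Suc 0))) * exp (- (1 / t)) +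
        (exp (- (1 / t)) * - (- ((1 / t) ^ 2))) * (1 / t) ^ m) (at t)"
      by (intro DERIV_mult DERIV_power DERIV_fun_exp DERIV_minus i)
    moreover have "(real m * (- (u ^ 2) * u ^ (m - Suc 0))) * e + (e * - (- (u ^ 2))) * u ^ m
        = u ^ (m + 2) * e - real m * (u ^ Suc m * e)" for u e :: real
      by (cases m) (simp_all add: power2_eq_square algebra_simps)
    note this[of "1 / t" "exp (- (1 / t))"]
    moreover have "(1 / t) ^ (m + 2) * exp (- (1 / t)) - real m * ((1 / t) ^ Suc m * exp (- (1 / t)))
        = flat (m + 2) t - real m * flat (Suc m) t"
      using 3 by (simp add: flat_def)
    ultimately have "((\<lambda>t. (1 / t) ^ m * exp (- (1 / t))) has_real_derivative
        flat (m + 2) t - real m * flat (Suc m) t) (at t)"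
      by (simp only:)
    then show ?thesis
      by (rule has_field_derivative_transform_within_open[where S = "{0<..}"])
        (use 3 in \<open>auto simp: flat_def\<close>)
  qed
qed

text \<open>
  The derivative of \<open>flat m \<circ> f\<close> involves only \<open>flat\<close> with other indices, composed with the same \<open>f\<close>, so
  the induction on the order of differentiability runs for all \<open>m\<close> at once.
\<close>

lemma Ck_on_flat_comp: "Ck_on k UNIV f \<Longrightarrow> Ck_on k UNIV (\<lambda>x. flat m (f x))"
proof (induction k arbitrary: m)
  case 0
  have "continuous_on UNIV (flat m)"
    by (meson flat_derivative DERIV_isCont continuous_at_imp_continuous_on)
  then show ?case using 0 by (auto intro: continuous_on_compose2)
next
  case (Suc k)
  obtain D where D: "\<And>x. (f has_derivative D x) (at x)" "\<And>v. Ck_on k UNIV (\<lambda>x. D x v)"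
    using Ck_on_SucD[OF Suc.prems] by blast
  show ?case
  proof (rule Ck_on_SucI)
    show "((\<lambda>x. flat m (f x)) has_derivative
        (\<lambda>v. D x v * (flat (m + 2) (f x) + - real m * flat (Suc m) (f x)))) (at x)" for x
      using DERIV_compose_FDERIV[OF flat_derivative D(1)] by simp
    show "Ck_on k UNIV (\<lambda>x. D x v * (flat (m + 2) (f x) + - real m * flat (Suc m) (f x)))" for v
      using Suc.IH[OF Ck_on_pred[OF Suc.prems]] D(2)
      by (intro Ck_on_mult Ck_on_add Ck_on_const)
  qed
qed

section \<open>A regularised maximum\<close>

text \<open>
  For \<open>t > 0\<close> this is \<open>t exp(-1/t)\<close>, the perspective of the exponential function and therefore convex.
\<close>

definition smooth_pos :: "real \<Rightarrow> real" where
  "smooth_pos t = t * flat 0 t"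

lemma smooth_pos_nonpos: "t \<le> 0 \<Longrightarrow> smooth_pos t = 0"
  and smooth_pos_nonneg: "0 \<le> smooth_pos t"
  and smooth_pos_le: "smooth_pos t \<le> max 0 t"
  by (auto simp: smooth_pos_def flat_def mult_left_le)

lemma smooth_pos_ge: "t - 1 \<le> smooth_pos t"
proof (cases "t \<le> 0")
  case False
  then have "1 - 1 / t \<le> exp (- (1 / t))"
    using exp_ge_add_one_self[of "- (1 / t)"] by simp
  then have "t * (1 - 1 / t) \<le> t * exp (- (1 / t))"
    using False by (intro mult_left_mono) auto
  then show ?thesis using False by (simp add: smooth_pos_def flat_def algebra_simps)
qed (simp add: smooth_pos_def flat_def)

lemma smooth_pos_derivative:
  "(smooth_pos has_real_derivative flat 0 t + flat 1 t) (at t)"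
proof -
  have "(smooth_pos has_real_derivative t * (flat 2 t - 0) + flat 0 t) (at t)"
    unfolding smooth_pos_def
    using flat_derivative[of 0 t] by (auto intro!: derivative_eq_intros simp: numeral_2_eq_2)
  then show ?thesis using flat_mult[of t 1] by (simp add: numeral_2_eq_2 add.commute)
qed

lemma convex_smooth_pos: "convex_on UNIV smooth_pos"
proof (rule f''_ge0_imp_convex)
  show "((\<lambda>t. flat 0 t + flat 1 t) has_real_derivative flat 3 t) (at t)" for t
    using DERIV_add[OF flat_derivative[of 0 t] flat_derivative[of 1 t]]
    by (simp add: numeral_2_eq_2 numeral_3_eq_3)
qed (use smooth_pos_derivative in \<open>auto intro: flat_nonneg\<close>)

text \<open>
The derivative is \<open>(1 + 1/t) exp(-1/t)\<close>, and \<open>1 + u \<le> exp u\<close>.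
\<close>

lemma smooth_pos_slope: "0 \<le> flat 0 t + flat 1 t" "flat 0 t + flat 1 t \<le> 1"
proof -
  show "0 \<le> flat 0 t + flat 1 t" by (simp add: flat_nonneg)
  show "flat 0 t + flat 1 t \<le> 1"
  proof (cases "t \<le> 0")
    case False
    have "(1 + 1 / t) * exp (- (1 / t)) \<le> exp (1 / t) * exp (- (1 / t))"
      by (intro mult_right_mono exp_ge_add_one_self) auto
    then show ?thesis using False by (simp add: flat_def algebra_simps flip: exp_add)
  qed (simp add: flat_def)
qed

lemma smooth_pos_mono: "s \<le> t \<Longrightarrow> smooth_pos s \<le> smooth_pos t"
  by (metis DERIV_nonneg_imp_nondecreasing smooth_pos_derivative smooth_pos_slope(1))

lemma smooth_pos_lipschitz: "s \<le> t \<Longrightarrow> smooth_pos t - smooth_pos s \<le> t - s"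
proof -
  assume "s \<le> t"
  moreover have "((\<lambda>t. t - smooth_pos t) has_real_derivative 1 - (flat 0 u + flat 1 u)) (at u)" for u
    by (intro derivative_intros smooth_pos_derivative)
  ultimately have "s - smooth_pos s \<le> t - smooth_pos t"
    using DERIV_nonneg_imp_nondecreasing[of s t "\<lambda>t. t - smooth_pos t"] smooth_pos_slope(2)
    by (metis diff_ge_0_iff_ge)
  then show ?thesis by linarith
qed

text \<open>
  The maximum is \<open>b\<close> plus the positive part of \<open>a - b\<close>; here the positive part is smoothed at scale \<open>\<epsilon>\<close>.
\<close>

definition reg_max2 :: "real \<Rightarrow> real \<Rightarrow> real \<Rightarrow> real" where
  "reg_max2 \<epsilon> a b = b + \<epsilon> * smooth_pos ((a - b) / \<epsilon>)"

text \<open>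
  Monotonicity in \<open>b\<close> is the Lipschitz bound: the correction term decreases at most as fast as \<open>b\<close>
  grows.
\<close>

lemma reg_max2_mono:
  assumes "\<epsilon> > 0" "a \<le> a'" "b \<le> b'"
  shows "reg_max2 \<epsilon> a b \<le> reg_max2 \<epsilon> a' b'"
proof -
  have "\<epsilon> * (smooth_pos ((a - b) / \<epsilon>) - smooth_pos ((a - b') / \<epsilon>))
      \<le> \<epsilon> * ((a - b) / \<epsilon> - (a - b') / \<epsilon>)"
    using assms by (intro mult_left_mono smooth_pos_lipschitz divide_right_mono) auto
  also have "\<dots> = b' - b" using assms(1) by (simp add: field_simps)
  finally have "reg_max2 \<epsilon> a b \<le> reg_max2 \<epsilon> a b'"
    by (simp add: reg_max2_def right_diff_distrib)
  moreover have "reg_max2 \<epsilon> a b' \<le> reg_max2 \<epsilon> a' b'"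
    unfolding reg_max2_def using assms
    by (intro add_left_mono mult_left_mono smooth_pos_mono divide_right_mono) auto
  ultimately show ?thesis by linarith
qed

lemma
  assumes "\<epsilon> > 0"
  shows reg_max2_le: "reg_max2 \<epsilon> a b \<le> max a b"
    and reg_max2_ge1: "a - \<epsilon> \<le> reg_max2 \<epsilon> a b"
    and reg_max2_ge2: "b \<le> reg_max2 \<epsilon> a b"
    and reg_max2_eq: "a \<le> b \<Longrightarrow> reg_max2 \<epsilon> a b = b"
proof -
  have "\<epsilon> * smooth_pos ((a - b) / \<epsilon>) \<le> \<epsilon> * max 0 ((a - b) / \<epsilon>)"
    using assms by (intro mult_left_mono smooth_pos_le) auto
  also have "\<dots> = max 0 (a - b)" using assms by (simp add: max_def field_simps)
  finally show "reg_max2 \<epsilon> a b \<le> max a b" by (cases "a \<le> b") (auto simp: reg_max2_def)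
  have eq: "\<epsilon> * ((a - b) / \<epsilon> - 1) = a - b - \<epsilon>" using assms by (simp add: field_simps)
  have "\<epsilon> * ((a - b) / \<epsilon> - 1) \<le> \<epsilon> * smooth_pos ((a - b) / \<epsilon>)"
    using assms by (intro mult_left_mono smooth_pos_ge) auto
  then show "a - \<epsilon> \<le> reg_max2 \<epsilon> a b"
    using assms by (simp add: reg_max2_def eq)
  show "b \<le> reg_max2 \<epsilon> a b"
    using assms smooth_pos_nonneg by (simp add: reg_max2_def)
  show "a \<le> b \<Longrightarrow> reg_max2 \<epsilon> a b = b"
    using assms by (simp add: reg_max2_def smooth_pos_nonpos divide_nonpos_pos)
qed

lemma reg_max2_convex:
  assumes "\<epsilon> > 0" "0 \<le> t" "t \<le> 1"
  shows "reg_max2 \<epsilon> ((1 - t) * a + t * a') ((1 - t) * b + t * b')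
    \<le> (1 - t) * reg_max2 \<epsilon> a b + t * reg_max2 \<epsilon> a' b'"
proof -
  have eq: "((1 - t) * a + t * a' - ((1 - t) * b + t * b')) / \<epsilon>
      = (1 - t) *\<^sub>R ((a - b) / \<epsilon>) + t *\<^sub>R ((a' - b') / \<epsilon>)"
    using assms(1) by (simp add: field_simps)
  have "smooth_pos (((1 - t) * a + t * a' - ((1 - t) * b + t * b')) / \<epsilon>)
      \<le> (1 - t) * smooth_pos ((a - b) / \<epsilon>) + t * smooth_pos ((a' - b') / \<epsilon>)"
    unfolding eq using assms by (intro convex_onD[OF convex_smooth_pos]) auto
  then have "\<epsilon> * smooth_pos (((1 - t) * a + t * a' - ((1 - t) * b + t * b')) / \<epsilon>)
      \<le> \<epsilon> * ((1 - t) * smooth_pos ((a - b) / \<epsilon>) + t * smooth_pos ((a' - b') / \<epsilon>))"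
    using assms(1) by (intro mult_left_mono) auto
  then show ?thesis by (simp add: reg_max2_def algebra_simps)
qed

text \<open>
The linear part is kept apart because its vanishing on a cone decides on which strata the form lives.
\<close>

type_synonym 'b affine_form = "('b \<Rightarrow> real) \<times> real"

abbreviation aff :: "'b affine_form \<Rightarrow> 'b \<Rightarrow> real" where
  "aff p x \<equiv> fst p x + snd p"

text \<open>
The constant \<open>m\<close> is a floor: forms with values below it have no influence at all.
\<close>

primrec reg_max :: "real \<Rightarrow> real \<Rightarrow> 'b affine_form list \<Rightarrow> 'b \<Rightarrow> real" where
  "reg_max \<epsilon> m [] x = m"
| "reg_max \<epsilon> m (p # ps) x = reg_max2 \<epsilon> (aff p x) (reg_max \<epsilon> m ps x)"

lemma reg_max_ge_base: "\<epsilon> > 0 \<Longrightarrow> m \<le> reg_max \<epsilon> m ps x"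
  by (induction ps) (auto intro: order_trans reg_max2_ge2)

text \<open>
  The error is a single \<open>\<epsilon>\<close> for a list of any length, since each further form only raises the value.
\<close>

lemma reg_max_ge: "\<epsilon> > 0 \<Longrightarrow> p \<in> set ps \<Longrightarrow> aff p x - \<epsilon> \<le> reg_max \<epsilon> m ps x"
  by (induction ps) (auto intro: order_trans reg_max2_ge2 reg_max2_ge1)

lemma reg_max_le:
  "\<epsilon> > 0 \<Longrightarrow> m \<le> r \<Longrightarrow> (\<And>p. p \<in> set ps \<Longrightarrow> aff p x \<le> r) \<Longrightarrow> reg_max \<epsilon> m ps x \<le> r"
  by (induction ps) (auto intro: order_trans[OF reg_max2_le])

lemma reg_max_filter_le: "\<epsilon> > 0 \<Longrightarrow> reg_max \<epsilon> m (filter P ps) x \<le> reg_max \<epsilon> m ps x"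
  by (induction ps) (auto intro: reg_max2_mono order_trans[OF _ reg_max2_ge2])

text \<open>
  A form below the floor changes nothing, exactly and not just approximately.  Constancy towards the
  boundary rests on this.
\<close>

lemma reg_max_filter_eq:
  assumes "\<epsilon> > 0" "\<And>p. p \<in> set ps \<Longrightarrow> \<not> P p \<Longrightarrow> aff p x \<le> m"
  shows "reg_max \<epsilon> m (filter P ps) x = reg_max \<epsilon> m ps x"
  using assms(2)
proof (induction ps)
  case (Cons p ps)
  show ?case
  proof (cases "P p")
    case False
    then have "aff p x \<le> reg_max \<epsilon> m ps x"
      using Cons.prems reg_max_ge_base[OF assms(1)] by (meson list.set_intros(1) order_trans)
    then show ?thesis using False Cons by (simp add: reg_max2_eq[OF assms(1)])
  qed (use Cons in simp)
qed simp

lemma reg_max_translate: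
  "(\<And>p. p \<in> set ps \<Longrightarrow> linear (fst p)) \<Longrightarrow> (\<And>p. p \<in> set ps \<Longrightarrow> fst p v = 0) \<Longrightarrow>
    reg_max \<epsilon> m ps (x + v) = reg_max \<epsilon> m ps x"
  by (induction ps) (auto simp: linear_add)

text \<open>
  An affine form is inserted into a convex function by a jointly convex operation that is monotone in
  the convex argument.
\<close>

lemma convex_reg_max:
  assumes "\<epsilon> > 0" "\<And>p. p \<in> set ps \<Longrightarrow> linear (fst p)"
  shows "convex_on UNIV (reg_max \<epsilon> m ps)"
  using assms(2)
proof (induction ps)
  case Nil
  show ?case by (simp add: convex_on_const)
next
  case (Cons p ps)
  show ?case
  proof (rule convex_onI)
    fix t :: real and x y :: 'a assume t: "0 < t" "t < 1"
    have "linear (fst p)" using Cons.prems by simp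
    then have "aff p ((1 - t) *\<^sub>R x + t *\<^sub>R y) = (1 - t) * aff p x + t * aff p y"
      by (simp add: linear_add linear_scale distrib_left left_diff_distrib)
    moreover have "convex_on UNIV (reg_max \<epsilon> m ps)"
      using Cons by simp
    then have "reg_max \<epsilon> m ps ((1 - t) *\<^sub>R x + t *\<^sub>R y)
        \<le> (1 - t) * reg_max \<epsilon> m ps x + t * reg_max \<epsilon> m ps y"
      by (rule convex_onD) (use t in auto)
    ultimately have "reg_max \<epsilon> m (p # ps) ((1 - t) *\<^sub>R x + t *\<^sub>R y)
        \<le> reg_max2 \<epsilon> ((1 - t) * aff p x + t * aff p y)
            ((1 - t) * reg_max \<epsilon> m ps x + t * reg_max \<epsilon> m ps y)"
      using reg_max2_mono[OF assms(1)] by simp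
    also have "\<dots> \<le> (1 - t) * reg_max \<epsilon> m (p # ps) x + t * reg_max \<epsilon> m (p # ps) y"
      using reg_max2_convex[OF assms(1)] t by simp
    finally show "reg_max \<epsilon> m (p # ps) ((1 - t) *\<^sub>R x + t *\<^sub>R y)
        \<le> (1 - t) * reg_max \<epsilon> m (p # ps) x + t * reg_max \<epsilon> m (p # ps) y" .
  qed simp
qed

lemma Ck_on_reg_max:
  assumes "\<And>p. p \<in> set ps \<Longrightarrow> bounded_linear (fst p)"
  shows "Ck_on k UNIV (reg_max \<epsilon> m ps)"
  using assms
proof (induction ps)
  case Nil
  show ?case by (simp add: Ck_on_const)
next
  case (Cons p ps)
  define f where "f = reg_max \<epsilon> m ps"
  define d where "d = (\<lambda>x. (1 / \<epsilon>) * ((fst p x + snd p) + (- 1) * f x))"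
  have f: "Ck_on k UNIV f" using Cons by (simp add: f_def)
  have d: "Ck_on k UNIV d" unfolding d_def
    by (intro Ck_on_mult Ck_on_add Ck_on_const f Ck_on_bounded_linear Cons.prems) simp
  have "Ck_on k UNIV (\<lambda>x. f x + \<epsilon> * (d x * flat 0 (d x)))"
    by (intro Ck_on_mult Ck_on_add Ck_on_const f d Ck_on_flat_comp)
  moreover have "reg_max \<epsilon> m (p # ps) = (\<lambda>x. f x + \<epsilon> * (d x * flat 0 (d x)))"
    by (simp add: fun_eq_iff reg_max2_def smooth_pos_def f_def d_def diff_divide_distrib)
  ultimately show ?case by simp
qed

section \<open>Finite-dimensional spaces\<close>

text \<open>
A zonotope is a Minkowski sum of segments.
\<close>

lemma compact_zonotope:
  fixes A :: "'a::real_normed_vector set"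
  assumes "finite A"
  shows "compact {\<Sum>b\<in>A. c b *\<^sub>R b | c. \<forall>b\<in>A. \<bar>c b\<bar> \<le> (1::real)}"
  using assms
proof (induction A)
  case empty
  then show ?case by simp
next
  case (insert a A)
  let ?Z = "\<lambda>A. {\<Sum>b\<in>A. c b *\<^sub>R b | c. \<forall>b\<in>A. \<bar>c b\<bar> \<le> (1::real)}"
  have "compact ((\<lambda>t. t *\<^sub>R a) ` {-1..1::real})"
    by (intro compact_continuous_image continuous_intros compact_Icc)
  from compact_sums[OF this insert.IH]
  have "compact {x + y | x y. x \<in> (\<lambda>t. t *\<^sub>R a) ` {-1..1::real} \<and> y \<in> ?Z A}" .
  also have "{x + y | x y. x \<in> (\<lambda>t. t *\<^sub>R a) ` {-1..1::real} \<and> y \<in> ?Z A} = ?Z (insert a A)"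
  proof (intro equalityI subsetI)
    fix z assume "z \<in> {x + y | x y. x \<in> (\<lambda>t. t *\<^sub>R a) ` {-1..1::real} \<and> y \<in> ?Z A}"
    then obtain t c where tc: "\<bar>t\<bar> \<le> 1" "\<forall>b\<in>A. \<bar>c b\<bar> \<le> 1" "z = t *\<^sub>R a + (\<Sum>b\<in>A. c b *\<^sub>R b)"
      by (auto simp: abs_le_iff)
    have "(\<Sum>b\<in>A. c b *\<^sub>R b) = (\<Sum>b\<in>A. (c(a := t)) b *\<^sub>R b)"
      using insert.hyps by (intro sum.cong) auto
    then have "z = (\<Sum>b\<in>insert a A. (c(a := t)) b *\<^sub>R b)"
      using tc(3) insert.hyps by simp
    moreover have "\<forall>b\<in>insert a A. \<bar>(c(a := t)) b\<bar> \<le> 1" using tc by auto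
    ultimately show "z \<in> ?Z (insert a A)" by blast
  next
    fix z assume "z \<in> ?Z (insert a A)"
    then obtain c where c: "\<forall>b\<in>insert a A. \<bar>c b\<bar> \<le> 1" "z = (\<Sum>b\<in>insert a A. c b *\<^sub>R b)"
      by blast
    have "z = c a *\<^sub>R a + (\<Sum>b\<in>A. c b *\<^sub>R b)" using c(2) insert.hyps by simp
    moreover have "c a \<in> {-1..1}" using c(1) by (auto simp: abs_le_iff)
    ultimately show "z \<in> {x + y | x y. x \<in> (\<lambda>t. t *\<^sub>R a) ` {-1..1::real} \<and> y \<in> ?Z A}"
      using c(1) by blast
  qed
  finally show ?case .
qed

text \<open>
  Scale a vector so that its largest coordinate is 1.  It then lies in \<open>b + Z\<close> for some basis vector
  \<open>b\<close> and a zonotope \<open>Z\<close> spanned by the other ones.  This compact set misses 0 by independence, so it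
  has a positive distance from 0.
\<close>

lemma coordinates_bounded:
  fixes B :: "'a::real_normed_vector set"
  assumes "finite B" "independent B"
  obtains d :: real where "d > 0" "\<And>c b. b \<in> B \<Longrightarrow> d * \<bar>c b\<bar> \<le> norm (\<Sum>b\<in>B. c b *\<^sub>R b)"
proof -
  let ?Z = "\<lambda>A. {\<Sum>b\<in>A. c b *\<^sub>R b | c. \<forall>b\<in>A. \<bar>c b\<bar> \<le> (1::real)}"
  have "\<exists>d>0. \<forall>y \<in> ?Z (B - {a}). d \<le> norm (a + y)" if "a \<in> B" for a
  proof -
    have "compact ((+) a ` ?Z (B - {a}))"
      using assms(1) by (intro compact_translation compact_zonotope) simp
    then have "open (- ((+) a ` ?Z (B - {a})))"
      by (intro open_Compl compact_imp_closed)
    moreover have "0 \<notin> (+) a ` ?Z (B - {a})"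
    proof
      assume "0 \<in> (+) a ` ?Z (B - {a})"
      then obtain c where "0 = a + (\<Sum>b\<in>B - {a}. c b *\<^sub>R b)" by blast
      then have "a = - (\<Sum>b\<in>B - {a}. c b *\<^sub>R b)" by (simp add: eq_neg_iff_add_eq_0)
      moreover have "- (\<Sum>b\<in>B - {a}. c b *\<^sub>R b) \<in> span (B - {a})"
        by (intro span_neg span_sum span_scale span_base)
      ultimately have "a \<in> span (B - {a})" by metis
      then show False using assms(2) that by (auto simp: dependent_def)
    qed
    ultimately obtain d where d: "d > 0" "ball 0 d \<subseteq> - ((+) a ` ?Z (B - {a}))"
      by (meson ComplI openE)
    have "d \<le> norm (a + y)" if "y \<in> ?Z (B - {a})" for y
    proof (rule ccontr)
      assume "\<not> d \<le> norm (a + y)"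
      then have "a + y \<in> ball 0 d" by simp
      then have "a + y \<notin> (+) a ` ?Z (B - {a})" using d(2) by blast
      then show False using that by blast
    qed
    then show ?thesis using d(1) by blast
  qed
  then have "\<forall>a\<in>B. \<exists>d>0. \<forall>y \<in> ?Z (B - {a}). d \<le> norm (a + y)" by (intro ballI)
  from bchoice[OF this] obtain d where d_all:
      "\<forall>a\<in>B. 0 < d a \<and> (\<forall>y \<in> ?Z (B - {a}). d a \<le> norm (a + y))" ..
  have d: "d a > 0" "\<And>y. y \<in> ?Z (B - {a}) \<Longrightarrow> d a \<le> norm (a + y)" if "a \<in> B" for a
    using conjunct1[OF bspec[OF d_all that]] bspec[OF conjunct2[OF bspec[OF d_all that]]] by simp_all
  define D where "D = Min (insert 1 (d ` B))"
  have D: "D > 0" "\<And>a. a \<in> B \<Longrightarrow> D \<le> d a"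
    using assms(1) d(1) by (auto simp: D_def)
  show thesis
  proof (rule that[OF D(1)])
    fix c :: "'a \<Rightarrow> real" and b assume b: "b \<in> B"
    have "Max ((\<lambda>b. \<bar>c b\<bar>) ` B) \<in> (\<lambda>b. \<bar>c b\<bar>) ` B"
      using assms(1) b by (intro Max_in) auto
    then obtain a where a: "a \<in> B" "\<bar>c a\<bar> = Max ((\<lambda>b. \<bar>c b\<bar>) ` B)" by auto
    have le: "\<bar>c b'\<bar> \<le> \<bar>c a\<bar>" if "b' \<in> B" for b'
      unfolding a(2) using assms(1) that by (intro Max_ge) auto
    show "D * \<bar>c b\<bar> \<le> norm (\<Sum>b\<in>B. c b *\<^sub>R b)"
    proof (cases "c a = 0")
      case True
      then show ?thesis using le[OF b] by simp
    next
      case False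
      have "(\<Sum>b\<in>B. c b *\<^sub>R b) = c a *\<^sub>R a + (\<Sum>b\<in>B - {a}. c b *\<^sub>R b)"
        using assms(1) a(1) by (simp add: sum.remove)
      also have "(\<Sum>b\<in>B - {a}. c b *\<^sub>R b) = c a *\<^sub>R (\<Sum>b\<in>B - {a}. (c b / c a) *\<^sub>R b)"
        using False by (simp add: scaleR_sum_right)
      finally have eq: "(\<Sum>b\<in>B. c b *\<^sub>R b) = c a *\<^sub>R (a + (\<Sum>b\<in>B - {a}. (c b / c a) *\<^sub>R b))"
        by (simp add: scaleR_add_right)
      have "(\<Sum>b\<in>B - {a}. (c b / c a) *\<^sub>R b) \<in> ?Z (B - {a})"
        using le False by auto
      then have "D \<le> norm (a + (\<Sum>b\<in>B - {a}. (c b / c a) *\<^sub>R b))"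
        using d(2)[OF a(1)] D(2)[OF a(1)] by (meson order_trans)
      then have "D * \<bar>c b\<bar> \<le> norm (a + (\<Sum>b\<in>B - {a}. (c b / c a) *\<^sub>R b)) * \<bar>c a\<bar>"
        using le[OF b] D(1) by (intro mult_mono) auto
      then show ?thesis unfolding eq by (simp add: mult.commute)
    qed
  qed
qed

lemma basis_expansion:
  fixes B :: "'a::real_vector set"
  assumes "finite B" "span B = UNIV"
  obtains c where "x = (\<Sum>b\<in>B. c b *\<^sub>R b)"
proof -
  have "x \<in> range (\<lambda>u. \<Sum>b\<in>B. u b *\<^sub>R b)"
    using span_finite[OF assms(1)] assms(2) by (metis UNIV_I)
  then show thesis using that by auto
qed

lemma linear_imp_bounded_linear:
  fixes f :: "'a::real_normed_vector \<Rightarrow> 'b::real_normed_vector" and B :: "'a set"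
  assumes "finite B" "independent B" "span B = UNIV" "linear f"
  shows "bounded_linear f"
proof -
  obtain d where d: "d > 0" "\<And>c b. b \<in> B \<Longrightarrow> d * \<bar>c b\<bar> \<le> norm (\<Sum>b\<in>B. c b *\<^sub>R b)"
    using coordinates_bounded[OF assms(1,2)] by metis
  have "norm (f x) \<le> norm x * ((\<Sum>b\<in>B. norm (f b)) / d)" for x
  proof -
    obtain c where c: "x = (\<Sum>b\<in>B. c b *\<^sub>R b)" using basis_expansion[OF assms(1,3)] .
    have "norm (f x) \<le> (\<Sum>b\<in>B. norm (f (c b *\<^sub>R b)))"
      unfolding c linear_sum[OF assms(4)] by (rule norm_sum)
    also have "\<dots> = (\<Sum>b\<in>B. \<bar>c b\<bar> * norm (f b))"
      by (simp add: linear_scale[OF assms(4)])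
    also have "\<dots> \<le> (\<Sum>b\<in>B. (norm x / d) * norm (f b))"
      using d c by (intro sum_mono mult_right_mono) (auto simp: field_simps)
    also have "\<dots> = norm x * ((\<Sum>b\<in>B. norm (f b)) / d)"
      by (simp add: sum_distrib_left sum_divide_distrib mult.commute)
    finally show ?thesis .
  qed
  then show ?thesis
    using assms(4) by (intro bounded_linear_intro[where K = "(\<Sum>b\<in>B. norm (f b)) / d"])
      (auto simp: linear_add linear_scale)
qed

text \<open>
  A neighbourhood of \<open>x\<close> that is the hull of finitely many points.  The centre is included so that the
  hull is nonempty in dimension 0.
\<close>

definition cross_polytope :: "'a::real_vector set \<Rightarrow> 'a \<Rightarrow> real \<Rightarrow> 'a set" where
  "cross_polytope B x \<delta> = insert x ((\<lambda>b. x + \<delta> *\<^sub>R b) ` B \<union> (\<lambda>b. x - \<delta> *\<^sub>R b) ` B)"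

lemma ball_subset_cross_polytope:
  fixes B :: "'a::real_normed_vector set"
  assumes "finite B" "independent B" "span B = UNIV" "\<delta> > 0"
  obtains \<eta> where "\<eta> > 0" "\<And>x. ball x \<eta> \<subseteq> convex hull (cross_polytope B x \<delta>)"
proof -
  obtain d where d: "d > 0" "\<And>c b. b \<in> B \<Longrightarrow> d * \<bar>c b\<bar> \<le> norm (\<Sum>b\<in>B. c b *\<^sub>R b)"
    using coordinates_bounded[OF assms(1,2)] by metis
  define n where "n = real (card B) + 1"
  have n: "n > 0" "card B \<le> n" by (auto simp: n_def)
  show thesis
  proof (rule that)
    show "d * \<delta> / n > 0" using d(1) assms(4) n by simp
    show "ball x (d * \<delta> / n) \<subseteq> convex hull (cross_polytope B x \<delta>)" for x
    proof
      fix y assume "y \<in> ball x (d * \<delta> / n)"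
      then have y: "norm (y - x) < d * \<delta> / n" by (simp add: dist_norm norm_minus_commute)
      obtain c where c: "y - x = (\<Sum>b\<in>B. c b *\<^sub>R b)" using basis_expansion[OF assms(1,3)] .
      define v where "v b = x + (if c b \<ge> 0 then \<delta> else - \<delta>) *\<^sub>R b" for b
      define w where "w b = \<bar>c b\<bar> / \<delta>" for b
      have v: "v b \<in> convex hull (cross_polytope B x \<delta>)" if "b \<in> B" for b
        using that by (intro hull_inc) (auto simp: v_def cross_polytope_def)
      have w: "w b \<le> 1 / n" if "b \<in> B" for b
      proof -
        have "d * \<bar>c b\<bar> \<le> d * \<delta> / n" using d(2)[OF that, of c] y c by simp
        then have "d * \<bar>c b\<bar> \<le> d * (\<delta> / n)" by simp
        then have "\<bar>c b\<bar> \<le> \<delta> / n" using d(1) by (rule mult_left_le_imp_le)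
        then show ?thesis using assms(4) by (simp add: w_def field_simps)
      qed
      have "sum w B \<le> card B * (1 / n)" using w by (intro sum_bounded_above) auto
      also have "\<dots> \<le> 1" using n by (simp add: field_simps)
      finally have sw: "sum w B \<le> 1" .
      have ws: "w b *\<^sub>R (v b - x) = c b *\<^sub>R b" for b
        using assms(4) by (auto simp: w_def v_def)
      have "(1 - sum w B) *\<^sub>R x + (\<Sum>b\<in>B. w b *\<^sub>R v b) = x + (\<Sum>b\<in>B. w b *\<^sub>R (v b - x))"
        by (simp add: scaleR_diff_left scaleR_diff_right sum_subtractf scaleR_sum_left)
      also have "\<dots> = y" using ws c by (simp add: algebra_simps)
      finally have yeq: "(1 - sum w B) *\<^sub>R x + (\<Sum>b\<in>B. w b *\<^sub>R v b) = y" .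
      let ?w = "\<lambda>i. case i of None \<Rightarrow> 1 - sum w B | Some b \<Rightarrow> w b"
      let ?v = "\<lambda>i. case i of None \<Rightarrow> x | Some b \<Rightarrow> v b"
      have "x \<in> convex hull (cross_polytope B x \<delta>)"
        by (intro hull_inc) (auto simp: cross_polytope_def)
      then have "(\<Sum>i\<in>insert None (Some ` B). ?w i *\<^sub>R ?v i) \<in> convex hull (cross_polytope B x \<delta>)"
        using assms(1) v sw assms(4)
        by (intro convex_sum) (auto simp: sum.reindex w_def split: option.splits)
      then show "y \<in> convex hull (cross_polytope B x \<delta>)"
        using assms(1) yeq by (simp add: sum.reindex)
    qed
  qed
qed

text \<open>
  Closure under rational translations along the basis puts the vertices of a cross-polytope with
  centre in the dense set and rational radius back into the dense set.
\<close>

lemma countable_dense_of_finite_basis: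
  fixes B :: "'a::real_normed_vector set"
  assumes "finite B" "span B = UNIV"
  obtains Q where "countable Q" "\<And>x \<eta>. \<eta> > 0 \<Longrightarrow> \<exists>r\<in>Q. norm (r - x) < \<eta>"
    "\<And>r b q. r \<in> Q \<Longrightarrow> b \<in> B \<Longrightarrow> q \<in> \<rat> \<Longrightarrow> r + q *\<^sub>R b \<in> Q"
proof (rule that)
  define Q where "Q = (\<lambda>q. \<Sum>b\<in>B. q b *\<^sub>R b) ` (\<Pi>\<^sub>E b\<in>B. \<rat>::real set)"
  show "countable Q"
    unfolding Q_def using assms(1) countable_rat by (intro countable_image countable_PiE) auto
  show "\<exists>r\<in>Q. norm (r - x) < \<eta>" if "\<eta> > 0" for x \<eta>
  proof -
    obtain c where c: "x = (\<Sum>b\<in>B. c b *\<^sub>R b)" using basis_expansion[OF assms] .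
    define e where "e = \<eta> / (1 + (\<Sum>b\<in>B. norm b))"
    have s: "0 \<le> (\<Sum>b\<in>B. norm b)" by (simp add: sum_nonneg)
    have e: "e > 0" using that s by (simp add: e_def)
    have "\<exists>q\<in>\<rat>. \<bar>q - t\<bar> \<le> e" for t
    proof -
      obtain q where "q \<in> \<rat>" "t < q" "q < t + e"
        using Rats_dense_in_real[of t "t + e"] e by auto
      then show ?thesis by (intro bexI[of _ q]) auto
    qed
    then obtain f where f: "\<And>t. f t \<in> \<rat>" "\<And>t. \<bar>f t - t\<bar> \<le> e" by metis
    let ?r = "\<Sum>b\<in>B. f (c b) *\<^sub>R b"
    have "?r = (\<Sum>b\<in>B. restrict (f \<circ> c) B b *\<^sub>R b)" by simp
    moreover have "restrict (f \<circ> c) B \<in> (\<Pi>\<^sub>E b\<in>B. \<rat>)" using f(1) by auto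
    ultimately have "?r \<in> Q" unfolding Q_def by (rule image_eqI)
    have "norm (?r - x) = norm (\<Sum>b\<in>B. (f (c b) - c b) *\<^sub>R b)"
      by (simp add: c scaleR_diff_left sum_subtractf)
    also have "\<dots> \<le> (\<Sum>b\<in>B. norm ((f (c b) - c b) *\<^sub>R b))" by (rule norm_sum)
    also have "\<dots> \<le> (\<Sum>b\<in>B. e * norm b)"
      using f(2) by (intro sum_mono) (simp add: mult_right_mono)
    also have "\<dots> = e * (\<Sum>b\<in>B. norm b)" by (simp add: sum_distrib_left)
    also have "\<dots> < e * (1 + (\<Sum>b\<in>B. norm b))" using e by simp
    also have "\<dots> = \<eta>" using s by (simp add: e_def)
    finally show ?thesis using \<open>?r \<in> Q\<close> by blast
  qed
  show "r + q *\<^sub>R b \<in> Q" if "r \<in> Q" "b \<in> B" "q \<in> \<rat>" for r b q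
  proof -
    from that(1) obtain f where f2: "r = (\<Sum>b\<in>B. f b *\<^sub>R b)" and f1: "f \<in> (\<Pi>\<^sub>E b\<in>B. \<rat>)"
      unfolding Q_def by (rule imageE)
    have "r + q *\<^sub>R b = (\<Sum>a\<in>B. (f(b := f b + q)) a *\<^sub>R a)"
      unfolding f2 by (simp add: sum.remove[OF assms(1) that(2)] algebra_simps)
    moreover have "f(b := f b + q) \<in> (\<Pi>\<^sub>E b\<in>B. \<rat>)"
      using f1 that by (auto simp: PiE_iff extensional_def)
    ultimately show ?thesis unfolding Q_def by (rule image_eqI)
  qed
qed

section \<open>Polyhedral cones\<close>

text \<open>
  Weyl's theorem, by Fourier-Motzkin elimination.  The set \<open>M\<close> of functionals separates points, which is
  how finite dimension enters and settles the zero cone.  Adding a generator \<open>v\<close> means asking for some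
  \<open>t \<ge> 0\<close> with \<open>t * l v \<le> l x\<close> for all constraints \<open>l\<close>; such a \<open>t\<close> exists iff every lower bound on it
  is at most every upper bound, which gives one new constraint for each pair \<open>l v > 0 > m v\<close>.
\<close>

lemma finitely_generated_cone_polyhedral:
  fixes G :: "'b::real_vector set" and M :: "('b \<Rightarrow> real) set"
  assumes "finite G" "finite M" "\<And>l. l \<in> M \<Longrightarrow> linear l"
    and "\<And>x. (\<And>l. l \<in> M \<Longrightarrow> l x = 0) \<Longrightarrow> x = 0"
  shows "\<exists>L. finite L \<and> (\<forall>l\<in>L. linear l) \<and> convex_cone hull G = {x. \<forall>l\<in>L. (0::real) \<le> l x}"
  using assms(1)
proof (induction G)
  case empty
  let ?L = "M \<union> (\<lambda>l x. - l x) ` M"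
  have "{x. \<forall>l\<in>?L. 0 \<le> l x} = {0}"
  proof (intro equalityI subsetI)
    fix x assume x: "x \<in> {x. \<forall>l\<in>?L. 0 \<le> l x}"
    then have "l x = 0" if "l \<in> M" for l
      using that by (auto simp: ball_Un intro: antisym)
    then show "x \<in> {0}" using assms(4) by simp
  qed (use assms(3) in \<open>auto simp: linear_0\<close>)
  moreover have "finite ?L" "\<forall>l\<in>?L. linear l"
    using assms(2,3) by (auto intro: linear_compose_neg)
  ultimately show ?case by (intro exI[of _ ?L]) simp
next
  case (insert v G)
  from insert.IH obtain L where L_all: "finite L \<and> (\<forall>l\<in>L. linear l) \<and> convex_cone hull G = {x. \<forall>l\<in>L. (0::real) \<le> l x}"
    ..
  from L_all have L: "finite L" "\<And>l. l \<in> L \<Longrightarrow> linear l"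
      "convex_cone hull G = {x. \<forall>l\<in>L. 0 \<le> l x}"
    by simp_all
  let ?f = "\<lambda>(l, m) x. l x * (- m v) + m x * l v"
  let ?P = "{l \<in> L. 0 \<le> l v}" and ?N = "{l \<in> L. l v < 0}"
  let ?L = "?P \<union> ?f ` (?P \<times> ?N)"
  have hull_v: "convex_cone hull {v} = {t *\<^sub>R v | t. 0 \<le> t}"
    by (auto simp: convex_cone_hull_convex_hull intro: exI[of _ 0])
  have "convex_cone hull (insert v G) = {x. \<exists>t\<ge>0. x - t *\<^sub>R v \<in> convex_cone hull G}"
    (is "_ = ?R")
  proof -
    have "convex_cone hull (insert v G) = convex_cone hull ({v} \<union> G)" by simp
    also have "\<dots> = ?R"
    proof (intro equalityI subsetI)
      fix x assume "x \<in> convex_cone hull ({v} \<union> G)"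
      then obtain t y where ty: "t \<ge> 0" "y \<in> convex_cone hull G" "x = t *\<^sub>R v + y"
        unfolding convex_cone_hull_Un hull_v by auto
      then have "x - t *\<^sub>R v \<in> convex_cone hull G" by simp
      then show "x \<in> ?R" using ty(1) by blast
    next
      fix x assume "x \<in> ?R"
      then obtain t where t: "t \<ge> 0" "x - t *\<^sub>R v \<in> convex_cone hull G" by blast
      have "x = t *\<^sub>R v + (x - t *\<^sub>R v)" by simp
      then show "x \<in> convex_cone hull ({v} \<union> G)"
        unfolding convex_cone_hull_Un hull_v using t by blast
    qed
    finally show ?thesis .
  qed
  also have "\<dots> = {x. \<exists>t\<ge>0. \<forall>l\<in>L. t * l v \<le> l x}"
    unfolding L(3) using L(2) by (auto simp: linear_diff linear_scale)
  also have "\<dots> = {x. \<forall>l\<in>?L. 0 \<le> l x}"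
  proof (intro equalityI subsetI)
    fix x assume "x \<in> {x. \<exists>t\<ge>0. \<forall>l\<in>L. t * l v \<le> l x}"
    then obtain t where t: "t \<ge> 0" "\<And>l. l \<in> L \<Longrightarrow> t * l v \<le> l x" by blast
    have "0 \<le> l x" if "l \<in> ?P" for l
    proof -
      have "0 \<le> t * l v" using t(1) that by simp
      also have "\<dots> \<le> l x" using t(2) that by simp
      finally show ?thesis .
    qed
    moreover have "0 \<le> l x * (- m v) + m x * l v" if "l \<in> ?P" "m \<in> ?N" for l m
    proof -
      have "(t * l v) * (- m v) \<le> l x * (- m v)" "(t * m v) * l v \<le> m x * l v"
        using that t(2) by (auto intro!: mult_right_mono simp: mult_right_mono_neg)
      then show ?thesis by (simp add: algebra_simps)
    qed
    ultimately show "x \<in> {x. \<forall>l\<in>?L. 0 \<le> l x}" by auto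
  next
    fix x assume x: "x \<in> {x. \<forall>l\<in>?L. 0 \<le> l x}"
    define t where "t = Max (insert 0 ((\<lambda>m. m x / m v) ` ?N))"
    have fin: "finite (insert 0 ((\<lambda>m. m x / m v) ` ?N))" using L(1) by simp
    have "t \<ge> 0" using fin by (simp add: t_def)
    moreover have "t * l v \<le> l x" if l: "l \<in> L" for l
    proof (cases "l v < 0")
      case True
      then have "l x / l v \<le> t" unfolding t_def using fin l by (intro Max_ge) auto
      then show ?thesis using True by (simp add: field_simps)
    next
      case False
      then have lP: "l \<in> ?P" using l by simp
      have "t \<in> insert 0 ((\<lambda>m. m x / m v) ` ?N)"
        unfolding t_def using fin by (intro Max_in) auto
      then consider "t = 0" | m where "m \<in> ?N" "t = m x / m v" by blast
      then show ?thesis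
      proof cases
        case 1
        then show ?thesis using x lP by auto
      next
        case 2
        then have "?f (l, m) \<in> ?L" using lP by blast
        then have "0 \<le> ?f (l, m) x" using x by blast
        then have "0 \<le> l x * (- m v) + m x * l v" by simp
        moreover have "m x = t * m v" using 2 by simp
        ultimately have "t * l v * (- m v) \<le> l x * (- m v)" by (simp add: algebra_simps)
        then show ?thesis using 2(1) by (simp add: mult_right_le_imp_le)
      qed
    qed
    ultimately show "x \<in> {x. \<exists>t\<ge>0. \<forall>l\<in>L. t * l v \<le> l x}" by blast
  qed
  finally have "convex_cone hull (insert v G) = {x. \<forall>l\<in>?L. 0 \<le> l x}" .
  moreover have "finite ?L" using L(1) by simp
  moreover have "\<forall>l\<in>?L. linear l"
    using L(2) by (auto intro!: linearI simp: linear_add linear_scale algebra_simps)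
  ultimately show ?case by blast
qed

text \<open>
  The largest function that is convex, decreases along the cone generated by \<open>S\<close> and does not exceed
  \<open>y\<close> on \<open>D\<close> has as epigraph the points \<open>(w' + s', r)\<close> with \<open>(w', \<rho>)\<close> in the convex hull of the graph of
  \<open>y\<close>, \<open>s'\<close> in the cone and \<open>\<rho> \<le> r\<close>.  Homogenising it by one more coordinate gives a finitely generated
  cone, and the functionals that cut out this cone are the sought affine forms.  The last clause says
  that nothing is lost: a bound on all the forms at a point of the domain puts that point into the
  epigraph.
\<close>

lemma polyhedral_interpolation:
  fixes y :: "'a::real_vector \<Rightarrow> real" and B D S :: "'a set"
  assumes "finite B" "independent B" "span B = UNIV" "finite D" "finite S"
  obtains ps :: "'a affine_form list" where
    "\<And>p. p \<in> set ps \<Longrightarrow> linear (fst p)"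
    "\<And>p s. p \<in> set ps \<Longrightarrow> s \<in> S \<Longrightarrow> fst p s \<le> 0"
    "\<And>p g. p \<in> set ps \<Longrightarrow> g \<in> D \<Longrightarrow> aff p g \<le> y g"
    "\<And>w s r. w \<in> convex hull D \<Longrightarrow> s \<in> convex_cone hull S \<Longrightarrow>
      (\<And>p. p \<in> set ps \<Longrightarrow> aff p (w + s) \<le> r) \<Longrightarrow>
      \<exists>w' \<rho> s'. (w', \<rho>) \<in> convex hull ((\<lambda>g. (g, y g)) ` D) \<and> s' \<in> convex_cone hull S \<and>
        w + s = w' + s' \<and> \<rho> \<le> r"
proof -
  let ?gr = "(\<lambda>g. (g, y g)) ` D"
  let ?lift = "\<lambda>(x::'a, r::real). (x, r, 1::real)"
  let ?base = "\<lambda>s::'a. (s, 0::real, 0::real)"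
  let ?up = "(0::'a, 1::real, 0::real)"
  let ?G = "(?lift ` ?gr \<union> ?base ` S) \<union> {?up}"
  let ?K = "convex_cone hull ?G"
  let ?L0 = "(\<lambda>b (p::'a \<times> real \<times> real). representation B (fst p) b) ` B \<union>
     {\<lambda>p. fst (snd p), \<lambda>p. snd (snd p)}"
  have lin_base: "linear ?base" by (intro linearI) auto
  have "\<exists>L. finite L \<and> (\<forall>l\<in>L. linear l) \<and> ?K = {x. \<forall>l\<in>L. (0::real) \<le> l x}"
  proof (rule finitely_generated_cone_polyhedral[where M = ?L0])
    show "finite ?G" "finite ?L0" using assms by auto
    show "linear l" if "l \<in> ?L0" for l
      using that assms(2,3)
      by (auto intro!: linearI simp: representation_add representation_scale)
    show "p = 0" if "\<And>l. l \<in> ?L0 \<Longrightarrow> l p = 0" for p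
    proof -
      have "representation B (fst p) b = 0" if "b \<in> B" for b
        using \<open>\<And>l. l \<in> ?L0 \<Longrightarrow> l p = 0\<close> that by blast
      then have "fst p = 0"
        using sum_representation_eq[OF assms(2) _ assms(1) subset_refl, of "fst p"] assms(3) by simp
      moreover have "fst (snd p) = 0" "snd (snd p) = 0" using that by auto
      ultimately show ?thesis by (simp add: prod_eq_iff)
    qed
  qed
  then obtain L where "finite L \<and> (\<forall>l\<in>L. linear l) \<and> ?K = {x. \<forall>l\<in>L. (0::real) \<le> l x}"
    ..
  then have L: "finite L" "\<And>l. l \<in> L \<Longrightarrow> linear l" "?K = {x. \<forall>l\<in>L. 0 \<le> l x}"
    by simp_all
  have split: "l (x, r, h) = l (x, 0, 0) + r * l ?up + h * l (0, 0, 1)" if "l \<in> L" for l x r h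
  proof -
    note lin = L(2)[OF that]
    have "l (x, r, h) = l ((x, 0, 0) + r *\<^sub>R ?up + h *\<^sub>R (0, 0, 1))" by simp
    also have "\<dots> = l (x, 0, 0) + r * l ?up + h * l (0, 0, 1)"
      by (simp only: linear_add[OF lin] linear_scale[OF lin] real_scaleR_def)
    finally show ?thesis .
  qed
  have in_K: "0 \<le> l q" if "l \<in> L" "q \<in> ?K" for l q using that L(3) by blast
  have up_nonneg: "0 \<le> l ?up" if "l \<in> L" for l
    using in_K[OF that hull_inc[of ?up ?G]] by simp
  \<comment> \<open>A constraint involving the value coordinate is an affine lower bound for the value; one not
    involving it only cuts out the domain.\<close>
  let ?aff = "\<lambda>l::'a \<times> real \<times> real \<Rightarrow> real. (\<lambda>x. - l (x, 0, 0) / l ?up, - l (0, 0, 1) / l ?up)"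
  define A where "A = ?aff ` {l \<in> L. 0 < l ?up}"
  have "finite A" using L(1) by (simp add: A_def)
  then obtain ps where ps: "set ps = A" using finite_list by blast
  have aff_le: "aff (?aff l) x \<le> r \<longleftrightarrow> 0 \<le> l (x, r, 1)" if "l \<in> L" "0 < l ?up" for l x r
  proof -
    have "aff (?aff l) x = - (l (x, 0, 0) + l (0, 0, 1)) / l ?up"
      by (simp add: diff_divide_distrib)
    then show ?thesis
      using that(2) by (simp only: split[OF that(1), of x r 1]) (auto simp: field_simps)
  qed
  have lift_K: "?lift q \<in> ?K" if "q \<in> convex hull ?gr" for q
  proof -
    have "convex ?K" by (rule convex_convex_cone_hull)
    have "convex {q. ?lift q \<in> ?K}"
    proof (rule convexI)
      fix p q :: "'a \<times> real" and u v :: real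
      assume pq: "p \<in> {q. ?lift q \<in> ?K}" "q \<in> {q. ?lift q \<in> ?K}" "0 \<le> u" "0 \<le> v" "u + v = 1"
      then have "u *\<^sub>R ?lift p + v *\<^sub>R ?lift q \<in> ?K"
        by (intro convexD[OF \<open>convex ?K\<close>]) auto
      also have "u *\<^sub>R ?lift p + v *\<^sub>R ?lift q = ?lift (u *\<^sub>R p + v *\<^sub>R q)"
        using pq(5) by (auto simp: split_beta)
      finally show "u *\<^sub>R p + v *\<^sub>R q \<in> {q. ?lift q \<in> ?K}" by simp
    qed
    moreover have "?gr \<subseteq> {q. ?lift q \<in> ?K}" by (auto intro!: hull_inc)
    ultimately have "convex hull ?gr \<subseteq> {q. ?lift q \<in> ?K}" by (intro hull_minimal)
    then show ?thesis using that by blast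
  qed
  have hull_base: "convex_cone hull (?base ` S) = ?base ` (convex_cone hull S)"
    by (rule convex_cone_hull_linear_image[OF lin_base])
  have base_K: "?base s \<in> ?K" if "s \<in> convex_cone hull S" for s
  proof -
    have "?base s \<in> convex_cone hull (?base ` S)" unfolding hull_base using that by blast
    moreover have "convex_cone hull (?base ` S) \<subseteq> ?K" by (rule hull_mono) blast
    ultimately show ?thesis by blast
  qed
  have hull_gr: "convex hull D = fst ` (convex hull ?gr)"
    by (simp add: convex_hull_linear_image[OF linear_fst] image_image)
  show thesis
  proof
    fix p assume "p \<in> set ps"
    then obtain l where l: "l \<in> L" "0 < l ?up" "p = ?aff l" by (auto simp: ps A_def)
    note lin = L(2)[OF l(1)]
    have "linear (\<lambda>x. l (x, 0, 0))"
      using linear_compose[OF lin_base lin] by (simp add: comp_def)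
    note additive = linear_add[OF this] and homogeneous = linear_scale[OF this]
    show "linear (fst p)"
      unfolding l(3) fst_conv
      by (rule linearI) (simp_all only: additive homogeneous minus_add_distrib add_divide_distrib
          real_scaleR_def mult_minus_right times_divide_eq_right)
    show "fst p s \<le> 0" if "s \<in> S" for s
      using in_K[OF l(1) base_K[OF hull_inc[of s S]]] that l(2,3) by (simp add: field_simps)
    show "aff p g \<le> y g" if "g \<in> D" for g
    proof -
      have "0 \<le> l (g, y g, 1)" by (rule in_K[OF l(1)]) (use that in \<open>auto intro!: hull_inc\<close>)
      then show ?thesis using aff_le[OF l(1,2)] l(3) by blast
    qed
  next
    fix w s r
    assume w: "w \<in> convex hull D" and s: "s \<in> convex_cone hull S"
      and r: "\<And>p. p \<in> set ps \<Longrightarrow> aff p (w + s) \<le> r"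
    obtain \<rho>0 where "(w, \<rho>0) \<in> convex hull ?gr" using w hull_gr by auto
    then have "?lift (w, \<rho>0) + ?base s \<in> ?K"
      using lift_K base_K[OF s] by (blast intro: convex_cone_hull_add)
    then have K0: "(w + s, \<rho>0, 1) \<in> ?K" by simp
    have "0 \<le> l (w + s, r, 1)" if l: "l \<in> L" for l
    proof (cases "0 < l ?up")
      case True
      then have "?aff l \<in> set ps" using l by (auto simp: ps A_def)
      then show ?thesis using r aff_le[OF l True] by blast
    next
      case False
      then have "l ?up = 0" using up_nonneg[OF l] by simp
      then show ?thesis
        using in_K[OF l K0] split[OF l, of "w + s" \<rho>0 1] split[OF l, of "w + s" r 1] by simp
    qed
    then have "(w + s, r, 1) \<in> ?K" using L(3) by simp
    then obtain a b c where abc: "a \<in> convex_cone hull (?lift ` ?gr)"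
        "b \<in> convex_cone hull (?base ` S)" "c \<in> convex_cone hull {?up}" "(w + s, r, 1) = a + b + c"
      unfolding convex_cone_hull_Un by blast
    obtain s' where s': "s' \<in> convex_cone hull S" "b = (s', 0, 0)"
      using abc(2) unfolding hull_base by blast
    obtain t where t: "t \<ge> 0" "c = t *\<^sub>R ?up"
    proof -
      have "convex_cone hull {?up} = insert 0 (\<Union>c\<in>{0..}. {c *\<^sub>R ?up})"
        by (simp add: convex_cone_hull_convex_hull)
      then consider "c = 0" | t where "t \<ge> 0" "c = t *\<^sub>R ?up" using abc(3) by auto
      then show thesis
      proof cases
        case 1
        then have "c = 0 *\<^sub>R ?up" by (simp add: zero_prod_def)
        then show thesis by (rule that[OF order_refl])
      qed (rule that)
    qed
    have "convex hull (?lift ` ?gr) \<subseteq> ?lift ` (convex hull ?gr)"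
    proof (rule hull_minimal)
      show "?lift ` ?gr \<subseteq> ?lift ` (convex hull ?gr)" by (intro image_mono hull_subset)
      have eq: "?lift ` (convex hull ?gr)
          = (+) (0, 0, 1) ` (\<lambda>p. (fst p, snd p, 0)) ` (convex hull ?gr)"
        by (auto simp: image_image split_beta)
      have "linear (\<lambda>p::'a \<times> real. (fst p, snd p, 0::real))" by (intro linearI) auto
      then show "convex (?lift ` (convex hull ?gr))"
        unfolding eq by (intro convex_translation convex_linear_image) auto
    qed
    then obtain h q where hq: "a = 0 \<or> a = h *\<^sub>R ?lift q \<and> q \<in> convex hull ?gr"
      using abc(1) unfolding convex_cone_hull_convex_hull by blast
    have "snd (snd a) = 1" using arg_cong[OF abc(4), of "\<lambda>p. snd (snd p)"] s' t by simp
    then have q: "q \<in> convex hull ?gr" "h = 1" "a = ?lift q"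
      using hq by (auto simp: split_beta)
    have "w + s = fst q + s'" "r = snd q + t"
      using abc(4) q(3) s'(2) t(2) by (auto simp: split_beta)
    moreover have "(fst q, snd q) \<in> convex hull ?gr" using q(1) by simp
    ultimately show "\<exists>w' \<rho> s'. (w', \<rho>) \<in> convex hull ?gr \<and> s' \<in> convex_cone hull S \<and>
        w + s = w' + s' \<and> \<rho> \<le> r"
      using s'(1) t(1) by (metis add.commute le_add_same_cancel2)
  qed
qed

section \<open>Convexity with values in the extended reals\<close>

text \<open>
  Bounding by real numbers above the values avoids arithmetic with \<open>-\<infinity>\<close>.
\<close>

lemma ereal_convex_iff:
  fixes a b c :: ereal
  assumes "a < \<infinity>" "b < \<infinity>" "0 < t" "t < 1"
  shows "c \<le> ereal (1 - t) * a + ereal t * b \<longleftrightarrow>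
    (\<forall>A B. a \<le> ereal A \<longrightarrow> b \<le> ereal B \<longrightarrow> c \<le> ereal ((1 - t) * A + t * B))"
proof
  assume c: "c \<le> ereal (1 - t) * a + ereal t * b"
  show "\<forall>A B. a \<le> ereal A \<longrightarrow> b \<le> ereal B \<longrightarrow> c \<le> ereal ((1 - t) * A + t * B)"
  proof (intro allI impI)
    fix A B assume "a \<le> ereal A" "b \<le> ereal B"
    then have "ereal (1 - t) * a + ereal t * b \<le> ereal (1 - t) * ereal A + ereal t * ereal B"
      using assms by (intro add_mono ereal_mult_left_mono) auto
    then show "c \<le> ereal ((1 - t) * A + t * B)" using c by simp
  qed
next
  assume R: "\<forall>A B. a \<le> ereal A \<longrightarrow> b \<le> ereal B \<longrightarrow> c \<le> ereal ((1 - t) * A + t * B)"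
  have infty: "c = -\<infinity>" if "\<And>K. c \<le> ereal K"
    using that by (metis ereal_bot)
  consider "a = -\<infinity>" | "b = -\<infinity>" | A B where "a = ereal A" "b = ereal B"
    using assms(1,2) by (cases a; cases b) auto
  then show "c \<le> ereal (1 - t) * a + ereal t * b"
  proof cases
    case 1
    obtain B where B: "b \<le> ereal B" using assms(2) by (cases b) auto
    have "c \<le> ereal K" for K
      using R[rule_format, of "(K - t * B) / (1 - t)" B] 1 B assms(4) by simp
    then show ?thesis using infty by simp
  next
    case 2
    obtain A where A: "a \<le> ereal A" using assms(1) by (cases a) auto
    have "c \<le> ereal K" for K
      using R[rule_format, of A "(K - (1 - t) * A) / t"] 2 A assms(3) by simp
    then show ?thesis using infty by simp
  next
    case 3
    then show ?thesis using R by simp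
  qed
qed

definition seg_convex :: "'a::real_vector set \<Rightarrow> ('a \<Rightarrow> ereal) \<Rightarrow> bool" where
  "seg_convex W \<psi> \<longleftrightarrow> (\<forall>x y t A B. closed_segment x y \<subseteq> W \<longrightarrow> 0 \<le> t \<longrightarrow> t \<le> 1 \<longrightarrow>
     \<psi> x \<le> ereal A \<longrightarrow> \<psi> y \<le> ereal B \<longrightarrow>
     \<psi> ((1 - t) *\<^sub>R x + t *\<^sub>R y) \<le> ereal ((1 - t) * A + t * B))"

lemma seg_convexD:
  assumes "seg_convex W \<psi>" "closed_segment x y \<subseteq> W" "0 \<le> t" "t \<le> 1"
    "\<psi> x \<le> ereal A" "\<psi> y \<le> ereal B"
  shows "\<psi> ((1 - t) *\<^sub>R x + t *\<^sub>R y) \<le> ereal ((1 - t) * A + t * B)"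
  using assms unfolding seg_convex_def by blast

lemma ereal_le_of_all_real_gt:
  fixes a b :: ereal
  assumes "\<And>A. b < ereal A \<Longrightarrow> a \<le> ereal A"
  shows "a \<le> b"
proof (rule ccontr)
  assume "\<not> a \<le> b"
  then obtain A where "b < ereal A" "ereal A < a"
    using ereal_dense2[of b a] by (auto simp: not_le)
  then show False using assms by (meson leD)
qed

text \<open>
  A fixed point of the ray is a convex combination of the origin \<open>p\<close> and a very remote point, with
  nearly all the weight on \<open>p\<close>.
\<close>

lemma seg_convex_ray_nonincreasing:
  fixes v :: "'a::real_vector"
  assumes "seg_convex W \<psi>" "\<And>\<mu>. \<mu> \<ge> 0 \<Longrightarrow> p + \<mu> *\<^sub>R v \<in> W"
    and "\<forall>\<^sub>F \<mu> in at_top. \<psi> (p + \<mu> *\<^sub>R v) \<le> ereal C" "\<mu> \<ge> 0"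
  shows "\<psi> (p + \<mu> *\<^sub>R v) \<le> \<psi> p"
proof (cases "\<mu> = 0")
  case False
  with \<open>\<mu> \<ge> 0\<close> have \<mu>: "\<mu> > 0" by simp
  show ?thesis
  proof (rule ereal_le_of_all_real_gt)
    fix A assume A: "\<psi> p < ereal A"
    obtain M where M: "\<And>\<nu>. \<nu> \<ge> M \<Longrightarrow> \<psi> (p + \<nu> *\<^sub>R v) \<le> ereal C"
      using assms(3) by (auto simp: eventually_at_top_linorder)
    have "\<forall>\<^sub>F n in sequentially. \<psi> (p + \<mu> *\<^sub>R v)
        \<le> ereal ((1 - inverse (real (Suc n))) * A + inverse (real (Suc n)) * C)"
    proof -
      obtain n0 :: nat where n0: "M / \<mu> \<le> real n0" using real_arch_simple by blast
      have "\<psi> (p + \<mu> *\<^sub>R v)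
          \<le> ereal ((1 - inverse (real (Suc n))) * A + inverse (real (Suc n)) * C)"
        if "n \<ge> n0" for n
      proof -
        let ?y = "p + (real (Suc n) * \<mu>) *\<^sub>R v"
        have "M / \<mu> \<le> real (Suc n)" using n0 that by linarith
        then have "M \<le> real (Suc n) * \<mu>" using \<mu> by (simp add: pos_divide_le_eq)
        then have "\<psi> ?y \<le> ereal C" by (rule M)
        moreover have "closed_segment p ?y \<subseteq> W"
        proof
          fix z assume "z \<in> closed_segment p ?y"
          then obtain u where u: "0 \<le> u" "z = (1 - u) *\<^sub>R p + u *\<^sub>R ?y"
            by (auto simp: closed_segment_def)
          then have "z = p + (u * (real (Suc n) * \<mu>)) *\<^sub>R v" by (simp add: algebra_simps)
          then show "z \<in> W" using assms(2) u(1) \<mu> by simp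
        qed
        moreover have "\<psi> p \<le> ereal A" using A by simp
        ultimately have "\<psi> ((1 - inverse (real (Suc n))) *\<^sub>R p + inverse (real (Suc n)) *\<^sub>R ?y)
            \<le> ereal ((1 - inverse (real (Suc n))) * A + inverse (real (Suc n)) * C)"
          by (intro seg_convexD[OF assms(1)]) (auto simp: inverse_le_1_iff)
        moreover have "(1 - inverse (real (Suc n))) *\<^sub>R p + inverse (real (Suc n)) *\<^sub>R ?y
            = p + \<mu> *\<^sub>R v"
        proof -
          have "(1 - c) *\<^sub>R p + c *\<^sub>R (p + (d * \<mu>) *\<^sub>R v) = p + (c * d * \<mu>) *\<^sub>R v" for c d
            by (simp add: algebra_simps)
          then show ?thesis by simp
        qed
        ultimately show ?thesis by simp
      qed
      then show ?thesis by (auto simp: eventually_sequentially)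
    qed
    moreover have "(\<lambda>n. ereal ((1 - inverse (real (Suc n))) * A + inverse (real (Suc n)) * C))
        \<longlonglongrightarrow> ereal ((1 - 0) * A + 0 * C)"
      by (intro tendsto_intros LIMSEQ_inverse_real_of_nat)
    ultimately have "\<psi> (p + \<mu> *\<^sub>R v) \<le> ereal ((1 - 0) * A + 0 * C)"
      by (intro tendsto_lowerbound) auto
    then show "\<psi> (p + \<mu> *\<^sub>R v) \<le> ereal A" by simp
  qed
qed simp

text \<open>
  If the maximum were not attained, the sets \<open>{f < f y}\<close> would cover \<open>K\<close>, and a finite subcover would
  have a largest \<open>f y\<close> with \<open>y\<close> itself uncovered.
\<close>

lemma usc_attains_max:
  fixes f :: "'b::topological_space \<Rightarrow> 'c::linorder"
  assumes "compact K" "K \<noteq> {}" "\<And>a. openin (top_of_set K) {x \<in> K. f x < a}"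
  obtains x where "x \<in> K" "\<And>y. y \<in> K \<Longrightarrow> f y \<le> f x"
proof -
  have "\<exists>x\<in>K. \<forall>y\<in>K. f y \<le> f x"
  proof (rule ccontr)
    assume "\<not> (\<exists>x\<in>K. \<forall>y\<in>K. f y \<le> f x)"
    then have "\<And>x. x \<in> K \<Longrightarrow> \<exists>y\<in>K. f x < f y" by (meson not_le)
    then have "K \<subseteq> \<Union> ((\<lambda>y. {x \<in> K. f x < f y}) ` K)" by blast
    moreover have "\<forall>c\<in>(\<lambda>y. {x \<in> K. f x < f y}) ` K. openin (top_of_set K) c"
      using assms(3) by blast
    ultimately have "\<exists>\<C>\<subseteq>(\<lambda>y. {x \<in> K. f x < f y}) ` K. finite \<C> \<and> K \<subseteq> \<Union>\<C>"
      using assms(1) unfolding compact_eq_openin_cover by simp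
    then obtain \<C> where \<C>: "\<C> \<subseteq> (\<lambda>y. {x \<in> K. f x < f y}) ` K" "finite \<C>" "K \<subseteq> \<Union>\<C>"
      by blast
    obtain Y where "Y \<subseteq> K" "finite Y" "\<C> = (\<lambda>y. {x \<in> K. f x < f y}) ` Y"
      using finite_subset_image[OF \<C>(2,1)] by blast
    with \<C>(3) have Y: "Y \<subseteq> K" "finite Y" "K \<subseteq> (\<Union>y\<in>Y. {x \<in> K. f x < f y})"
      by simp_all
    then have "Y \<noteq> {}" using assms(2) by blast
    then have "Max (f ` Y) \<in> f ` Y" using Y(2) by (intro Max_in) auto
    then obtain y where y: "y \<in> Y" "f y = Max (f ` Y)" by auto
    then obtain z where z: "z \<in> Y" "f y < f z" using Y(1,3) by blast
    then have "f z \<le> f y" unfolding y(2) using Y(2) by (intro Max_ge) auto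
    then show False using z(2) by simp
  qed
  then show thesis using that by blast
qed

text \<open>
  If \<open>\<psi>\<close> exceeds a chord somewhere on a segment, subtract from it the chord plus a small strictly
  concave function vanishing at the ends.  The difference still has a positive maximum, at an interior
  point, but it is strictly convex near that point.
\<close>

lemma seg_convex_if_locally_midpoint_convex:
  fixes W :: "'a::real_normed_vector set"
  assumes fin: "\<And>x. x \<in> W \<Longrightarrow> \<psi> x < \<infinity>"
    and usc: "\<And>a::real. open {x \<in> W. \<psi> x < ereal a}"
    and mid: "\<And>z. z \<in> W \<Longrightarrow> \<exists>\<eta>>0. \<forall>w A B. norm w < \<eta> \<longrightarrow> \<psi> (z - w) \<le> ereal A \<longrightarrow>
      \<psi> (z + w) \<le> ereal B \<longrightarrow> \<psi> z \<le> ereal ((A + B) / 2)"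
  shows "seg_convex W \<psi>"
  unfolding seg_convex_def
proof (intro allI impI, rule ccontr)
  fix x y t A B
  assume seg: "closed_segment x y \<subseteq> W" and t: "0 \<le> t" "t \<le> 1"
    and A: "\<psi> x \<le> ereal A" and B: "\<psi> y \<le> ereal B"
    and neg: "\<not> \<psi> ((1 - t) *\<^sub>R x + t *\<^sub>R y) \<le> ereal ((1 - t) * A + t * B)"
  define \<gamma> where "\<gamma> s = (1 - s) *\<^sub>R x + s *\<^sub>R y" for s :: real
  have \<gamma>W: "\<gamma> s \<in> W" if "s \<in> {0..1}" for s
    using seg that by (auto simp: \<gamma>_def closed_segment_def)
  have \<gamma>_cont: "continuous_on S \<gamma>" for S
    unfolding \<gamma>_def by (intro continuous_intros)
  obtain r where r: "\<psi> (\<gamma> t) = ereal r"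
    using fin[OF \<gamma>W] t neg by (cases "\<psi> (\<gamma> t)") (auto simp: \<gamma>_def)
  \<comment> \<open>The excess over the chord; since \<open>s (1 - s) \<le> 1/4\<close>, the concave correction \<open>\<kappa> s (1 - s)\<close> uses
    up at most a quarter of it.\<close>
  define \<kappa> where "\<kappa> = r - ((1 - t) * A + t * B)"
  have \<kappa>: "\<kappa> > 0" using neg r by (simp add: \<kappa>_def \<gamma>_def)
  define q where "q s = (1 - s) * A + s * B + \<kappa> * (s * (1 - s))" for s
  have q_cont: "continuous_on S q" for S
    unfolding q_def by (intro continuous_intros)
  define G where "G s = \<psi> (\<gamma> s) - ereal (q s)" for s
  have G_less: "G s < ereal c \<longleftrightarrow> \<psi> (\<gamma> s) < ereal (c + q s)"
    and G_le: "G s \<le> ereal c \<longleftrightarrow> \<psi> (\<gamma> s) \<le> ereal (c + q s)" for s c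
    unfolding G_def by (cases "\<psi> (\<gamma> s)"; auto)+
  have "openin (top_of_set {0..1}) {s \<in> {0..1}. G s < a}" for a
  proof (subst openin_subopen, intro ballI)
    fix s assume s: "s \<in> {s \<in> {0..1}. G s < a}"
    then obtain c where c: "G s < ereal c" "ereal c < a"
      using ereal_dense2[of "G s" a] by auto
    then have "\<psi> (\<gamma> s) < ereal (c + q s)" using G_less by simp
    then obtain d where d: "\<psi> (\<gamma> s) < ereal d" "d < c + q s"
      using ereal_dense2 less_ereal.simps(1) by meson
    have open1: "openin (top_of_set {0..1}) ({0..1} \<inter> \<gamma> -` {x \<in> W. \<psi> x < ereal d})"
      by (rule continuous_openin_preimage_gen[OF \<gamma>_cont usc])
    have open2: "openin (top_of_set {0..1}) ({0..1} \<inter> (\<lambda>s. c + q s) -` {d<..})"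
      by (rule continuous_openin_preimage_gen) (auto intro: continuous_intros q_cont)
    let ?T = "({0..1} \<inter> \<gamma> -` {x \<in> W. \<psi> x < ereal d}) \<inter> ({0..1} \<inter> (\<lambda>s. c + q s) -` {d<..})"
    have "openin (top_of_set {0..1}) ?T" using open1 open2 by (rule openin_Int)
    moreover have "s \<in> ?T" using s d \<gamma>W by auto
    moreover have "?T \<subseteq> {s \<in> {0..1}. G s < a}"
    proof
      fix u assume u: "u \<in> ?T"
      then have "\<psi> (\<gamma> u) < ereal (c + q u)"
        by (auto intro: less_trans)
      then have "G u < a" using c(2) G_less by (meson less_trans)
      then show "u \<in> {s \<in> {0..1}. G s < a}" using u by auto
    qed
    ultimately show "\<exists>T. openin (top_of_set {0..1}) T \<and> s \<in> T \<and> T \<subseteq> {s \<in> {0..1}. G s < a}"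
      by blast
  qed
  then obtain s where s: "s \<in> {0..1}" and max: "\<And>u. u \<in> {0..1} \<Longrightarrow> G u \<le> G s"
    using usc_attains_max[of "{0..1::real}" G] by auto
  have "G t = ereal (r - q t)" by (simp add: G_def r)
  moreover have "0 < r - q t"
  proof -
    have "\<kappa> * (t * (1 - t)) \<le> \<kappa> * (1 / 4)"
      using \<kappa> sum_squares_ge_zero[of "t - 1/2" 0]
      by (intro mult_left_mono) (auto simp: algebra_simps)
    moreover have "r - q t = \<kappa> - \<kappa> * (t * (1 - t))" by (simp add: q_def \<kappa>_def)
    ultimately show ?thesis using \<kappa> by linarith
  qed
  ultimately have "0 < G t" by (metis ereal_less(2))
  then have Gs_pos: "0 < G s" using max[of t] t by auto
  have "G s < \<infinity>" using fin[OF \<gamma>W[OF s]] by (cases "\<psi> (\<gamma> s)") (auto simp: G_def)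
  then obtain M where M: "G s = ereal M" using Gs_pos by (cases "G s") auto
  have M_pos: "0 < M" using Gs_pos M by simp
  have psi_s: "\<psi> (\<gamma> s) = ereal (M + q s)"
    using M by (cases "\<psi> (\<gamma> s)") (auto simp: G_def)
  have "G 0 \<le> ereal 0" "G 1 \<le> ereal 0"
    unfolding G_le using A B by (simp_all add: q_def \<gamma>_def)
  then have s01: "0 < s" "s < 1"
    using s M M_pos by (auto simp: less_le)
  obtain \<eta> where \<eta>: "\<eta> > 0" "\<And>w A B. norm w < \<eta> \<Longrightarrow> \<psi> (\<gamma> s - w) \<le> ereal A \<Longrightarrow>
      \<psi> (\<gamma> s + w) \<le> ereal B \<Longrightarrow> \<psi> (\<gamma> s) \<le> ereal ((A + B) / 2)"
    using mid[OF \<gamma>W[OF s]] by blast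
  define h where "h = min (min s (1 - s)) (\<eta> / (2 * (norm (y - x) + 1)))"
  have np: "norm (y - x) + 1 > 0" by (simp add: add_nonneg_pos)
  have h: "h > 0" "h \<le> s" "h \<le> 1 - s" using s01 \<eta>(1) np by (auto simp: h_def)
  have "norm (h *\<^sub>R (y - x)) < \<eta>"
  proof -
    have "h * norm (y - x) \<le> \<eta> / (2 * (norm (y - x) + 1)) * (norm (y - x) + 1)"
      using h np \<eta>(1) by (intro mult_mono) (auto simp: h_def)
    also have "\<dots> = \<eta> / 2" using np by (simp add: field_simps)
    finally show ?thesis using h \<eta>(1) by simp
  qed
  moreover have "\<gamma> s - h *\<^sub>R (y - x) = \<gamma> (s - h)" "\<gamma> s + h *\<^sub>R (y - x) = \<gamma> (s + h)"
    by (simp_all add: \<gamma>_def algebra_simps)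
  moreover have "\<psi> (\<gamma> u) \<le> ereal (M + q u)" if "u \<in> {0..1}" for u
    using max[OF that] M G_le by simp
  ultimately have "\<psi> (\<gamma> s) \<le> ereal (((M + q (s - h)) + (M + q (s + h))) / 2)"
    using h s01 by (intro \<eta>(2)[where w = "h *\<^sub>R (y - x)"]) auto
  moreover have "((M + q (s - h)) + (M + q (s + h))) / 2 = M + q s - \<kappa> * h * h"
    by (simp add: q_def algebra_simps) (simp add: field_simps)
  ultimately have "\<kappa> * h * h \<le> 0" using psi_s by simp
  then show False using \<kappa> h(1) by (simp add: mult_le_0_iff)
qed

section \<open>Neighbourhoods in the space of a fan\<close>

lemma quot_eq_iff: "quot \<sigma> x = quot \<tau> y \<longleftrightarrow> \<sigma> = \<tau> \<and> x - y \<in> span \<sigma>"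
proof -
  have "(+) x ` span \<sigma> = (+) y ` span \<sigma> \<longleftrightarrow> x - y \<in> span \<sigma>"
  proof
    assume "(+) x ` span \<sigma> = (+) y ` span \<sigma>"
    moreover have "x + 0 \<in> (+) x ` span \<sigma>" by (intro imageI span_zero)
    ultimately obtain v where "v \<in> span \<sigma>" "x = y + v" by auto
    then show "x - y \<in> span \<sigma>" by simp
  next
    assume d: "x - y \<in> span \<sigma>"
    have "a + v \<in> (+) b ` span \<sigma>" if "a - b \<in> span \<sigma>" "v \<in> span \<sigma>" for a b v
    proof -
      have "a + v = b + ((a - b) + v)" by simp
      moreover have "(a - b) + v \<in> span \<sigma>" using that by (rule span_add)
      ultimately show ?thesis by (rule image_eqI)
    qed
    moreover have "y - x \<in> span \<sigma>" using span_neg[OF d] by simp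
    ultimately show "(+) x ` span \<sigma> = (+) y ` span \<sigma>" using d by blast
  qed
  then show ?thesis by (auto simp: quot_def)
qed

lemma set_plus_cone_translate:
  assumes "convex_cone \<sigma>" "x \<in> \<Omega> + \<sigma>" "s \<in> \<sigma>"
  shows "x + s \<in> \<Omega> + \<sigma>"
proof -
  obtain \<omega> r where wr: "\<omega> \<in> \<Omega>" "r \<in> \<sigma>" "x = \<omega> + r"
    using assms(2) by (auto simp: set_plus_def)
  then have "\<omega> + (r + s) \<in> \<Omega> + \<sigma>"
    using convex_cone_add[OF assms(1) _ assms(3)] by (intro set_plus_intro)
  then show ?thesis by (simp add: wr(3) add.assoc)
qed

lemma open_set_plus:
  fixes \<Omega> \<sigma> :: "'a::real_normed_vector set"
  assumes "open \<Omega>"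
  shows "open (\<Omega> + \<sigma>)"
proof -
  have "\<Omega> + \<sigma> = (\<Union>s\<in>\<sigma>. (+) s ` \<Omega>)"
    unfolding set_plus_def by (auto simp: image_iff) (metis add.commute)+
  then show ?thesis using open_translation[OF assms] by auto
qed

lemma strictly_convex_cone_zero_face:
  assumes "convex_cone \<sigma>" "strictly_convex_cone \<sigma>"
  shows "{0} face_of \<sigma>"
  unfolding face_of_def
proof (intro conjI ballI impI)
  show "{0} \<subseteq> \<sigma>" using convex_cone_contains_0[OF assms(1)] by simp
  have *: "a = 0" if "a \<in> \<sigma>" "b \<in> \<sigma>" "0 < u" "u < 1" "0 = (1 - u) *\<^sub>R a + u *\<^sub>R b" for a b and u :: real
  proof -
    have "(1 - u) *\<^sub>R a \<in> \<sigma>" "u *\<^sub>R b \<in> \<sigma>"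
      using that convex_cone_scaleR[OF assms(1)] by simp_all
    moreover have "(1 - u) *\<^sub>R a = - (u *\<^sub>R b)" using that(5) by (simp add: eq_neg_iff_add_eq_0)
    ultimately have "(1 - u) *\<^sub>R a \<in> \<sigma> \<inter> uminus ` \<sigma>" by auto
    also have "\<dots> = {0}" using assms(2) by (simp only: strictly_convex_cone_def)
    finally show ?thesis using that(4) by simp
  qed
  fix a b x assume ab: "a \<in> \<sigma>" "b \<in> \<sigma>" and "x \<in> {0}" "x \<in> open_segment a b"
  then obtain u where u: "0 < u" "u < 1" "0 = (1 - u) *\<^sub>R a + u *\<^sub>R b"
    by (auto simp: in_segment)
  show "a \<in> {0}" using *[OF ab u] by simp
  have "0 = (1 - (1 - u)) *\<^sub>R b + (1 - u) *\<^sub>R a" using u(3) by (simp add: add.commute)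
  then show "b \<in> {0}" using *[OF ab(2,1), of "1 - u"] u by simp
qed auto

lemma fan_zero_face:
  assumes "fan N \<Sigma>" "\<sigma> \<in> \<Sigma>"
  shows "{0} face_of \<sigma>" "{0} \<in> \<Sigma>"
proof -
  show "{0} face_of \<sigma>"
    using strictly_convex_cone_zero_face[OF fan_convex_cone[OF assms]] assms
    by (auto simp: fan_def)
  then show "{0} \<in> \<Sigma>" using assms unfolding fan_def by blast
qed

lemma fan_face_refl: "fan N \<Sigma> \<Longrightarrow> \<sigma> \<in> \<Sigma> \<Longrightarrow> \<sigma> face_of \<sigma>"
  using fan_convex_cone by (auto simp: convex_cone_def intro: face_of_refl)

text \<open>
  An element of \<open>span \<tau>\<close> is a difference of two elements of \<open>\<tau>\<close>, and the first one is absorbed by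
  \<open>\<Omega> + \<sigma>\<close>.
\<close>

lemma quot_in_basic_nbhd_iff:
  assumes "fan N \<Sigma>" "\<sigma> \<in> \<Sigma>"
  shows "quot \<tau> x \<in> basic_nbhd \<Sigma> \<sigma> \<Omega> \<longleftrightarrow>
    \<tau> \<in> \<Sigma> \<and> \<tau> face_of \<sigma> \<and> (\<exists>t\<in>\<tau>. x + t \<in> \<Omega> + \<sigma>)"
proof
  assume "quot \<tau> x \<in> basic_nbhd \<Sigma> \<sigma> \<Omega>"
  then obtain y where y: "\<tau> \<in> \<Sigma>" "\<tau> face_of \<sigma>" "y \<in> \<Omega> + \<sigma>" "x - y \<in> span \<tau>"
    by (auto simp: basic_nbhd_def quot_eq_iff)
  obtain s t where st: "s \<in> \<tau>" "t \<in> \<tau>" "x - y = s - t"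
    using span_convex_cone[OF fan_convex_cone[OF assms(1) y(1)] y(4)] by metis
  have "s \<in> \<sigma>" using st(1) face_of_imp_subset[OF y(2)] by blast
  obtain \<omega> r where "\<omega> \<in> \<Omega>" "r \<in> \<sigma>" "y = \<omega> + r" using y(3) by (auto simp: set_plus_def)
  moreover have "x + t = y + s" using st(3) by (simp add: algebra_simps)
  ultimately have "x + t = \<omega> + (r + s)" "r + s \<in> \<sigma>"
    using convex_cone_add[OF fan_convex_cone[OF assms]] \<open>s \<in> \<sigma>\<close> by (auto simp: add.assoc)
  then have "x + t \<in> \<Omega> + \<sigma>" using \<open>\<omega> \<in> \<Omega>\<close> by (auto intro: set_plus_intro)
  then show "\<tau> \<in> \<Sigma> \<and> \<tau> face_of \<sigma> \<and> (\<exists>t\<in>\<tau>. x + t \<in> \<Omega> + \<sigma>)" using y st by blast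
next
  assume "\<tau> \<in> \<Sigma> \<and> \<tau> face_of \<sigma> \<and> (\<exists>t\<in>\<tau>. x + t \<in> \<Omega> + \<sigma>)"
  then obtain t where t: "\<tau> \<in> \<Sigma>" "\<tau> face_of \<sigma>" "t \<in> \<tau>" "x + t \<in> \<Omega> + \<sigma>" by blast
  have "quot \<tau> x = quot \<tau> (x + t)"
    using span_neg[OF span_base[OF t(3)]] by (simp add: quot_eq_iff)
  then show "quot \<tau> x \<in> basic_nbhd \<Sigma> \<sigma> \<Omega>" using t by (auto simp: basic_nbhd_def)
qed

lemma incl_in_basic_nbhd_iff:
  assumes "fan N \<Sigma>" "\<sigma> \<in> \<Sigma>"
  shows "incl x \<in> basic_nbhd \<Sigma> \<sigma> \<Omega> \<longleftrightarrow> x \<in> \<Omega> + \<sigma>"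
  using fan_zero_face[OF assms] by (simp add: quot_in_basic_nbhd_iff[OF assms])

lemma incl_in_superset_of_basic_nbhd:
  assumes "fan N \<Sigma>" "\<sigma> \<in> \<Sigma>" "basic_nbhd \<Sigma> \<sigma> \<Omega> \<subseteq> U" "x \<in> \<Omega> + \<sigma>"
  shows "incl x \<in> U"
  using assms(3,4) incl_in_basic_nbhd_iff[OF assms(1,2)] by blast

lemma openin_basic_nbhd:
  "\<sigma> \<in> \<Sigma> \<Longrightarrow> bounded \<Omega> \<Longrightarrow> open \<Omega> \<Longrightarrow> convex \<Omega> \<Longrightarrow> openin (NS_topology \<Sigma>) (basic_nbhd \<Sigma> \<sigma> \<Omega>)"
  unfolding NS_topology_def by (intro topology_generated_by_Basis) blast

lemma basic_nbhd_mono: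
  assumes "\<tau> face_of \<sigma>" "\<Omega> + \<tau> \<subseteq> \<Omega>' + \<sigma>"
  shows "basic_nbhd \<Sigma> \<tau> \<Omega> \<subseteq> basic_nbhd \<Sigma> \<sigma> \<Omega>'"
  unfolding basic_nbhd_def using face_of_trans[OF _ assms(1)] assms(2) by blast

lemma openin_NS_nbhdE:
  assumes "fan N \<Sigma>" "openin (NS_topology \<Sigma>) W" "quot \<tau> x \<in> W"
  obtains \<Omega> \<omega> where "\<tau> \<in> \<Sigma>" "bounded \<Omega>" "open \<Omega>" "convex \<Omega>" "\<omega> \<in> \<Omega>" "x - \<omega> \<in> span \<tau>"
    "basic_nbhd \<Sigma> \<tau> \<Omega> \<subseteq> W"
proof -
  have W: "W \<subseteq> (\<Union>\<sigma>\<in>\<Sigma>. stratum \<sigma>)" "\<And>\<sigma> p. \<sigma> \<in> \<Sigma> \<Longrightarrow> p \<in> W \<inter> stratum \<sigma> \<Longrightarrow>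
     \<exists>\<Omega>. bounded \<Omega> \<and> open \<Omega> \<and> convex \<Omega> \<and> p \<in> quot \<sigma> ` \<Omega> \<and> basic_nbhd \<Sigma> \<sigma> \<Omega> \<subseteq> W"
    using assms(2) unfolding openin_NS_topology[OF assms(1)] by blast+
  have \<tau>: "\<tau> \<in> \<Sigma>" using W(1) assms(3) by (auto simp: quot_eq_iff)
  obtain \<Omega> where "bounded \<Omega>" "open \<Omega>" "convex \<Omega>" "quot \<tau> x \<in> quot \<tau> ` \<Omega>" "basic_nbhd \<Sigma> \<tau> \<Omega> \<subseteq> W"
    using W(2)[OF \<tau>, of "quot \<tau> x"] assms(3) by blast
  then show thesis using that[OF \<tau>] by (auto simp: quot_eq_iff)
qed

lemma open_incl_vimage:
  assumes "fan N \<Sigma>" "openin (NS_topology \<Sigma>) W"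
  shows "open (incl -` W)"
proof (subst open_subopen, intro ballI)
  fix x assume "x \<in> incl -` W"
  then have "incl x \<in> W" by simp
  then obtain \<Omega> \<omega> where \<Omega>: "{0} \<in> \<Sigma>" "open \<Omega>" "\<omega> \<in> \<Omega>" "x - \<omega> \<in> span {0}"
      "basic_nbhd \<Sigma> {0} \<Omega> \<subseteq> W"
    by (rule openin_NS_nbhdE[OF assms])
  then have "x \<in> \<Omega>" by simp
  moreover have "\<Omega> \<subseteq> incl -` W"
  proof
    fix y assume "y \<in> \<Omega>"
    then have "y \<in> \<Omega> + {0}" by (force simp: set_plus_def)
    then show "y \<in> incl -` W"
      using \<Omega>(5) incl_in_basic_nbhd_iff[OF assms(1) \<Omega>(1)] by auto
  qed
  ultimately show "\<exists>T. open T \<and> x \<in> T \<and> T \<subseteq> incl -` W" using \<Omega>(2) by blast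
qed

lemma convex_cone_sum:
  assumes "convex_cone C" "finite A" "\<And>s. s \<in> A \<Longrightarrow> 0 \<le> c s" "A \<subseteq> C"
  shows "(\<Sum>s\<in>A. c s *\<^sub>R s) \<in> C"
  using assms(2-4)
proof (induction A rule: finite_induct)
  case empty
  show ?case using convex_cone_contains_0[OF assms(1)] by simp
next
  case (insert a A)
  then show ?case
    using convex_cone_add[OF assms(1)] convex_cone_scaleR[OF assms(1)] by simp
qed

text \<open>
  The sum of a finite set of generators lies in the relative interior of the cone: a large multiple
  of it makes all the coefficients of \<open>t\<close> nonnegative.
\<close>

lemma fan_cone_absorbing:
  assumes "fan N \<Sigma>" "\<tau> \<in> \<Sigma>"
  obtains v where "v \<in> \<tau>" "\<And>t. t \<in> span \<tau> \<Longrightarrow> \<forall>\<^sub>F \<mu>::real in at_top. t + \<mu> *\<^sub>R v \<in> \<tau>"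
proof -
  obtain S where S: "finite S" "\<tau> = convex_cone hull S"
    using assms by (auto simp: fan_def rational_cone_def dest!: bspec)
  have cc: "convex_cone \<tau>" by (rule fan_convex_cone[OF assms])
  have S\<tau>: "S \<subseteq> \<tau>" unfolding S(2) by (rule hull_subset)
  have "\<tau> \<subseteq> span S"
    unfolding S(2) by (intro hull_minimal span_superset convex_cone_span)
  then have span: "span \<tau> \<subseteq> span S" by (metis span_mono span_span)
  show thesis
  proof
    show "(\<Sum>s\<in>S. s) \<in> \<tau>"
      using convex_cone_sum[OF cc S(1) _ S\<tau>, of "\<lambda>_. 1"] by simp
    fix t assume "t \<in> span \<tau>"
    then obtain u where u: "t = (\<Sum>s\<in>S. u s *\<^sub>R s)"
      using span span_finite[OF S(1)] by auto
    have "t + \<mu> *\<^sub>R (\<Sum>s\<in>S. s) \<in> \<tau>" if "\<mu> \<ge> (\<Sum>s\<in>S. \<bar>u s\<bar>)" for \<mu>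
    proof -
      have "0 \<le> u s + \<mu>" if "s \<in> S" for s
        using member_le_sum[OF that, of "\<lambda>s. \<bar>u s\<bar>"] S(1) \<open>\<mu> \<ge> _\<close> by simp
      then have "(\<Sum>s\<in>S. (u s + \<mu>) *\<^sub>R s) \<in> \<tau>"
        by (intro convex_cone_sum[OF cc S(1) _ S\<tau>]) simp
      then show ?thesis
        by (simp add: u scaleR_add_left sum.distrib scaleR_sum_right)
    qed
    then show "\<forall>\<^sub>F \<mu>::real in at_top. t + \<mu> *\<^sub>R (\<Sum>s\<in>S. s) \<in> \<tau>"
      unfolding eventually_at_top_linorder by blast
  qed
qed

text \<open>
  Every boundary point is reached along a ray, as soon as the direction is interior to the cone of
  its stratum.
\<close>

lemma ray_limit:
  assumes "fan N \<Sigma>" "\<tau> \<in> \<Sigma>"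
  obtains v where "v \<in> \<tau>"
    "\<And>p. limitin (NS_topology \<Sigma>) (\<lambda>\<mu>::real. incl (p + \<mu> *\<^sub>R v)) (quot \<tau> p) at_top"
proof -
  obtain v where v: "v \<in> \<tau>" "\<And>t. t \<in> span \<tau> \<Longrightarrow> \<forall>\<^sub>F \<mu>::real in at_top. t + \<mu> *\<^sub>R v \<in> \<tau>"
    using fan_cone_absorbing[OF assms] by metis
  show thesis
  proof (rule that[OF v(1)])
    fix p
    have 0: "0 \<in> \<tau>" by (rule convex_cone_contains_0[OF fan_convex_cone[OF assms]])
    have "p + 0 \<in> ball p 1 + \<tau>" using 0 by (intro set_plus_intro) auto
    then have "\<exists>t\<in>\<tau>. p + t \<in> ball p 1 + \<tau>" using 0 by (rule bexI)
    then have "quot \<tau> p \<in> basic_nbhd \<Sigma> \<tau> (ball p 1)"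
      using assms fan_face_refl[OF assms] by (simp add: quot_in_basic_nbhd_iff[OF assms])
    moreover have "openin (NS_topology \<Sigma>) (basic_nbhd \<Sigma> \<tau> (ball p 1))"
      using assms(2) by (intro openin_basic_nbhd) auto
    ultimately have "quot \<tau> p \<in> topspace (NS_topology \<Sigma>)"
      using openin_subset by blast
    moreover have "\<forall>\<^sub>F \<mu> in at_top. incl (p + \<mu> *\<^sub>R v) \<in> W"
      if W: "openin (NS_topology \<Sigma>) W" "quot \<tau> p \<in> W" for W
    proof -
      obtain \<Omega> \<omega> where \<Omega>: "\<omega> \<in> \<Omega>" "p - \<omega> \<in> span \<tau>" "basic_nbhd \<Sigma> \<tau> \<Omega> \<subseteq> W"
        using openin_NS_nbhdE[OF assms(1) W] by metis
      show ?thesis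
        using v(2)[OF \<Omega>(2)]
      proof eventually_elim
        case (elim \<mu>)
        then have "\<omega> + (p - \<omega> + \<mu> *\<^sub>R v) \<in> \<Omega> + \<tau>" using \<Omega>(1) by (intro set_plus_intro)
        then show ?case using \<Omega>(3) incl_in_basic_nbhd_iff[OF assms] by auto
      qed
    qed
    ultimately show "limitin (NS_topology \<Sigma>) (\<lambda>\<mu>::real. incl (p + \<mu> *\<^sub>R v)) (quot \<tau> p) at_top"
      by (auto simp: limitin_def)
  qed
qed

section \<open>Plurisubharmonic functions\<close>

lemma psh_onD_less_infty: "psh_on \<Sigma> U \<phi> \<Longrightarrow> p \<in> U \<Longrightarrow> \<phi> p < \<infinity>"
  unfolding psh_on_def by blast

lemma psh_onD_usc:
  "psh_on \<Sigma> U \<phi> \<Longrightarrow> openin (NS_topology \<Sigma>) U \<Longrightarrow>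
    openin (NS_topology \<Sigma>) {p \<in> U. \<phi> p < ereal a}"
  unfolding psh_on_def using openin_trans_full by blast

lemma psh_onD_limit:
  assumes "psh_on \<Sigma> U \<phi>" "v \<in> \<Union>\<Sigma>" "\<And>\<mu>. \<mu> \<ge> 0 \<Longrightarrow> incl (p + \<mu> *\<^sub>R v) \<in> U"
    "limitin (NS_topology \<Sigma>) (\<lambda>\<mu>::real. incl (p + \<mu> *\<^sub>R v)) q at_top" "q \<in> U"
  shows "\<phi> q \<le> \<phi> (incl p)"
  using assms unfolding psh_on_def by blast

text \<open>
  On an open set, relative openness is openness, and the convexity condition can be stated with real
  bounds.
\<close>

lemma psh_on_iff_seg_convex:
  assumes "openin (NS_topology \<Sigma>) U"
  shows "psh_on \<Sigma> U \<phi> \<longleftrightarrow>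
    (\<forall>p\<in>U. \<phi> p < \<infinity>) \<and>
    (\<forall>a::real. openin (NS_topology \<Sigma>) {p \<in> U. \<phi> p < ereal a}) \<and>
    seg_convex (incl -` U) (\<lambda>x. \<phi> (incl x)) \<and>
    (\<forall>p q. \<forall>v\<in>\<Union>\<Sigma>. (\<forall>\<mu>\<ge>0. incl (p + \<mu> *\<^sub>R v) \<in> U) \<and>
        limitin (NS_topology \<Sigma>) (\<lambda>\<mu>::real. incl (p + \<mu> *\<^sub>R v)) q at_top \<and> q \<in> U \<longrightarrow>
        \<phi> q \<le> \<phi> (incl p))"
proof -
  have "openin (subtopology (NS_topology \<Sigma>) U) {p \<in> U. \<phi> p < ereal a} \<longleftrightarrow>
      openin (NS_topology \<Sigma>) {p \<in> U. \<phi> p < ereal a}" for a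
    using openin_open_subtopology[OF assms] by auto
  moreover have "(\<forall>x y. incl ` closed_segment x y \<subseteq> U \<longrightarrow>
        (\<forall>t\<in>{0<..<1}. \<phi> (incl ((1 - t) *\<^sub>R x + t *\<^sub>R y))
             \<le> ereal (1 - t) * \<phi> (incl x) + ereal t * \<phi> (incl y)))
      \<longleftrightarrow> seg_convex (incl -` U) (\<lambda>x. \<phi> (incl x))" (is "?L \<longleftrightarrow> ?R")
    if fin: "\<forall>p\<in>U. \<phi> p < \<infinity>"
  proof -
    have iff: "\<phi> (incl ((1 - t) *\<^sub>R x + t *\<^sub>R y))
          \<le> ereal (1 - t) * \<phi> (incl x) + ereal t * \<phi> (incl y) \<longleftrightarrow>
        (\<forall>A B. \<phi> (incl x) \<le> ereal A \<longrightarrow> \<phi> (incl y) \<le> ereal B \<longrightarrow>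
          \<phi> (incl ((1 - t) *\<^sub>R x + t *\<^sub>R y)) \<le> ereal ((1 - t) * A + t * B))"
      if "incl ` closed_segment x y \<subseteq> U" "t \<in> {0<..<1}" for x y t
    proof (rule ereal_convex_iff)
      have "incl x \<in> U" "incl y \<in> U" using that(1) by auto
      then show "\<phi> (incl x) < \<infinity>" "\<phi> (incl y) < \<infinity>" using fin by auto
    qed (use that in auto)
    show ?thesis
    proof
      assume L: ?L
      show ?R
        unfolding seg_convex_def
      proof (intro allI impI)
        fix x y A B and t :: real
        assume seg: "closed_segment x y \<subseteq> incl -` U" and t: "0 \<le> t" "t \<le> 1"
          and AB: "\<phi> (incl x) \<le> ereal A" "\<phi> (incl y) \<le> ereal B"
        have seg': "incl ` closed_segment x y \<subseteq> U" using seg by blast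
        consider "t = 0" | "t = 1" | "0 < t \<and> t < 1" using t by linarith
        then show "\<phi> (incl ((1 - t) *\<^sub>R x + t *\<^sub>R y)) \<le> ereal ((1 - t) * A + t * B)"
        proof cases
          case 3
          then have "t \<in> {0<..<1}" by simp
          then show ?thesis using L seg' iff[OF seg' \<open>t \<in> {0<..<1}\<close>] AB by blast
        qed (use AB in simp_all)
      qed
    next
      assume R: ?R
      show ?L
      proof (intro allI impI ballI)
        fix x y t assume seg: "incl ` closed_segment x y \<subseteq> U" and t: "t \<in> {0<..<1::real}"
        show "\<phi> (incl ((1 - t) *\<^sub>R x + t *\<^sub>R y))
             \<le> ereal (1 - t) * \<phi> (incl x) + ereal t * \<phi> (incl y)"
          unfolding iff[OF seg t]
        proof (intro allI impI)
          fix A B assume "\<phi> (incl x) \<le> ereal A" "\<phi> (incl y) \<le> ereal B"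
          moreover have "closed_segment x y \<subseteq> incl -` U" using seg by blast
          ultimately show "\<phi> (incl ((1 - t) *\<^sub>R x + t *\<^sub>R y)) \<le> ereal ((1 - t) * A + t * B)"
            using seg_convexD[OF R, of x y t A B] t by auto
        qed
      qed
    qed
  qed
  ultimately show ?thesis
    unfolding psh_on_def by (auto simp only: cong: conj_cong)
qed

lemma seg_convex_mono: "seg_convex W \<psi> \<Longrightarrow> W' \<subseteq> W \<Longrightarrow> seg_convex W' \<psi>"
  unfolding seg_convex_def by blast

text \<open>
Upper semicontinuity at the limit point bounds the function on the end of the ray.
\<close>

lemma ray_nonincreasing_if_limit:
  assumes "seg_convex (incl -` U) (\<lambda>x. \<phi> (incl x))"
    and "\<And>a::real. openin (NS_topology \<Sigma>) {p \<in> U. \<phi> p < ereal a}"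
    and "\<And>\<mu>. \<mu> \<ge> 0 \<Longrightarrow> incl (p + \<mu> *\<^sub>R v) \<in> U"
    and "limitin (NS_topology \<Sigma>) (\<lambda>\<mu>::real. incl (p + \<mu> *\<^sub>R v)) q at_top" "q \<in> U" "\<phi> q < \<infinity>"
    and "\<mu> \<ge> 0"
  shows "\<phi> (incl (p + \<mu> *\<^sub>R v)) \<le> \<phi> (incl p)"
proof -
  obtain C where C: "\<phi> q < ereal C" using assms(6) ereal_dense2 by blast
  then have "\<forall>\<^sub>F \<mu> in at_top. incl (p + \<mu> *\<^sub>R v) \<in> {p \<in> U. \<phi> p < ereal C}"
    using assms(2,4,5) unfolding limitin_def by blast
  then have "\<forall>\<^sub>F \<mu> in at_top. \<phi> (incl (p + \<mu> *\<^sub>R v)) \<le> ereal C"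
    by eventually_elim auto
  then show ?thesis
    using seg_convex_ray_nonincreasing[OF assms(1) _ _ assms(7), of p v C] assms(3) by simp
qed

lemma psh_on_if_locally_decreasing_limit:
  assumes fan: "fan N \<Sigma>" and U: "openin (NS_topology \<Sigma>) U"
    and fin: "\<forall>p\<in>U. \<phi> p < \<infinity>"
    and loc: "\<forall>p\<in>U. \<exists>V. openin (NS_topology \<Sigma>) V \<and> p \<in> V \<and> V \<subseteq> U \<and>
       decreasing_limit_of_smooth_psh \<Sigma> V \<phi>"
  shows "psh_on \<Sigma> U \<phi>"
proof -
  have loc': "\<exists>V f. openin (NS_topology \<Sigma>) V \<and> p \<in> V \<and> V \<subseteq> U \<and>
      (\<forall>k. psh_on \<Sigma> V (\<lambda>p. ereal (f k p))) \<and> (\<forall>p\<in>V. (\<lambda>k. ereal (f k p)) \<longlonglongrightarrow> \<phi> p) \<and>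
      (\<forall>p\<in>V. \<forall>k. \<phi> p \<le> ereal (f k p))" if "p \<in> U" for p
  proof -
    obtain V where V: "openin (NS_topology \<Sigma>) V" "p \<in> V" "V \<subseteq> U"
        "decreasing_limit_of_smooth_psh \<Sigma> V \<phi>"
      using bspec[OF loc \<open>p \<in> U\<close>] by (elim exE conjE)
    obtain f where f: "\<forall>k. smooth_on \<Sigma> V (f k) \<and> psh_on \<Sigma> V (\<lambda>p. ereal (f k p))"
        "\<forall>p\<in>V. decseq (\<lambda>k. f k p) \<and> (\<lambda>k. ereal (f k p)) \<longlonglongrightarrow> \<phi> p"
      using V(4) unfolding decreasing_limit_of_smooth_psh_def by blast
    have "\<phi> q \<le> ereal (f k q)" if "q \<in> V" for q k
    proof (rule tendsto_upperbound)
      show "(\<lambda>k. ereal (f k q)) \<longlonglongrightarrow> \<phi> q" using f(2) that by blast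
      show "\<forall>\<^sub>F n in sequentially. ereal (f n q) \<le> ereal (f k q)"
        using f(2) that by (auto simp: eventually_sequentially decseq_def)
    qed simp
    then show ?thesis using V(1-3) f by (intro exI[of _ V] exI[of _ f]) simp
  qed
  have usc: "openin (NS_topology \<Sigma>) {p \<in> U. \<phi> p < ereal a}" for a
  proof (subst openin_subopen, intro ballI)
    fix p assume p: "p \<in> {p \<in> U. \<phi> p < ereal a}"
    then have "p \<in> U" by simp
    from loc'[OF this] obtain V f where Vf: "openin (NS_topology \<Sigma>) V" "p \<in> V" "V \<subseteq> U"
        "\<forall>k. psh_on \<Sigma> V (\<lambda>p. ereal (f k p))" "\<forall>p\<in>V. (\<lambda>k. ereal (f k p)) \<longlonglongrightarrow> \<phi> p"
        "\<forall>p\<in>V. \<forall>k. \<phi> p \<le> ereal (f k p)"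
      by (elim exE conjE)
    have "\<forall>\<^sub>F k in sequentially. ereal (f k p) < ereal a"
      using Vf(2,5) p by (intro order_tendstoD(2)) auto
    then obtain k where k: "ereal (f k p) < ereal a"
      by (auto simp: eventually_sequentially)
    let ?T = "{q \<in> V. ereal (f k q) < ereal a}"
    have "openin (NS_topology \<Sigma>) ?T" using Vf(1,4) psh_onD_usc by blast
    moreover have "p \<in> ?T" using k Vf(2) by simp
    moreover have "?T \<subseteq> {p \<in> U. \<phi> p < ereal a}"
    proof
      fix q assume q: "q \<in> ?T"
      then have "\<phi> q \<le> ereal (f k q)" using Vf(6) by blast
      also have "\<dots> < ereal a" using q by blast
      finally show "q \<in> {p \<in> U. \<phi> p < ereal a}" using q Vf(3) by blast
    qed
    ultimately show "\<exists>T. openin (NS_topology \<Sigma>) T \<and> p \<in> T \<and> T \<subseteq> {p \<in> U. \<phi> p < ereal a}"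
      by blast
  qed
  have cvx: "seg_convex (incl -` U) (\<lambda>x. \<phi> (incl x))"
  proof (rule seg_convex_if_locally_midpoint_convex)
    show "\<phi> (incl x) < \<infinity>" if "x \<in> incl -` U" for x using fin that by blast
    show "open {x \<in> incl -` U. \<phi> (incl x) < ereal a}" for a
    proof -
      have "{x \<in> incl -` U. \<phi> (incl x) < ereal a} = incl -` {p \<in> U. \<phi> p < ereal a}" by auto
      then show ?thesis using open_incl_vimage[OF fan usc] by simp
    qed
    fix z assume "z \<in> incl -` U"
    then have "incl z \<in> U" by simp
    from loc'[OF this] obtain V f where Vf: "openin (NS_topology \<Sigma>) V" "incl z \<in> V" "V \<subseteq> U"
        "\<forall>k. psh_on \<Sigma> V (\<lambda>p. ereal (f k p))" "\<forall>p\<in>V. (\<lambda>k. ereal (f k p)) \<longlonglongrightarrow> \<phi> p"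
        "\<forall>p\<in>V. \<forall>k. \<phi> p \<le> ereal (f k p)"
      by (elim exE conjE)
    obtain \<eta> where \<eta>: "\<eta> > 0" "ball z \<eta> \<subseteq> incl -` V"
      using open_incl_vimage[OF fan Vf(1)] Vf(2) by (meson openE vimageI)
    have "\<phi> (incl z) \<le> ereal ((A + B) / 2)"
      if w: "norm w < \<eta>" and A: "\<phi> (incl (z - w)) \<le> ereal A" and B: "\<phi> (incl (z + w)) \<le> ereal B"
      for w A B
    proof (rule ereal_le_of_all_real_gt)
      fix R assume "ereal ((A + B) / 2) < ereal R"
      then have \<epsilon>: "R - (A + B) / 2 > 0" (is "?\<epsilon> > 0") by simp
      have zw: "z - w \<in> ball z \<eta>" "z + w \<in> ball z \<eta>" using w by (simp_all add: dist_norm)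
      then have seg: "closed_segment (z - w) (z + w) \<subseteq> incl -` V"
        using \<eta>(2) closed_segment_subset[OF zw convex_ball] by blast
      have V: "incl (z - w) \<in> V" "incl (z + w) \<in> V" using subsetD[OF \<eta>(2) zw(1)] subsetD[OF \<eta>(2) zw(2)] by auto
      have "\<phi> (incl (z - w)) < ereal (A + ?\<epsilon>)" "\<phi> (incl (z + w)) < ereal (B + ?\<epsilon>)"
        using le_less_trans[OF A] le_less_trans[OF B] \<epsilon> by simp_all
      then have "\<forall>\<^sub>F k in sequentially. ereal (f k (incl (z - w))) < ereal (A + ?\<epsilon>)"
          "\<forall>\<^sub>F k in sequentially. ereal (f k (incl (z + w))) < ereal (B + ?\<epsilon>)"
        using order_tendstoD(2)[OF bspec[OF Vf(5) V(1)]] order_tendstoD(2)[OF bspec[OF Vf(5) V(2)]]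
        by blast+
      then have "\<forall>\<^sub>F k in sequentially. ereal (f k (incl (z - w))) < ereal (A + ?\<epsilon>) \<and>
          ereal (f k (incl (z + w))) < ereal (B + ?\<epsilon>)"
        by (rule eventually_conj)
      then obtain k where k: "ereal (f k (incl (z - w))) < ereal (A + ?\<epsilon>)"
          "ereal (f k (incl (z + w))) < ereal (B + ?\<epsilon>)"
        by (auto simp: eventually_sequentially)
      have "seg_convex (incl -` V) (\<lambda>x. ereal (f k (incl x)))"
        using Vf(4) psh_on_iff_seg_convex[OF Vf(1), of "\<lambda>p. ereal (f k p)"] by blast
      from seg_convexD[OF this seg _ _ less_imp_le[OF k(1)] less_imp_le[OF k(2)], of "1 / 2"]
      have "ereal (f k (incl ((1 - 1/2) *\<^sub>R (z - w) + (1/2) *\<^sub>R (z + w))))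
          \<le> ereal ((1 - 1/2) * (A + ?\<epsilon>) + 1/2 * (B + ?\<epsilon>))" by simp
      moreover have "(1 - 1/2) *\<^sub>R (z - w) + (1/2) *\<^sub>R (z + w) = z"
        by (simp add: algebra_simps flip: scaleR_add_left)
      moreover have "(1 - 1/2) * (A + ?\<epsilon>) + 1/2 * (B + ?\<epsilon>) = R" by (simp add: field_simps)
      ultimately have "ereal (f k (incl z)) \<le> ereal R" by metis
      then show "\<phi> (incl z) \<le> ereal R" using Vf(2,6) order_trans by blast
    qed
    then show "\<exists>\<eta>>0. \<forall>w A B. norm w < \<eta> \<longrightarrow> \<phi> (incl (z - w)) \<le> ereal A \<longrightarrow>
        \<phi> (incl (z + w)) \<le> ereal B \<longrightarrow> \<phi> (incl z) \<le> ereal ((A + B) / 2)"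
      using \<eta>(1) by blast
  qed
  have "\<phi> q \<le> \<phi> (incl p)"
    if v: "v \<in> \<Union>\<Sigma>" and ray: "\<And>\<mu>. \<mu> \<ge> 0 \<Longrightarrow> incl (p + \<mu> *\<^sub>R v) \<in> U"
      and lim: "limitin (NS_topology \<Sigma>) (\<lambda>\<mu>::real. incl (p + \<mu> *\<^sub>R v)) q at_top" and q: "q \<in> U"
    for p q v
  proof -
    obtain V f where Vf: "openin (NS_topology \<Sigma>) V" "q \<in> V" "V \<subseteq> U"
        "\<forall>k. psh_on \<Sigma> V (\<lambda>p. ereal (f k p))" "\<forall>p\<in>V. (\<lambda>k. ereal (f k p)) \<longlonglongrightarrow> \<phi> p"
      using loc'[OF q] by blast
    have "\<forall>\<^sub>F \<mu> in at_top. incl (p + \<mu> *\<^sub>R v) \<in> V"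
      using lim Vf(1,2) by (auto simp: limitin_def)
    then obtain \<mu>1 where "\<And>\<mu>. \<mu> \<ge> \<mu>1 \<Longrightarrow> incl (p + \<mu> *\<^sub>R v) \<in> V"
      by (auto simp: eventually_at_top_linorder)
    \<comment> \<open>The approximants are available on the end of the ray only; convexity covers the rest of it.\<close>
    then obtain \<mu>0 where \<mu>0: "\<mu>0 \<ge> 0" "\<And>\<mu>. \<mu> \<ge> \<mu>0 \<Longrightarrow> incl (p + \<mu> *\<^sub>R v) \<in> V"
      by (metis max.bounded_iff max.cobounded1)
    let ?p = "p + \<mu>0 *\<^sub>R v"
    have shift: "?p + \<mu> *\<^sub>R v = p + (\<mu>0 + \<mu>) *\<^sub>R v" for \<mu> by (simp add: algebra_simps)
    have lim': "limitin (NS_topology \<Sigma>) (\<lambda>\<mu>::real. incl (?p + \<mu> *\<^sub>R v)) q at_top"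
      unfolding shift limitin_def
    proof (intro conjI allI impI)
      show "q \<in> topspace (NS_topology \<Sigma>)" using lim by (simp add: limitin_def)
      fix T assume "openin (NS_topology \<Sigma>) T \<and> q \<in> T"
      then have "\<forall>\<^sub>F \<mu> in at_top. incl (p + \<mu> *\<^sub>R v) \<in> T" using lim by (simp add: limitin_def)
      moreover have "filterlim (\<lambda>\<mu>. \<mu>0 + \<mu>) at_top (at_top :: real filter)"
        by (rule filterlim_tendsto_add_at_top[OF tendsto_const filterlim_ident])
      ultimately show "\<forall>\<^sub>F \<mu> in at_top. incl (p + (\<mu>0 + \<mu>) *\<^sub>R v) \<in> T"
        by (rule eventually_compose_filterlim)
    qed
    have ray': "incl (?p + \<mu> *\<^sub>R v) \<in> V" if "\<mu> \<ge> 0" for \<mu>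
      unfolding shift using \<mu>0 that by simp
    have "ereal (f k q) \<le> ereal (f k (incl ?p))" for k
      using psh_onD_limit[OF Vf(4)[rule_format, of k] v ray' lim' Vf(2)] by simp
    moreover have "(\<lambda>k. ereal (f k q)) \<longlonglongrightarrow> \<phi> q" "(\<lambda>k. ereal (f k (incl ?p))) \<longlonglongrightarrow> \<phi> (incl ?p)"
      using Vf(2,5) \<mu>0(2)[of \<mu>0] by auto
    ultimately have "\<phi> q \<le> \<phi> (incl ?p)" by (meson LIMSEQ_le)
    also have "\<dots> \<le> \<phi> (incl p)"
      by (rule ray_nonincreasing_if_limit[OF cvx usc ray lim q _ \<mu>0(1)]) (use fin q in auto)
    finally show ?thesis .
  qed
  then show ?thesis
    unfolding psh_on_iff_seg_convex[OF U] using fin usc cvx by blast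
qed

text \<open>
  In the following context a psh function is studied on a basic neighbourhood, whose part in \<open>N\<^sub>\<real>\<close> is
  \<open>\<Omega> + \<sigma>\<close>.
\<close>

context
  fixes N :: "'a::real_normed_vector set" and \<Sigma> U \<phi> \<sigma> \<Omega>
  assumes fan: "fan N \<Sigma>" and U: "openin (NS_topology \<Sigma>) U" and psh: "psh_on \<Sigma> U \<phi>"
    and \<sigma>: "\<sigma> \<in> \<Sigma>" and \<Omega>: "open \<Omega>" and sub: "basic_nbhd \<Sigma> \<sigma> \<Omega> \<subseteq> U"
begin

lemmas incl_in_U = incl_in_superset_of_basic_nbhd[OF fan \<sigma> sub]
lemmas translate_in = set_plus_cone_translate[OF fan_convex_cone[OF fan \<sigma>]]

lemma open_sublevel_of_psh: "open {x \<in> \<Omega> + \<sigma>. \<phi> (incl x) < ereal a}"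
proof -
  have "{x \<in> \<Omega> + \<sigma>. \<phi> (incl x) < ereal a} = (\<Omega> + \<sigma>) \<inter> incl -` {p \<in> U. \<phi> p < ereal a}"
    using incl_in_U by auto
  then show ?thesis
    using open_Int[OF open_set_plus[OF \<Omega>] open_incl_vimage[OF fan psh_onD_usc[OF psh U]]] by simp
qed

lemma psh_boundary_le:
  assumes "\<tau> face_of \<sigma>" "\<tau> \<in> \<Sigma>" "x \<in> \<Omega> + \<sigma>"
  shows "\<phi> (quot \<tau> x) \<le> \<phi> (incl x)"
proof -
  obtain v where v: "v \<in> \<tau>"
      "limitin (NS_topology \<Sigma>) (\<lambda>\<mu>::real. incl (x + \<mu> *\<^sub>R v)) (quot \<tau> x) at_top"
    using ray_limit[OF fan assms(2)] by metis
  have "\<mu> *\<^sub>R v \<in> \<sigma>" if "\<mu> \<ge> 0" for \<mu>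
    using convex_cone_scaleR[OF fan_convex_cone[OF fan \<sigma>] that] v(1)
      face_of_imp_subset[OF assms(1)] by blast
  then have "incl (x + \<mu> *\<^sub>R v) \<in> U" if "\<mu> \<ge> 0" for \<mu>
    using incl_in_U translate_in[OF assms(3)] that by blast
  moreover have "quot \<tau> x \<in> U"
    using sub assms(1-3) by (auto simp: basic_nbhd_def)
  ultimately show ?thesis
    using psh_onD_limit[OF psh _ _ v(2)] v(1) assms(2) by blast
qed

text \<open>
  Together with \<open>psh_boundary_le\<close>: the value at a boundary point is an infimum over interior points.
\<close>

lemma psh_boundary_approx:
  assumes "\<tau> \<in> \<Sigma>" "quot \<tau> x \<in> U" "\<phi> (quot \<tau> x) < ereal a"
  obtains t where "t \<in> \<tau>" "\<phi> (incl (x + t)) < ereal a"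
proof -
  have "quot \<tau> x \<in> {p \<in> U. \<phi> p < ereal a}" using assms by simp
  then obtain \<Omega>' \<omega> where O: "\<omega> \<in> \<Omega>'" "x - \<omega> \<in> span \<tau>"
      "basic_nbhd \<Sigma> \<tau> \<Omega>' \<subseteq> {p \<in> U. \<phi> p < ereal a}"
    by (rule openin_NS_nbhdE[OF fan psh_onD_usc[OF psh U]])
  obtain s t where st: "s \<in> \<tau>" "t \<in> \<tau>" "x - \<omega> = s - t"
    using span_convex_cone[OF fan_convex_cone[OF fan assms(1)] O(2)] by metis
  then have "x + t = \<omega> + s" by (simp add: algebra_simps)
  then have "x + t \<in> \<Omega>' + \<tau>" using O(1) st(1) by (simp add: set_plus_intro)
  then have "incl (x + t) \<in> {p \<in> U. \<phi> p < ereal a}"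
    using O(3) incl_in_basic_nbhd_iff[OF fan assms(1)] by blast
  then show thesis using that st(2) by simp
qed

text \<open>
  A ray in the direction \<open>s\<close> may converge to no point of \<open>N(\<sigma>)\<close>, where upper semicontinuity provides a
  bound.  So \<open>s\<close> is tilted to \<open>s + \<epsilon> v\<close> with \<open>v\<close> interior to \<open>\<sigma>\<close>, and the starting point is moved to
  \<open>x - \<epsilon> v\<close>, which leaves the endpoint \<open>x + s\<close> fixed; for small \<open>\<epsilon>\<close> the value at the new starting point
  is controlled by upper semicontinuity at \<open>x\<close>.
\<close>

lemma psh_nonincreasing_along_cone:
  assumes x: "x \<in> \<Omega> + \<sigma>" and s: "s \<in> \<sigma>"
  shows "\<phi> (incl (x + s)) \<le> \<phi> (incl x)"
proof (rule ereal_le_of_all_real_gt)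
  fix A assume A: "\<phi> (incl x) < ereal A"
  note cc = fan_convex_cone[OF fan \<sigma>]
  obtain v where v: "v \<in> \<sigma>" "\<And>t. t \<in> span \<sigma> \<Longrightarrow> \<forall>\<^sub>F \<mu>::real in at_top. t + \<mu> *\<^sub>R v \<in> \<sigma>"
    using fan_cone_absorbing[OF fan \<sigma>] by metis
  have "((\<lambda>\<epsilon>. x - \<epsilon> *\<^sub>R v) \<longlongrightarrow> x - 0 *\<^sub>R v) (at_right 0)"
    by (intro tendsto_intros)
  then have "\<forall>\<^sub>F \<epsilon> in at_right 0. x - \<epsilon> *\<^sub>R v \<in> {x \<in> \<Omega> + \<sigma>. \<phi> (incl x) < ereal A}"
    using open_sublevel_of_psh[of A] x A by (intro topological_tendstoD) auto
  moreover have "\<forall>\<^sub>F \<epsilon>::real in at_right 0. 0 < \<epsilon>"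
    by (simp add: eventually_at_filter)
  ultimately have "\<forall>\<^sub>F \<epsilon> in at_right 0.
      0 < \<epsilon> \<and> x - \<epsilon> *\<^sub>R v \<in> {x \<in> \<Omega> + \<sigma>. \<phi> (incl x) < ereal A}"
    by (simp add: eventually_conj_iff)
  then have "\<exists>\<epsilon>>0. x - \<epsilon> *\<^sub>R v \<in> {x \<in> \<Omega> + \<sigma>. \<phi> (incl x) < ereal A}"
    by (rule eventually_happens'[OF trivial_limit_at_right_real])
  then obtain \<epsilon> :: real where \<epsilon>: "\<epsilon> > 0" "x - \<epsilon> *\<^sub>R v \<in> \<Omega> + \<sigma>" "\<phi> (incl (x - \<epsilon> *\<^sub>R v)) < ereal A"
    by auto
  let ?p = "x - \<epsilon> *\<^sub>R v" and ?w = "s + \<epsilon> *\<^sub>R v"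
  have w: "?w \<in> \<sigma>"
    using convex_cone_add[OF cc s] convex_cone_scaleR[OF cc _ v(1)] \<epsilon>(1) by simp
  have ray: "?p + \<mu> *\<^sub>R ?w \<in> \<Omega> + \<sigma>" if "\<mu> \<ge> 0" for \<mu>
    by (rule translate_in[OF \<epsilon>(2) convex_cone_scaleR[OF cc that w]])
  have q: "quot \<sigma> ?p \<in> U"
    using sub \<epsilon>(2) \<sigma> fan_face_refl[OF fan \<sigma>] by (auto simp: basic_nbhd_def)
  obtain C where C: "\<phi> (quot \<sigma> ?p) < ereal C"
    using psh_onD_less_infty[OF psh q] ereal_dense2 by blast
  then have "quot \<sigma> ?p \<in> {p \<in> U. \<phi> p < ereal C}" using q by simp
  then obtain \<Omega>' \<omega> where O: "\<omega> \<in> \<Omega>'" "?p - \<omega> \<in> span \<sigma>"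
      "basic_nbhd \<Sigma> \<sigma> \<Omega>' \<subseteq> {p \<in> U. \<phi> p < ereal C}"
    by (rule openin_NS_nbhdE[OF fan psh_onD_usc[OF psh U]])
  have "\<forall>\<^sub>F \<mu>::real in at_top. (?p - \<omega>) + \<mu> *\<^sub>R v \<in> \<sigma>" by (rule v(2)[OF O(2)])
  moreover have "filterlim (\<lambda>\<mu>. \<epsilon> * \<mu>) at_top (at_top :: real filter)"
    by (rule filterlim_tendsto_pos_mult_at_top[OF tendsto_const \<epsilon>(1) filterlim_ident])
  ultimately have "\<forall>\<^sub>F \<mu> in at_top. (?p - \<omega>) + (\<epsilon> * \<mu>) *\<^sub>R v \<in> \<sigma>"
    by (rule eventually_compose_filterlim)
  then have "\<forall>\<^sub>F \<mu> in at_top. \<phi> (incl (?p + \<mu> *\<^sub>R ?w)) \<le> ereal C"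
    using eventually_ge_at_top[of 0]
  proof eventually_elim
    case (elim \<mu>)
    have "\<omega> + (((?p - \<omega>) + (\<epsilon> * \<mu>) *\<^sub>R v) + \<mu> *\<^sub>R s) \<in> \<Omega>' + \<sigma>"
      using O(1) convex_cone_add[OF cc elim(1) convex_cone_scaleR[OF cc elim(2) s]]
      by (rule set_plus_intro)
    moreover have "\<omega> + (((?p - \<omega>) + (\<epsilon> * \<mu>) *\<^sub>R v) + \<mu> *\<^sub>R s) = ?p + \<mu> *\<^sub>R ?w"
      by (simp add: algebra_simps)
    ultimately show ?case
      using O(3) incl_in_basic_nbhd_iff[OF fan \<sigma>] by (auto intro: less_imp_le)
  qed
  moreover have "seg_convex (incl -` U) (\<lambda>x. \<phi> (incl x))"
    using psh psh_on_iff_seg_convex[OF U] by blast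
  ultimately have "\<phi> (incl (?p + 1 *\<^sub>R ?w)) \<le> \<phi> (incl ?p)"
    using seg_convex_ray_nonincreasing[where W = "incl -` U" and \<psi> = "\<lambda>x. \<phi> (incl x)"
        and p = ?p and v = ?w and \<mu> = 1] ray incl_in_U by auto
  then show "\<phi> (incl (x + s)) \<le> ereal A" using \<epsilon>(3) by (simp add: algebra_simps)
qed

end

section \<open>Smooth psh functions from affine forms\<close>

abbreviation vanishing_on :: "'a set \<Rightarrow> 'a affine_form list \<Rightarrow> 'a affine_form list" where
  "vanishing_on \<tau> ps \<equiv> filter (\<lambda>p. \<forall>t\<in>\<tau>. fst p t = 0) ps"

text \<open>
  On the stratum \<open>N(\<tau>)\<close> only the forms that descend to the quotient by \<open>span \<tau>\<close> are kept, and their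
  values do not depend on the representative chosen.
\<close>

definition toric_reg_max :: "real \<Rightarrow> real \<Rightarrow> 'a affine_form list \<Rightarrow> 'a point \<Rightarrow> real" where
  "toric_reg_max \<epsilon> m ps q = reg_max \<epsilon> m (vanishing_on (fst q) ps) (SOME x. x \<in> snd q)"

lemma reg_max_vanishing_translate:
  assumes "\<And>p. p \<in> set ps \<Longrightarrow> linear (fst p)" "v \<in> span \<tau>"
  shows "reg_max \<epsilon> m (vanishing_on \<tau> ps) (x + v) = reg_max \<epsilon> m (vanishing_on \<tau> ps) x"
proof (rule reg_max_translate)
  fix p assume p: "p \<in> set (vanishing_on \<tau> ps)"
  then show "linear (fst p)" using assms(1) by simp
  then show "fst p v = 0"
    using p assms(2) linear_eq_0_on_span[of "fst p" \<tau> v] by simp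
qed

lemma toric_reg_max_quot:
  assumes "\<And>p. p \<in> set ps \<Longrightarrow> linear (fst p)"
  shows "toric_reg_max \<epsilon> m ps (quot \<tau> x) = reg_max \<epsilon> m (vanishing_on \<tau> ps) x"
proof -
  have "x + 0 \<in> (+) x ` span \<tau>" by (intro imageI span_zero)
  then have "(SOME y. y \<in> (+) x ` span \<tau>) \<in> (+) x ` span \<tau>" by (rule someI)
  then obtain v where "v \<in> span \<tau>" "(SOME y. y \<in> (+) x ` span \<tau>) = x + v" by blast
  then show ?thesis
    using reg_max_vanishing_translate[OF assms] by (simp add: toric_reg_max_def quot_def)
qed

text \<open>
  A form that is nonpositive on \<open>\<tau>\<close> without vanishing there is negative at some \<open>v \<in> \<tau>\<close>, and adding a
  large multiple of \<open>v\<close> brings it below any bound, uniformly on bounded sets.  Further steps into \<open>\<tau>\<close>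
  only help, so the forms can be treated one after the other.
\<close>

lemma nonvanishing_forms_le_far_out:
  fixes ps :: "'a::real_normed_vector affine_form list"
  assumes "convex_cone \<tau>" "bounded \<Omega>"
    and "\<And>p. p \<in> set ps \<Longrightarrow> bounded_linear (fst p)"
    and "\<And>p t. p \<in> set ps \<Longrightarrow> t \<in> \<tau> \<Longrightarrow> fst p t \<le> 0"
  shows "\<exists>w\<in>\<tau>. \<forall>x\<in>\<Omega>. \<forall>t\<in>\<tau>. \<forall>p\<in>set ps. \<not> (\<forall>t\<in>\<tau>. fst p t = 0) \<longrightarrow> aff p (x + w + t) \<le> m"
  using assms(3,4)
proof (induction ps)
  case Nil
  show ?case using convex_cone_contains_0[OF assms(1)] by auto
next
  case (Cons p ps)
  have lin: "linear (fst p')" if "p' \<in> set (p # ps)" for p'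
    using Cons.prems(1)[OF that] by (rule bounded_linear.linear)
  obtain w where w: "w \<in> \<tau>" "\<And>x t p. x \<in> \<Omega> \<Longrightarrow> t \<in> \<tau> \<Longrightarrow> p \<in> set ps \<Longrightarrow>
      \<not> (\<forall>t\<in>\<tau>. fst p t = 0) \<Longrightarrow> aff p (x + w + t) \<le> m"
    using Cons.IH Cons.prems by (metis list.set_intros(2))
  show ?case
  proof (cases "\<forall>t\<in>\<tau>. fst p t = 0")
    case True
    then show ?thesis using w by (intro bexI[of _ w]) auto
  next
    case False
    then obtain v where v: "v \<in> \<tau>" "fst p v < 0"
      using Cons.prems(2)[of p] by (force simp: less_le)
    have "bounded (fst p ` \<Omega>)"
      by (rule bounded_linear_image[OF assms(2) Cons.prems(1)]) simp
    then obtain K where K: "\<And>x. x \<in> \<Omega> \<Longrightarrow> \<bar>fst p x\<bar> \<le> K"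
      unfolding bounded_iff by auto
    define \<mu> where "\<mu> = max 0 ((K + \<bar>snd p\<bar> + \<bar>m\<bar>) / - fst p v)"
    have \<mu>: "\<mu> \<ge> 0" "\<mu> * fst p v \<le> - (K + \<bar>snd p\<bar> + \<bar>m\<bar>)"
    proof -
      show "\<mu> \<ge> 0" by (simp add: \<mu>_def)
      have "(K + \<bar>snd p\<bar> + \<bar>m\<bar>) / - fst p v \<le> \<mu>" by (simp add: \<mu>_def)
      then have "K + \<bar>snd p\<bar> + \<bar>m\<bar> \<le> \<mu> * - fst p v"
        using v(2) by (subst (asm) pos_divide_le_eq) auto
      then show "\<mu> * fst p v \<le> - (K + \<bar>snd p\<bar> + \<bar>m\<bar>)" by simp
    qed
    have \<mu>v: "\<mu> *\<^sub>R v \<in> \<tau>" by (rule convex_cone_scaleR[OF assms(1) \<mu>(1) v(1)])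
    have "aff p' (x + (w + \<mu> *\<^sub>R v) + t) \<le> m"
      if x: "x \<in> \<Omega>" and t: "t \<in> \<tau>" and p': "p' \<in> set (p # ps)" and nv: "\<not> (\<forall>t\<in>\<tau>. fst p' t = 0)"
      for x t p'
    proof (cases "p' = p")
      case True
      have "fst p (x + (w + \<mu> *\<^sub>R v) + t) = fst p x + fst p w + \<mu> * fst p v + fst p t"
        using lin[of p] by (simp add: linear_add linear_scale)
      moreover have "fst p w \<le> 0" "fst p t \<le> 0" using Cons.prems(2) w(1) t by simp_all
      ultimately have "aff p (x + (w + \<mu> *\<^sub>R v) + t) \<le> m" using K[OF x] \<mu>(2) by linarith
      then show ?thesis using True by simp
    next
      case False
      have "aff p' (x + w + (\<mu> *\<^sub>R v + t)) \<le> m"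
        using p' False nv by (intro w(2) x convex_cone_add[OF assms(1) \<mu>v t]) auto
      then show ?thesis by (simp add: add.assoc)
    qed
    moreover have "w + \<mu> *\<^sub>R v \<in> \<tau>" by (rule convex_cone_add[OF assms(1) w(1) \<mu>v])
    ultimately show ?thesis by blast
  qed
qed

context
  fixes N :: "'a::real_normed_vector set" and \<Sigma> :: "'a set set" and \<sigma> \<Omega> :: "'a set"
    and ps :: "'a affine_form list" and \<epsilon> m :: real
  assumes fan: "fan N \<Sigma>" and \<sigma>: "\<sigma> \<in> \<Sigma>"
    and \<Omega>: "bounded \<Omega>" "open \<Omega>" "convex \<Omega>"
    and \<epsilon>: "\<epsilon> > 0"
    and bdd_lin: "\<And>p. p \<in> set ps \<Longrightarrow> bounded_linear (fst p)"
    and slopes: "\<And>p s. p \<in> set ps \<Longrightarrow> s \<in> \<sigma> \<Longrightarrow> fst p s \<le> 0"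
begin

lemma forms_linear: "p \<in> set ps \<Longrightarrow> linear (fst p)"
  using bdd_lin by (rule bounded_linear.linear)

text \<open>
  The value at a boundary point is attained in \<open>N\<^sub>\<real>\<close>, far enough out on the fibre.
\<close>

lemma toric_reg_max_eq_far:
  assumes "\<tau> \<in> \<Sigma>" "\<tau> face_of \<sigma>"
  obtains w where "w \<in> \<tau>"
    "\<And>t. t \<in> \<tau> \<Longrightarrow> toric_reg_max \<epsilon> m ps (quot \<tau> z) = reg_max \<epsilon> m ps (z + w + t)"
proof -
  have sub: "\<tau> \<subseteq> \<sigma>" by (rule face_of_imp_subset[OF assms(2)])
  have "\<exists>w\<in>\<tau>. \<forall>x\<in>{z}. \<forall>t\<in>\<tau>. \<forall>p\<in>set ps. \<not> (\<forall>t\<in>\<tau>. fst p t = 0) \<longrightarrow> aff p (x + w + t) \<le> m"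
    using bdd_lin slopes sub by (intro nonvanishing_forms_le_far_out[OF fan_convex_cone[OF fan assms(1)]]) auto
  then obtain w where w: "w \<in> \<tau>" "\<And>t p. t \<in> \<tau> \<Longrightarrow> p \<in> set ps \<Longrightarrow> \<not> (\<forall>t\<in>\<tau>. fst p t = 0) \<Longrightarrow>
      aff p (z + w + t) \<le> m"
    by blast
  show thesis
  proof (rule that[OF w(1)])
    fix t assume t: "t \<in> \<tau>"
    have "w + t \<in> span \<tau>" using w(1) t by (intro span_add span_base)
    then have "toric_reg_max \<epsilon> m ps (quot \<tau> z) = reg_max \<epsilon> m (vanishing_on \<tau> ps) (z + w + t)"
      using reg_max_vanishing_translate[OF forms_linear, where v = "w + t" and \<tau> = \<tau>]
      by (simp add: toric_reg_max_quot[OF forms_linear] add.assoc)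
    also have "\<dots> = reg_max \<epsilon> m ps (z + w + t)"
      using w(2)[OF t] by (intro reg_max_filter_eq[OF \<epsilon>])
    finally show "toric_reg_max \<epsilon> m ps (quot \<tau> z) = reg_max \<epsilon> m ps (z + w + t)" .
  qed
qed

text \<open>
  Translating \<open>\<Omega>\<close> far into \<open>\<tau>\<close> does not change its image in \<open>N(\<tau>)\<close> and brings all forms that do not
  vanish on \<open>\<tau>\<close> below the floor.  On the resulting neighbourhood the function is pulled back from
  \<open>N(\<tau>)\<close>.
\<close>

lemma invariant_nbhd:
  assumes q: "quot \<tau> z \<in> basic_nbhd \<Sigma> \<sigma> \<Omega>"
  obtains \<Omega>' \<omega> where "\<tau> \<in> \<Sigma>" "\<tau> face_of \<sigma>" "bounded \<Omega>'" "open \<Omega>'" "convex \<Omega>'" "\<omega> \<in> \<Omega>'"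
    "quot \<tau> z = quot \<tau> \<omega>" "basic_nbhd \<Sigma> \<tau> \<Omega>' \<subseteq> basic_nbhd \<Sigma> \<sigma> \<Omega>"
    "\<forall>\<rho> y. \<rho> face_of \<tau> \<longrightarrow> y \<in> \<Omega>' + \<tau> \<longrightarrow>
      toric_reg_max \<epsilon> m ps (quot \<rho> y) = reg_max \<epsilon> m (vanishing_on \<tau> ps) y"
proof -
  obtain t where t: "\<tau> \<in> \<Sigma>" "\<tau> face_of \<sigma>" "t \<in> \<tau>" "z + t \<in> \<Omega> + \<sigma>"
    using q unfolding quot_in_basic_nbhd_iff[OF fan \<sigma>] by blast
  have sub: "\<tau> \<subseteq> \<sigma>" by (rule face_of_imp_subset[OF t(2)])
  note cc = fan_convex_cone[OF fan \<sigma>] and cc\<tau> = fan_convex_cone[OF fan t(1)]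
  obtain \<omega> s where ws: "\<omega> \<in> \<Omega>" "s \<in> \<sigma>" "z + t = \<omega> + s" using t(4) by (auto simp: set_plus_def)
  have "\<exists>w\<in>\<tau>. \<forall>x\<in>(+) s ` \<Omega>. \<forall>t\<in>\<tau>. \<forall>p\<in>set ps. \<not> (\<forall>t\<in>\<tau>. fst p t = 0) \<longrightarrow>
      aff p (x + w + t) \<le> m"
    using bdd_lin slopes sub by (intro nonvanishing_forms_le_far_out[OF cc\<tau> bounded_translation[OF \<Omega>(1)]]) auto
  then obtain w where w: "w \<in> \<tau>" "\<And>x t p. x \<in> \<Omega> \<Longrightarrow> t \<in> \<tau> \<Longrightarrow> p \<in> set ps \<Longrightarrow>
      \<not> (\<forall>t\<in>\<tau>. fst p t = 0) \<Longrightarrow> aff p (s + x + w + t) \<le> m"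
    by blast
  define \<Omega>' where "\<Omega>' = (+) (s + w) ` \<Omega>"
  have sw: "s + w \<in> \<sigma>" using convex_cone_add[OF cc ws(2)] w(1) sub by blast
  show thesis
  proof (rule that[OF t(1,2)])
    show "bounded \<Omega>'" "open \<Omega>'" "convex \<Omega>'"
      unfolding \<Omega>'_def using \<Omega> by (auto intro: bounded_translation open_translation convex_translation)
    show "s + w + \<omega> \<in> \<Omega>'" using ws(1) by (simp add: \<Omega>'_def)
    have "z - (s + w + \<omega>) = - (w + t)" using ws(3) by (simp add: algebra_simps)
    moreover have "- (w + t) \<in> span \<tau>" using w(1) t(3) by (intro span_neg span_add span_base)
    ultimately show "quot \<tau> z = quot \<tau> (s + w + \<omega>)" by (simp only: quot_eq_iff)
    show "basic_nbhd \<Sigma> \<tau> \<Omega>' \<subseteq> basic_nbhd \<Sigma> \<sigma> \<Omega>"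
    proof (rule basic_nbhd_mono[OF t(2)], rule subsetI)
      fix y assume "y \<in> \<Omega>' + \<tau>"
      then obtain x r where "x \<in> \<Omega>" "r \<in> \<tau>" "y = x + ((s + w) + r)"
        by (auto simp: \<Omega>'_def set_plus_def add_ac)
      moreover have "(s + w) + r \<in> \<sigma>"
        using convex_cone_add[OF cc sw] \<open>r \<in> \<tau>\<close> sub by blast
      ultimately show "y \<in> \<Omega> + \<sigma>" by (simp add: set_plus_intro)
    qed
    show "\<forall>\<rho> y. \<rho> face_of \<tau> \<longrightarrow> y \<in> \<Omega>' + \<tau> \<longrightarrow>
        toric_reg_max \<epsilon> m ps (quot \<rho> y) = reg_max \<epsilon> m (vanishing_on \<tau> ps) y"
    proof (intro allI impI)
      fix \<rho> y assume \<rho>: "\<rho> face_of \<tau>" and y: "y \<in> \<Omega>' + \<tau>"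
      then obtain x r where y': "x \<in> \<Omega>" "r \<in> \<tau>" "y = s + x + w + r"
        by (auto simp: \<Omega>'_def set_plus_def add_ac)
      have "\<rho> \<subseteq> \<tau>" by (rule face_of_imp_subset[OF \<rho>])
      then have "vanishing_on \<tau> ps = vanishing_on \<tau> (vanishing_on \<rho> ps)"
        by (auto intro!: filter_cong)
      then have "reg_max \<epsilon> m (vanishing_on \<tau> ps) y = reg_max \<epsilon> m (vanishing_on \<tau> (vanishing_on \<rho> ps)) y"
        by simp
      also have "\<dots> = reg_max \<epsilon> m (vanishing_on \<rho> ps) y"
        using w(2)[OF y'(1,2)] unfolding y'(3) by (intro reg_max_filter_eq[OF \<epsilon>]) auto
      finally show "toric_reg_max \<epsilon> m ps (quot \<rho> y) = reg_max \<epsilon> m (vanishing_on \<tau> ps) y"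
        by (simp add: toric_reg_max_quot[OF forms_linear])
    qed
  qed
qed

lemma smooth_toric_reg_max: "smooth_on \<Sigma> (basic_nbhd \<Sigma> \<sigma> \<Omega>) (toric_reg_max \<epsilon> m ps)"
  unfolding smooth_on_def
proof (intro conjI ballI)
  fix \<tau> assume "\<tau> \<in> \<Sigma>"
  have "toric_reg_max \<epsilon> m ps \<circ> quot \<tau> = reg_max \<epsilon> m (vanishing_on \<tau> ps)"
    by (simp add: fun_eq_iff toric_reg_max_quot[OF forms_linear])
  moreover have "Ck_on k UNIV (reg_max \<epsilon> m (vanishing_on \<tau> ps))" for k
    using bdd_lin by (intro Ck_on_reg_max) simp
  ultimately show "C_infinity_on_stratum \<tau> (basic_nbhd \<Sigma> \<sigma> \<Omega>) (toric_reg_max \<epsilon> m ps)"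
    unfolding C_infinity_on_stratum_def C_infinity_on_def by (metis Ck_on_subset subset_UNIV)
next
  show "constant_towards_boundary \<Sigma> (basic_nbhd \<Sigma> \<sigma> \<Omega>) (toric_reg_max \<epsilon> m ps)"
    unfolding constant_towards_boundary_def
  proof (intro ballI)
    fix \<tau> x assume "\<tau> \<in> \<Sigma>" and "x \<in> basic_nbhd \<Sigma> \<sigma> \<Omega> \<inter> stratum \<tau>"
    then obtain z where x: "x = quot \<tau> z" and z: "quot \<tau> z \<in> basic_nbhd \<Sigma> \<sigma> \<Omega>" by auto
    obtain \<Omega>' \<omega> where \<Omega>': "\<tau> \<in> \<Sigma>" "\<tau> face_of \<sigma>" "bounded \<Omega>'" "open \<Omega>'" "convex \<Omega>'"
        "\<omega> \<in> \<Omega>'" "quot \<tau> z = quot \<tau> \<omega>" "basic_nbhd \<Sigma> \<tau> \<Omega>' \<subseteq> basic_nbhd \<Sigma> \<sigma> \<Omega>"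
        "\<forall>\<rho> y. \<rho> face_of \<tau> \<longrightarrow> y \<in> \<Omega>' + \<tau> \<longrightarrow>
          toric_reg_max \<epsilon> m ps (quot \<rho> y) = reg_max \<epsilon> m (vanishing_on \<tau> ps) y"
      by (rule invariant_nbhd[OF z])
    let ?V = "basic_nbhd \<Sigma> \<tau> \<Omega>'"
    have refl: "\<tau> face_of \<tau>" by (rule fan_face_refl[OF fan \<Omega>'(1)])
    have inv: "quot_map \<tau> q \<in> ?V \<inter> stratum \<tau> \<and>
        toric_reg_max \<epsilon> m ps q = toric_reg_max \<epsilon> m ps (quot_map \<tau> q)"
      if \<rho>: "\<rho> face_of \<tau>" and q: "q \<in> ?V \<inter> stratum \<rho>" for \<rho> q
    proof -
      obtain y where y: "y \<in> \<Omega>' + \<tau>" "q = quot \<rho> y"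
        using q by (auto simp: basic_nbhd_def quot_def)
      have "quot_map \<tau> q = quot \<tau> y"
        unfolding y(2) by (rule quot_map_quot[OF face_of_imp_subset[OF \<rho>]])
      moreover have "quot \<tau> y \<in> ?V" using y(1) \<Omega>'(1) refl by (auto simp: basic_nbhd_def)
      ultimately show ?thesis using \<Omega>'(9)[rule_format, OF \<rho> y(1)] \<Omega>'(9)[rule_format, OF refl y(1)] y(2) by simp
    qed
    have "\<omega> + 0 \<in> \<Omega>' + \<tau>"
      using \<Omega>'(6) convex_cone_contains_0[OF fan_convex_cone[OF fan \<Omega>'(1)]] by (rule set_plus_intro)
    then have "x \<in> ?V" unfolding x \<Omega>'(7) using \<Omega>'(1) refl by (auto simp: basic_nbhd_def)
    moreover have "openin (NS_topology \<Sigma>) ?V" using \<Omega>' by (intro openin_basic_nbhd)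
    ultimately show "\<exists>V. openin (NS_topology \<Sigma>) V \<and> x \<in> V \<and> V \<subseteq> basic_nbhd \<Sigma> \<sigma> \<Omega> \<and>
        (\<forall>\<rho>\<in>\<Sigma>. \<rho> face_of \<tau> \<longrightarrow>
           V \<inter> stratum \<rho> = {q \<in> V \<inter> stratum \<rho>. quot_map \<tau> q \<in> V \<inter> stratum \<tau>} \<and>
           (\<forall>q \<in> V \<inter> stratum \<rho>. toric_reg_max \<epsilon> m ps q = toric_reg_max \<epsilon> m ps (quot_map \<tau> q)))"
      using inv \<Omega>'(8) by (intro exI[of _ ?V]) blast
  qed
qed

text \<open>
  On the neighbourhood just constructed the function is pulled back from a continuous function on
  \<open>N(\<tau>)\<close>, so \<open>\<Omega>'\<close> can be shrunk to a ball around the point.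
\<close>

lemma toric_reg_max_continuous:
  assumes q: "q \<in> basic_nbhd \<Sigma> \<sigma> \<Omega>" and e: "e > 0"
  obtains W where "openin (NS_topology \<Sigma>) W" "q \<in> W" "W \<subseteq> basic_nbhd \<Sigma> \<sigma> \<Omega>"
    "\<And>q'. q' \<in> W \<Longrightarrow> \<bar>toric_reg_max \<epsilon> m ps q' - toric_reg_max \<epsilon> m ps q\<bar> < e"
proof -
  obtain \<tau> z where z: "q = quot \<tau> z" using q by (auto simp: basic_nbhd_def)
  then have "quot \<tau> z \<in> basic_nbhd \<Sigma> \<sigma> \<Omega>" using q by simp
  then obtain \<Omega>' \<omega> where \<Omega>': "\<tau> \<in> \<Sigma>" "\<tau> face_of \<sigma>" "bounded \<Omega>'" "open \<Omega>'" "convex \<Omega>'"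
      "\<omega> \<in> \<Omega>'" "quot \<tau> z = quot \<tau> \<omega>" "basic_nbhd \<Sigma> \<tau> \<Omega>' \<subseteq> basic_nbhd \<Sigma> \<sigma> \<Omega>"
      "\<forall>\<rho> y. \<rho> face_of \<tau> \<longrightarrow> y \<in> \<Omega>' + \<tau> \<longrightarrow>
        toric_reg_max \<epsilon> m ps (quot \<rho> y) = reg_max \<epsilon> m (vanishing_on \<tau> ps) y"
    by (rule invariant_nbhd)
  let ?g = "reg_max \<epsilon> m (vanishing_on \<tau> ps)"
  have "Ck_on 0 UNIV ?g" using bdd_lin by (intro Ck_on_reg_max) simp
  then have "isCont ?g \<omega>" by (simp add: continuous_on_eq_continuous_at)
  then obtain \<delta> where \<delta>: "\<delta> > 0" "\<And>x. dist x \<omega> < \<delta> \<Longrightarrow> \<bar>?g x - ?g \<omega>\<bar> < e"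
    using e unfolding continuous_at_eps_delta by (auto simp: dist_real_def)
  let ?\<Omega> = "\<Omega>' \<inter> ball \<omega> \<delta>"
  let ?W = "basic_nbhd \<Sigma> \<tau> ?\<Omega>"
  have refl: "\<tau> face_of \<tau>" by (rule fan_face_refl[OF fan \<Omega>'(1)])
  have 0: "0 \<in> \<tau>" by (rule convex_cone_contains_0[OF fan_convex_cone[OF fan \<Omega>'(1)]])
  have sub: "?\<Omega> + \<tau> \<subseteq> \<Omega>' + \<tau>" by (intro set_plus_mono2) auto
  have "\<omega> + 0 \<in> ?\<Omega> + \<tau>" using \<Omega>'(6) \<delta>(1) 0 by (intro set_plus_intro) auto
  then have \<omega>: "\<omega> \<in> ?\<Omega> + \<tau>" by simp
  show thesis
  proof
    show "openin (NS_topology \<Sigma>) ?W"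
      using \<Omega>'(1,3-5) by (intro openin_basic_nbhd) (auto intro: convex_Int)
    show "q \<in> ?W" unfolding z \<Omega>'(7) using \<Omega>'(1) refl \<omega> by (auto simp: basic_nbhd_def)
    show "?W \<subseteq> basic_nbhd \<Sigma> \<sigma> \<Omega>"
      using basic_nbhd_mono[OF refl sub] \<Omega>'(8) by blast
    fix q' assume "q' \<in> ?W"
    then obtain \<rho> y where y: "\<rho> face_of \<tau>" "y \<in> ?\<Omega> + \<tau>" "q' = quot \<rho> y"
      by (auto simp: basic_nbhd_def)
    then obtain x t where xt: "x \<in> ball \<omega> \<delta>" "t \<in> \<tau>" "y = x + t" by (auto simp: set_plus_def)
    have "toric_reg_max \<epsilon> m ps q' = ?g y" using \<Omega>'(9) y sub by blast
    also have "\<dots> = ?g x"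
      unfolding xt(3) by (rule reg_max_vanishing_translate[OF forms_linear span_base[OF xt(2)]])
    finally have "toric_reg_max \<epsilon> m ps q' = ?g x" .
    moreover have "toric_reg_max \<epsilon> m ps q = ?g \<omega>"
      unfolding z \<Omega>'(7) using \<Omega>'(9)[rule_format, OF refl] sub \<omega> by blast
    ultimately show "\<bar>toric_reg_max \<epsilon> m ps q' - toric_reg_max \<epsilon> m ps q\<bar> < e"
      using \<delta>(2)[of x] xt(1) by (simp add: dist_commute)
  qed
qed

text \<open>
  For the condition on rays: if the value at the limit point exceeded the value at the origin of the
  ray, then by continuity so would the values far out on the ray, but these are nonincreasing.
\<close>

lemma psh_toric_reg_max: "psh_on \<Sigma> (basic_nbhd \<Sigma> \<sigma> \<Omega>) (\<lambda>q. ereal (toric_reg_max \<epsilon> m ps q))"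
proof -
  let ?V = "basic_nbhd \<Sigma> \<sigma> \<Omega>" and ?f = "toric_reg_max \<epsilon> m ps"
  have V: "openin (NS_topology \<Sigma>) ?V" using \<sigma> \<Omega> by (intro openin_basic_nbhd)
  have usc: "openin (NS_topology \<Sigma>) {q \<in> ?V. ereal (?f q) < ereal a}" for a
  proof (subst openin_subopen, intro ballI)
    fix q assume q: "q \<in> {q \<in> ?V. ereal (?f q) < ereal a}"
    then have "q \<in> ?V" "a - ?f q > 0" by auto
    from toric_reg_max_continuous[OF this]
    obtain W where W: "openin (NS_topology \<Sigma>) W" "q \<in> W" "W \<subseteq> ?V"
        "\<And>q'. q' \<in> W \<Longrightarrow> \<bar>?f q' - ?f q\<bar> < a - ?f q"
      by metis
    have "W \<subseteq> {q \<in> ?V. ereal (?f q) < ereal a}"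
    proof
      fix q' assume q': "q' \<in> W"
      then have "?f q' < a" using W(4)[OF q'] by linarith
      then show "q' \<in> {q \<in> ?V. ereal (?f q) < ereal a}" using W(3) q' by auto
    qed
    then show "\<exists>T. openin (NS_topology \<Sigma>) T \<and> q \<in> T \<and> T \<subseteq> {q \<in> ?V. ereal (?f q) < ereal a}"
      using W(1,2) by blast
  qed
  have incl_f: "?f (incl x) = reg_max \<epsilon> m ps x" for x
  proof -
    have "vanishing_on {0} ps = ps"
      using forms_linear by (auto simp: filter_id_conv linear_0)
    then show ?thesis by (simp add: toric_reg_max_quot[OF forms_linear])
  qed
  have "convex_on UNIV (reg_max \<epsilon> m ps)" by (rule convex_reg_max[OF \<epsilon> forms_linear])
  have cvx: "seg_convex (incl -` ?V) (\<lambda>x. ereal (?f (incl x)))"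
    unfolding seg_convex_def incl_f
  proof (intro allI impI)
    fix x y :: 'a and t A B :: real
    assume t: "0 \<le> t" "t \<le> 1" and AB: "ereal (reg_max \<epsilon> m ps x) \<le> ereal A"
      "ereal (reg_max \<epsilon> m ps y) \<le> ereal B"
    have "reg_max \<epsilon> m ps ((1 - t) *\<^sub>R x + t *\<^sub>R y)
        \<le> (1 - t) * reg_max \<epsilon> m ps x + t * reg_max \<epsilon> m ps y"
      using t by (intro convex_onD[OF \<open>convex_on UNIV (reg_max \<epsilon> m ps)\<close>]) auto
    also have "\<dots> \<le> (1 - t) * A + t * B"
      using t AB by (intro add_mono mult_left_mono) auto
    finally show "ereal (reg_max \<epsilon> m ps ((1 - t) *\<^sub>R x + t *\<^sub>R y)) \<le> ereal ((1 - t) * A + t * B)"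
      by simp
  qed
  have "?f q \<le> ?f (incl p)"
    if ray: "\<And>\<mu>. \<mu> \<ge> 0 \<Longrightarrow> incl (p + \<mu> *\<^sub>R v) \<in> ?V"
      and lim: "limitin (NS_topology \<Sigma>) (\<lambda>\<mu>::real. incl (p + \<mu> *\<^sub>R v)) q at_top" and q: "q \<in> ?V"
    for p q v
  proof (rule ccontr)
    assume "\<not> ?f q \<le> ?f (incl p)"
    then have "?f q - ?f (incl p) > 0" by simp
    from toric_reg_max_continuous[OF q this]
    obtain W where W: "openin (NS_topology \<Sigma>) W" "q \<in> W" "W \<subseteq> ?V"
        "\<And>q'. q' \<in> W \<Longrightarrow> \<bar>?f q' - ?f q\<bar> < ?f q - ?f (incl p)"
      by metis
    have "\<forall>\<^sub>F \<mu> in at_top. incl (p + \<mu> *\<^sub>R v) \<in> W" using lim W(1,2) by (auto simp: limitin_def)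
    then have "\<forall>\<^sub>F \<mu> in at_top. incl (p + \<mu> *\<^sub>R v) \<in> W \<and> \<mu> \<ge> 0"
      using eventually_ge_at_top[of 0] by (rule eventually_conj)
    from eventually_happens'[OF _ this]
    obtain \<mu> where \<mu>: "incl (p + \<mu> *\<^sub>R v) \<in> W" "\<mu> \<ge> 0"
      by auto
    have "ereal (?f (incl (p + \<mu> *\<^sub>R v))) \<le> ereal (?f (incl p))"
      by (rule ray_nonincreasing_if_limit[OF cvx usc ray lim q _ \<mu>(2)]) simp_all
    then show False using W(4)[OF \<mu>(1)] by simp
  qed
  then show ?thesis
    unfolding psh_on_iff_seg_convex[OF V] using usc cvx by auto
qed

end

section \<open>Approximation from above\<close>

text \<open>
The points above the graph of an affine function form a convex set.
\<close>

lemma affine_le_on_convex_hull_graph: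
  fixes u y :: "'a::real_vector \<Rightarrow> real"
  assumes "linear u" "\<And>g. g \<in> D \<Longrightarrow> u g + c \<le> y g"
    and "(w, \<rho>) \<in> convex hull ((\<lambda>g. (g, y g)) ` D)"
  shows "u w + c \<le> \<rho>"
proof -
  have "convex {q. u (fst q) + c \<le> snd q}"
  proof (rule convexI)
    fix p q :: "'a \<times> real" and s t :: real
    assume pq: "p \<in> {q. u (fst q) + c \<le> snd q}" "q \<in> {q. u (fst q) + c \<le> snd q}"
      and st: "0 \<le> s" "0 \<le> t" "s + t = 1"
    have "u (fst (s *\<^sub>R p + t *\<^sub>R q)) + c = s * (u (fst p) + c) + t * (u (fst q) + c)"
      using st(3) by (simp add: linear_add[OF assms(1)] linear_scale[OF assms(1)] distrib_left
          flip: distrib_right)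
    also have "\<dots> \<le> s * snd p + t * snd q"
      using pq st by (intro add_mono mult_left_mono) auto
    finally show "s *\<^sub>R p + t *\<^sub>R q \<in> {q. u (fst q) + c \<le> snd q}" by simp
  qed
  moreover have "(\<lambda>g. (g, y g)) ` D \<subseteq> {q. u (fst q) + c \<le> snd q}" using assms(2) by auto
  ultimately have "convex hull ((\<lambda>g. (g, y g)) ` D) \<subseteq> {q. u (fst q) + c \<le> snd q}"
    by (intro hull_minimal)
  then show ?thesis using assms(3) by auto
qed

lemma affine_le_on_convex_hull:
  fixes u :: "'a::real_vector \<Rightarrow> real"
  assumes "linear u" "\<And>g. g \<in> D \<Longrightarrow> u g + c \<le> r" "w \<in> convex hull D"
  shows "u w + c \<le> r"
proof -
  have "(\<lambda>g. (g, r)) ` D = D \<times> {r}" by auto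
  then have "(w, r) \<in> convex hull ((\<lambda>g. (g, r)) ` D)"
    using assms(3) by (simp add: convex_hull_Times)
  then show ?thesis
    using affine_le_on_convex_hull_graph[OF assms(1), of D c "\<lambda>_. r" w r] assms(2) by blast
qed

lemma linear_nonpos_on_convex_cone_hull:
  assumes "linear u" "\<And>s. s \<in> S \<Longrightarrow> u s \<le> (0::real)" "s \<in> convex_cone hull S"
  shows "u s \<le> 0"
proof -
  have "convex_cone {s. u s \<le> 0}"
    unfolding convex_cone_iff
    by (auto simp: linear_0[OF assms(1)] linear_add[OF assms(1)] linear_scale[OF assms(1)]
        mult_nonneg_nonpos)
  then have "convex_cone hull S \<subseteq> {s. u s \<le> 0}"
    using assms(2) by (intro hull_minimal) auto
  then show ?thesis using assms(3) by blast
qed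

lemma cross_polytope_subset_ball:
  fixes B :: "'a::real_normed_vector set"
  assumes "finite B" "r > 0"
  obtains \<delta> where "\<delta> > 0" "\<delta> \<in> \<rat>" "\<And>x. cross_polytope B x \<delta> \<subseteq> ball x r"
proof -
  have s: "0 \<le> (\<Sum>b\<in>B. norm b)" by (simp add: sum_nonneg)
  then obtain \<delta> where \<delta>: "\<delta> \<in> \<rat>" "0 < \<delta>" "\<delta> < r / (1 + (\<Sum>b\<in>B. norm b))"
    using Rats_dense_in_real[of 0 "r / (1 + (\<Sum>b\<in>B. norm b))"] assms(2) by auto
  have "\<delta> * norm b < r" if "b \<in> B" for b
  proof -
    have "norm b \<le> (\<Sum>b\<in>B. norm b)" using member_le_sum[OF that, of norm] assms(1) by simp
    then have "\<delta> * norm b \<le> \<delta> * (1 + (\<Sum>b\<in>B. norm b))" using \<delta>(2) by simp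
    also have "\<dots> < r" using \<delta>(3) s by (simp add: pos_less_divide_eq)
    finally show ?thesis .
  qed
  then have "cross_polytope B x \<delta> \<subseteq> ball x r" for x
    using assms(2) \<delta>(2) by (auto simp: cross_polytope_def dist_norm)
  then show thesis by (rule that[OF \<delta>(2,1)])
qed

lemma finite_cross_polytope: "finite B \<Longrightarrow> finite (cross_polytope B x \<delta>)"
  by (simp add: cross_polytope_def)

text \<open>
  The polyhedral interpolants of the samples of \<open>max \<phi> (-k)\<close> at growing finite sets are decreasing,
  and the regularised maximum approximates them within \<open>\<epsilon>\<close> from below.  The first sample set already
  contains the vertices of a polytope around \<open>\<omega>\<close>, so that a fixed neighbourhood lies in the domain of
  all the interpolants.  Truncating at \<open>-k\<close> keeps the samples finite and deals with \<open>\<phi> = -\<infinity>\<close> as well.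
\<close>

lemma decreasing_affine_approximation:
  fixes N :: "'a::real_normed_vector set" and B :: "'a set"
  assumes B: "finite B" "independent B" "span B = UNIV"
    and fan: "fan N \<Sigma>" and U: "openin (NS_topology \<Sigma>) U" and psh: "psh_on \<Sigma> U \<phi>"
    and \<sigma>: "\<sigma> \<in> \<Sigma>" and \<Omega>: "open \<Omega>" "convex \<Omega>" and sub: "basic_nbhd \<Sigma> \<sigma> \<Omega> \<subseteq> U"
    and \<omega>: "\<omega> \<in> \<Omega>"
  shows "\<exists>\<eta>>0. \<exists>(ps :: nat \<Rightarrow> 'a affine_form list) m \<epsilon>.
    (\<forall>k. \<epsilon> k > 0 \<and> (\<forall>p\<in>set (ps k). linear (fst p) \<and> (\<forall>s\<in>\<sigma>. fst p s \<le> 0))) \<and>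
    (\<forall>x \<in> (\<Omega> \<inter> ball \<omega> \<eta>) + \<sigma>.
      (\<forall>k. \<phi> (incl x) \<le> ereal (reg_max (\<epsilon> k) (m k) (ps k) x)) \<and>
      (\<forall>k. reg_max (\<epsilon> (Suc k)) (m (Suc k)) (ps (Suc k)) x \<le> reg_max (\<epsilon> k) (m k) (ps k) x) \<and>
      (\<forall>a. \<phi> (incl x) < ereal a \<longrightarrow> (\<forall>\<^sub>F k in sequentially. reg_max (\<epsilon> k) (m k) (ps k) x < a)))"
proof -
  note loc = fan U psh \<sigma> \<Omega>(1) sub
  note cc = fan_convex_cone[OF fan \<sigma>]
  obtain S where S: "finite S" "\<sigma> = convex_cone hull S"
    using fan \<sigma> by (auto simp: fan_def rational_cone_def dest!: bspec)
  let ?W = "\<Omega> + \<sigma>"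
  have \<Omega>W: "\<Omega> \<subseteq> ?W" using convex_cone_contains_0[OF cc] by (force simp: set_plus_def)
  have "convex \<sigma>" using cc by (simp add: convex_cone_def)
  then have convW: "convex ?W" using \<Omega>(2) by (simp add: convex_set_plus)
  have finW: "\<phi> (incl x) < \<infinity>" if "x \<in> ?W" for x
    using psh_onD_less_infty[OF psh incl_in_superset_of_basic_nbhd[OF fan \<sigma> sub that]] .
  have cvx: "seg_convex ?W (\<lambda>x. \<phi> (incl x))"
  proof (rule seg_convex_mono)
    show "seg_convex (incl -` U) (\<lambda>x. \<phi> (incl x))"
      using psh psh_on_iff_seg_convex[OF U] by blast
    show "?W \<subseteq> incl -` U" using incl_in_superset_of_basic_nbhd[OF fan \<sigma> sub] by blast
  qed
  obtain r where r: "r > 0" "ball \<omega> r \<subseteq> \<Omega>" using \<Omega>(1) \<omega> by (meson openE)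
  obtain \<delta> where \<delta>: "\<delta> > 0" "\<And>x. cross_polytope B x \<delta> \<subseteq> ball x r"
    using cross_polytope_subset_ball[OF B(1) r(1)] by metis
  define D0 where "D0 = cross_polytope B \<omega> \<delta>"
  obtain \<eta> where \<eta>: "\<eta> > 0" "ball \<omega> \<eta> \<subseteq> convex hull D0"
    using ball_subset_cross_polytope[OF B \<delta>(1)] unfolding D0_def by metis
  obtain Q where Q: "countable Q" "\<And>x \<eta>. \<eta> > 0 \<Longrightarrow> \<exists>r\<in>Q. norm (r - x) < \<eta>"
      "\<And>r b q. r \<in> Q \<Longrightarrow> b \<in> B \<Longrightarrow> q \<in> \<rat> \<Longrightarrow> r + q *\<^sub>R b \<in> Q"
    using countable_dense_of_finite_basis[OF B(1,3)] by metis
  \<comment> \<open>The first points of a dense sequence, as far as they lie in the domain of \<open>\<phi>\<close>.\<close>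
  define D where "D k = D0 \<union> (from_nat_into Q ` {..k} \<inter> ?W)" for k
  have finD: "finite (D k)" for k
    using finite_cross_polytope[OF B(1)] by (simp add: D_def D0_def)
  have D_mono: "D k \<subseteq> D (Suc k)" for k by (auto simp: D_def)
  have DW: "D k \<subseteq> ?W" for k using \<delta>(2) r(2) \<Omega>W by (auto simp: D_def D0_def)
  define y where "y k g = real_of_ereal (max (\<phi> (incl g)) (ereal (- real k)))" for k g
  have y: "ereal (y k g) = max (\<phi> (incl g)) (ereal (- real k))" if "g \<in> ?W" for k g
    using finW[OF that] by (cases "\<phi> (incl g)") (auto simp: y_def max_def)
  define interp where "interp k qs \<longleftrightarrow>
      (\<forall>p\<in>set qs. linear (fst p)) \<and> (\<forall>p\<in>set qs. \<forall>s\<in>S. fst p s \<le> 0) \<and>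
      (\<forall>p\<in>set qs. \<forall>g\<in>D k. aff p g \<le> y k g) \<and>
      (\<forall>w\<in>convex hull D k. \<forall>s\<in>convex_cone hull S. \<forall>r. (\<forall>p\<in>set qs. aff p (w + s) \<le> r) \<longrightarrow>
        (\<exists>w' \<rho> s'. (w', \<rho>) \<in> convex hull ((\<lambda>g. (g, y k g)) ` D k) \<and> s' \<in> convex_cone hull S \<and>
          w + s = w' + s' \<and> \<rho> \<le> r))" for k and qs :: "'a affine_form list"
  have "\<exists>qs. interp k qs" for k
  proof (rule polyhedral_interpolation[OF B finD[of k] S(1), where y = "y k"])
    fix qs :: "'a affine_form list"
    assume *: "\<And>p. p \<in> set qs \<Longrightarrow> linear (fst p)"
      "\<And>p s. p \<in> set qs \<Longrightarrow> s \<in> S \<Longrightarrow> fst p s \<le> 0"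
      "\<And>p g. p \<in> set qs \<Longrightarrow> g \<in> D k \<Longrightarrow> aff p g \<le> y k g"
      "\<And>w s r. w \<in> convex hull D k \<Longrightarrow> s \<in> convex_cone hull S \<Longrightarrow>
        (\<And>p. p \<in> set qs \<Longrightarrow> aff p (w + s) \<le> r) \<Longrightarrow>
        \<exists>w' \<rho> s'. (w', \<rho>) \<in> convex hull ((\<lambda>g. (g, y k g)) ` D k) \<and> s' \<in> convex_cone hull S \<and>
          w + s = w' + s' \<and> \<rho> \<le> r"
    have "interp k qs"
      unfolding interp_def by (intro conjI ballI allI impI *(4)) (use *(1-3) in blast)+
    then show ?thesis ..
  qed
  then obtain qs where interp: "\<And>k. interp k (qs k)" by metis
  from interp have lin: "\<And>k p. p \<in> set (qs k) \<Longrightarrow> linear (fst p)"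
    and slopeS: "\<And>k p s. p \<in> set (qs k) \<Longrightarrow> s \<in> S \<Longrightarrow> fst p s \<le> 0"
    and below: "\<And>k p g. p \<in> set (qs k) \<Longrightarrow> g \<in> D k \<Longrightarrow> aff p g \<le> y k g"
    and dominate: "\<And>k w s r. w \<in> convex hull D k \<Longrightarrow> s \<in> \<sigma> \<Longrightarrow>
      (\<forall>p\<in>set (qs k). aff p (w + s) \<le> r) \<Longrightarrow>
        (\<exists>w' \<rho> s'. (w', \<rho>) \<in> convex hull ((\<lambda>g. (g, y k g)) ` D k) \<and> s' \<in> \<sigma> \<and>
          w + s = w' + s' \<and> \<rho> \<le> r)"
    unfolding S(2) by (simp_all add: interp_def)
  have slope: "fst p s \<le> 0" if "p \<in> set (qs k)" "s \<in> \<sigma>" for k p s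
    using linear_nonpos_on_convex_cone_hull[OF lin[OF that(1)] slopeS[OF that(1)]] that(2) S(2) by simp
  \<comment> \<open>With the forms and the floor raised by \<open>2\<epsilon>\<^sub>k\<close>, the regularised maximum \<open>F\<^sub>k\<close> lies between
    \<open>M\<^sub>k + \<epsilon>\<^sub>k\<close> and \<open>M\<^sub>k + 2\<epsilon>\<^sub>k\<close>, where \<open>M\<^sub>k\<close> is the maximum of the unshifted forms and \<open>-k\<close>.
    So \<open>M\<^sub>k\<^sub>+\<^sub>1 \<le> M\<^sub>k\<close> and \<open>2\<epsilon>\<^sub>k\<^sub>+\<^sub>1 = \<epsilon>\<^sub>k\<close> give \<open>F\<^sub>k\<^sub>+\<^sub>1 \<le> F\<^sub>k\<close>.\<close>
  define \<epsilon> where "\<epsilon> k = (1 / 2 :: real) ^ k" for k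
  define m where "m k = - real k + 2 * \<epsilon> k" for k
  define ps where "ps k = map (\<lambda>p. (fst p, snd p + 2 * \<epsilon> k)) (qs k)" for k
  define F where "F k = reg_max (\<epsilon> k) (m k) (ps k)" for k
  have \<epsilon>: "\<epsilon> k > 0" "\<epsilon> k = 2 * \<epsilon> (Suc k)" for k by (simp_all add: \<epsilon>_def)
  let ?W' = "(\<Omega> \<inter> ball \<omega> \<eta>) + \<sigma>"
  have W'E: "\<exists>w s. w \<in> convex hull D k \<and> s \<in> \<sigma> \<and> x = w + s" if x: "x \<in> ?W'" for x k
  proof -
    obtain w s where ws: "w \<in> ball \<omega> \<eta>" "s \<in> \<sigma>" "x = w + s" using x by (auto simp: set_plus_def)
    have "convex hull D0 \<subseteq> convex hull D k" by (rule hull_mono) (simp add: D_def)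
    then show ?thesis using ws \<eta>(2) by blast
  qed
  have W'W: "?W' \<subseteq> ?W" by (intro set_plus_mono2) auto
  have F_dominates: "\<exists>w \<rho> s. (w, \<rho>) \<in> convex hull ((\<lambda>g. (g, y k g)) ` D k) \<and> s \<in> \<sigma> \<and>
      x = w + s \<and> \<rho> \<le> F k x - \<epsilon> k" if x: "x \<in> ?W'" for k x
  proof -
    have "aff p x \<le> F k x - \<epsilon> k" if "p \<in> set (qs k)" for p
    proof -
      have "(fst p, snd p + 2 * \<epsilon> k) \<in> set (ps k)" using that by (auto simp: ps_def)
      from reg_max_ge[OF \<epsilon>(1)[of k] this, of x "m k"] show ?thesis by (simp add: F_def)
    qed
    then show ?thesis using W'E[OF x, of k] dominate[of _ k] by blast
  qed
  have F_ge: "\<phi> (incl x) \<le> ereal (F k x)" if x: "x \<in> ?W'" for k x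
  proof -
    obtain w \<rho> s where w: "(w, \<rho>) \<in> convex hull ((\<lambda>g. (g, y k g)) ` D k)" "s \<in> \<sigma>" "x = w + s"
        "\<rho> \<le> F k x - \<epsilon> k"
      using F_dominates[OF x, of k] by (elim exE conjE)
    \<comment> \<open>The epigraph of \<open>\<phi>\<close> is convex and contains the samples, hence also their convex hull.\<close>
    let ?E = "{q. fst q \<in> ?W \<and> \<phi> (incl (fst q)) \<le> ereal (snd q)}"
    have "convex ?E"
      unfolding convex_alt
    proof (intro ballI allI impI)
      fix p q and t :: real assume pq: "p \<in> ?E" "q \<in> ?E" and t: "0 \<le> t \<and> t \<le> 1"
      have seg: "closed_segment (fst p) (fst q) \<subseteq> ?W"
        using pq convW by (intro closed_segment_subset) auto
      have "(1 - t) *\<^sub>R fst p + t *\<^sub>R fst q \<in> ?W"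
        using seg t by (auto simp: closed_segment_def)
      moreover have "\<phi> (incl ((1 - t) *\<^sub>R fst p + t *\<^sub>R fst q))
          \<le> ereal ((1 - t) * snd p + t * snd q)"
        using pq t by (intro seg_convexD[OF cvx seg]) auto
      ultimately show "(1 - t) *\<^sub>R p + t *\<^sub>R q \<in> ?E" by simp
    qed
    moreover have "(\<lambda>g. (g, y k g)) ` D k \<subseteq> ?E" using DW y by fastforce
    ultimately have "convex hull ((\<lambda>g. (g, y k g)) ` D k) \<subseteq> ?E" by (intro hull_minimal)
    then have "w \<in> ?W" "\<phi> (incl w) \<le> ereal \<rho>" using w(1) by auto
    have "\<phi> (incl x) \<le> \<phi> (incl w)"
      unfolding w(3) by (rule psh_nonincreasing_along_cone[OF loc \<open>w \<in> ?W\<close> w(2)])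
    also have "\<dots> \<le> ereal \<rho>" by fact
    also have "\<dots> \<le> ereal (F k x)" using w(4) \<epsilon>(1)[of k] by simp
    finally show ?thesis .
  qed
  have F_dec: "F (Suc k) x \<le> F k x" if x: "x \<in> ?W'" for k x
  proof -
    obtain w \<rho> s where w: "(w, \<rho>) \<in> convex hull ((\<lambda>g. (g, y k g)) ` D k)" "s \<in> \<sigma>" "x = w + s"
        "\<rho> \<le> F k x - \<epsilon> k"
      using F_dominates[OF x, of k] by (elim exE conjE)
    have "aff p x + 2 * \<epsilon> (Suc k) \<le> F k x" if p: "p \<in> set (qs (Suc k))" for p
    proof -
      have "fst p g + snd p \<le> y k g" if g: "g \<in> D k" for g
      proof -
        have gW: "g \<in> ?W" using g DW by blast
        have "ereal (y (Suc k) g) \<le> ereal (y k g)"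
          unfolding y[OF gW] by (intro max.mono) auto
        moreover have "aff p g \<le> y (Suc k) g" using below[OF p] g D_mono by blast
        ultimately show ?thesis by simp
      qed
      then have "fst p w + snd p \<le> \<rho>"
        by (rule affine_le_on_convex_hull_graph[OF lin[OF p] _ w(1)])
      then have "aff p x \<le> \<rho>"
        using slope[OF p w(2)] by (simp add: w(3) linear_add[OF lin[OF p]])
      then show ?thesis using w(4) \<epsilon>(2)[of k] by simp
    qed
    moreover have "m (Suc k) \<le> F k x"
    proof -
      have "m k \<le> F k x" unfolding F_def by (rule reg_max_ge_base[OF \<epsilon>(1)])
      then show ?thesis using \<epsilon>(1)[of "Suc k"] \<epsilon>(2)[of k] by (simp add: m_def)
    qed
    ultimately show ?thesis
      unfolding F_def[of "Suc k"] by (intro reg_max_le \<epsilon>(1)) (auto simp: ps_def add.assoc)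
  qed
  have F_lim: "\<forall>\<^sub>F k in sequentially. F k x < a" if x: "x \<in> ?W'" and a: "\<phi> (incl x) < ereal a" for x a
  proof -
    obtain a' where a': "\<phi> (incl x) < ereal a'" "a' < a"
      using ereal_dense2[OF a] by auto
    have "x \<in> {x \<in> ?W. \<phi> (incl x) < ereal a'}" using x W'W a'(1) by blast
    then obtain r where r: "r > 0" "ball x r \<subseteq> {x \<in> ?W. \<phi> (incl x) < ereal a'}"
      using open_sublevel_of_psh[OF loc, of a'] by (meson openE)
    have "r / 2 > 0" using r(1) by simp
    then obtain \<delta>' where \<delta>': "\<delta>' > 0" "\<delta>' \<in> \<rat>" "\<And>z. cross_polytope B z \<delta>' \<subseteq> ball z (r / 2)"
      using cross_polytope_subset_ball[OF B(1), of "r / 2"] by metis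
    obtain \<eta>' where \<eta>': "\<eta>' > 0" "\<And>z. ball z \<eta>' \<subseteq> convex hull (cross_polytope B z \<delta>')"
      using ball_subset_cross_polytope[OF B \<delta>'(1)] by metis
    obtain z where z: "z \<in> Q" "norm (z - x) < min \<eta>' (r / 2)"
      using Q(2)[of "min \<eta>' (r / 2)" x] \<eta>'(1) r(1) by auto
    let ?P = "cross_polytope B z \<delta>'"
    \<comment> \<open>The vertices of a small cross-polytope around \<open>x\<close>, all of them points of the dense set where
      \<open>\<phi>\<close> is below \<open>a'\<close>; eventually they are all sampled.\<close>
    have P_near: "g \<in> ?W" "\<phi> (incl g) < ereal a'" if "g \<in> ?P" for g
    proof -
      have "dist x g \<le> dist x z + dist z g" by (rule dist_triangle)
      also have "\<dots> < r / 2 + r / 2"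
        using z(2) \<delta>'(3)[of z] that by (intro add_strict_mono) (auto simp: dist_norm norm_minus_commute)
      finally have "g \<in> ball x r" by simp
      then show "g \<in> ?W" "\<phi> (incl g) < ereal a'" using r(2) by auto
    qed
    have xP: "x \<in> convex hull ?P"
      using subsetD[OF \<eta>'(2), of x z] z(2) by (simp add: dist_norm)
    have PQ: "?P \<subseteq> Q"
    proof -
      have "z + \<delta>' *\<^sub>R b \<in> Q" "z - \<delta>' *\<^sub>R b \<in> Q" if "b \<in> B" for b
        using Q(3)[OF z(1) that \<delta>'(2)] Q(3)[OF z(1) that Rats_minus_iff[THEN iffD2, OF \<delta>'(2)]]
        by simp_all
      then show ?thesis using z(1) by (auto simp: cross_polytope_def)
    qed
    have "\<forall>\<^sub>F k in sequentially. g \<in> D k" if g: "g \<in> ?P" for g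
    proof -
      have "g \<in> Q" using PQ g by blast
      then obtain n where "from_nat_into Q n = g" using from_nat_into_surj[OF Q(1)] by blast
      then have "g \<in> D k" if "k \<ge> n" for k
        using that P_near(1)[OF g] by (auto simp: D_def)
      then show ?thesis by (auto simp: eventually_sequentially)
    qed
    then have "\<forall>\<^sub>F k in sequentially. \<forall>g\<in>?P. g \<in> D k"
      using finite_cross_polytope[OF B(1)] by (simp add: eventually_ball_finite_distrib)
    moreover have "\<forall>\<^sub>F k in sequentially. - real k \<le> a'"
      using eventually_ge_at_top[of "nat \<lceil>- a'\<rceil>"] by eventually_elim linarith
    moreover have "(\<lambda>k. a' + 2 * \<epsilon> k) \<longlonglongrightarrow> a' + 2 * 0"
      unfolding \<epsilon>_def by (intro tendsto_intros LIMSEQ_power_zero) simp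
    then have "\<forall>\<^sub>F k in sequentially. a' + 2 * \<epsilon> k < a"
      using a'(2) by (intro order_tendstoD(2)) simp_all
    ultimately show ?thesis
    proof eventually_elim
      case (elim k)
      have "aff p x \<le> a'" if p: "p \<in> set (qs k)" for p
      proof (rule affine_le_on_convex_hull[OF lin[OF p] _ xP])
        fix g assume g: "g \<in> ?P"
        have "ereal (y k g) \<le> ereal a'"
          unfolding y[OF P_near(1)[OF g]] using P_near(2)[OF g] elim(2) by simp
        moreover have "aff p g \<le> y k g" using below[OF p] elim(1) g by blast
        ultimately show "fst p g + snd p \<le> a'" by simp
      qed
      then have "F k x \<le> a' + 2 * \<epsilon> k"
        unfolding F_def using elim(2) by (intro reg_max_le \<epsilon>(1)) (auto simp: ps_def m_def)
      then show ?case using elim(3) by simp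
    qed
  qed
  have "linear (fst p)" "fst p s \<le> 0" if "p \<in> set (ps k)" "s \<in> \<sigma>" for k p s
    using that lin slope by (auto simp: ps_def)
  moreover have "linear (fst p)" if "p \<in> set (ps k)" for k p
    using that lin by (auto simp: ps_def)
  ultimately show ?thesis
    using \<epsilon>(1) F_ge F_dec F_lim
    by (intro exI[of _ \<eta>] conjI[OF \<eta>(1)] exI[of _ ps] exI[of _ m] exI[of _ \<epsilon>]) (simp add: F_def)
qed

text \<open>
  The approximants and their monotonicity are known on \<open>N\<^sub>\<real>\<close>.  A value on a boundary stratum equals a
  value far out on the fibre, where two consecutive approximants can be compared; convergence at the
  boundary point follows since \<open>\<phi>\<close> at that point is the infimum of \<open>\<phi>\<close> over the fibre.
\<close>

lemma psh_imp_locally_decreasing_limit: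
  fixes N :: "'a::real_normed_vector set"
  assumes lattice: "full_lattice N" and fan: "fan N \<Sigma>" and U: "openin (NS_topology \<Sigma>) U"
    and psh: "psh_on \<Sigma> U \<phi>" and p: "p \<in> U"
  shows "\<exists>V. openin (NS_topology \<Sigma>) V \<and> p \<in> V \<and> V \<subseteq> U \<and>
       decreasing_limit_of_smooth_psh \<Sigma> V \<phi>"
proof -
  obtain B :: "'a set" where B: "finite B" "independent B" "span B = UNIV"
    using lattice unfolding full_lattice_def by (elim exE conjE)
  have "U \<subseteq> (\<Union>\<sigma>\<in>\<Sigma>. stratum \<sigma>)" using U unfolding openin_NS_topology[OF fan] by (rule conjunct1)
  then obtain \<sigma> x where x: "p = quot \<sigma> x" using p by blast
  then have "quot \<sigma> x \<in> U" using p by simp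
  then obtain \<Omega> \<omega> where \<sigma>: "\<sigma> \<in> \<Sigma>" and \<Omega>: "bounded \<Omega>" "open \<Omega>" "convex \<Omega>"
      and \<omega>: "\<omega> \<in> \<Omega>" "x - \<omega> \<in> span \<sigma>" and sub: "basic_nbhd \<Sigma> \<sigma> \<Omega> \<subseteq> U"
    by (rule openin_NS_nbhdE[OF fan U])
  note loc = fan U psh \<sigma> \<Omega>(2) sub
  from decreasing_affine_approximation[OF B fan U psh \<sigma> \<Omega>(2,3) sub \<omega>(1)]
  obtain \<eta> m \<epsilon> and ps :: "nat \<Rightarrow> 'a affine_form list" where \<eta>: "\<eta> > 0" and
    forms: "\<forall>k. \<epsilon> k > 0 \<and> (\<forall>p\<in>set (ps k). linear (fst p) \<and> (\<forall>s\<in>\<sigma>. fst p s \<le> 0))" and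
    approx: "\<forall>x \<in> (\<Omega> \<inter> ball \<omega> \<eta>) + \<sigma>.
      (\<forall>k. \<phi> (incl x) \<le> ereal (reg_max (\<epsilon> k) (m k) (ps k) x)) \<and>
      (\<forall>k. reg_max (\<epsilon> (Suc k)) (m (Suc k)) (ps (Suc k)) x \<le> reg_max (\<epsilon> k) (m k) (ps k) x) \<and>
      (\<forall>a. \<phi> (incl x) < ereal a \<longrightarrow> (\<forall>\<^sub>F k in sequentially. reg_max (\<epsilon> k) (m k) (ps k) x < a))"
    by (elim exE conjE)
  have \<epsilon>: "\<epsilon> k > 0" for k using forms by simp
  have lin: "linear (fst p)" if "p \<in> set (ps k)" for k p using forms that by blast
  have slopes: "fst p s \<le> 0" if "p \<in> set (ps k)" "s \<in> \<sigma>" for k p s using forms that by blast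
  have bl: "bounded_linear (fst p)" if "p \<in> set (ps k)" for k p
    by (rule linear_imp_bounded_linear[OF B lin[OF that]])
  define \<Omega>' where "\<Omega>' = \<Omega> \<inter> ball \<omega> \<eta>"
  have \<Omega>': "bounded \<Omega>'" "open \<Omega>'" "convex \<Omega>'"
    unfolding \<Omega>'_def using \<Omega> by (auto intro: convex_Int)
  let ?V = "basic_nbhd \<Sigma> \<sigma> \<Omega>'"
  let ?f = "\<lambda>k. toric_reg_max (\<epsilon> k) (m k) (ps k)"
  let ?F = "\<lambda>k. reg_max (\<epsilon> k) (m k) (ps k)"
  have W'W: "\<Omega>' + \<sigma> \<subseteq> \<Omega> + \<sigma>" unfolding \<Omega>'_def by (intro set_plus_mono2) auto
  have V_U: "?V \<subseteq> U" using basic_nbhd_mono[OF fan_face_refl[OF fan \<sigma>] W'W] sub by blast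
  have shift: "z + t \<in> \<Omega>' + \<sigma>" if "z \<in> \<Omega>' + \<sigma>" "t \<in> \<tau>" "\<tau> face_of \<sigma>" for z t \<tau>
    using set_plus_cone_translate[OF fan_convex_cone[OF fan \<sigma>] that(1)] that(2) face_of_imp_subset[OF that(3)]
    by blast
  have "decseq (\<lambda>k. ?f k q) \<and> (\<lambda>k. ereal (?f k q)) \<longlonglongrightarrow> \<phi> q" if qV: "q \<in> ?V" for q
  proof -
    obtain \<tau> z where q: "q = quot \<tau> z" and \<tau>: "\<tau> \<in> \<Sigma>" "\<tau> face_of \<sigma>" and z: "z \<in> \<Omega>' + \<sigma>"
      using qV by (auto simp: basic_nbhd_def)
    have far: "\<exists>w\<in>\<tau>. \<forall>t\<in>\<tau>. ?f k q = ?F k (z + w + t)" for k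
    proof (rule toric_reg_max_eq_far[OF fan \<sigma> \<Omega>' \<epsilon>[of k] bl slopes \<tau>])
      fix w assume "w \<in> \<tau>" "\<And>t. t \<in> \<tau> \<Longrightarrow> ?f k (quot \<tau> z) = ?F k (z + w + t)"
      then show ?thesis unfolding q by blast
    qed
    have "?f (Suc k) q \<le> ?f k q" for k
    proof -
      obtain w1 where w1: "w1 \<in> \<tau>" "\<And>t. t \<in> \<tau> \<Longrightarrow> ?f k q = ?F k (z + w1 + t)"
        using far[of k] by blast
      obtain w2 where w2: "w2 \<in> \<tau>" "\<And>t. t \<in> \<tau> \<Longrightarrow> ?f (Suc k) q = ?F (Suc k) (z + w2 + t)"
        using far[of "Suc k"] by blast
      have "z + w1 + w2 \<in> \<Omega>' + \<sigma>" using shift[OF shift[OF z w1(1) \<tau>(2)] w2(1) \<tau>(2)] .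
      then have "?F (Suc k) (z + w1 + w2) \<le> ?F k (z + w1 + w2)" using approx unfolding \<Omega>'_def by blast
      then show ?thesis
        using w1(2)[OF w2(1)] w2(2)[OF w1(1)] by (simp add: add.assoc add.commute[of w2 w1])
    qed
    then have "decseq (\<lambda>k. ?f k q)" by (intro decseq_SucI)
    moreover have "(\<lambda>k. ereal (?f k q)) \<longlonglongrightarrow> \<phi> q"
    proof (rule order_tendstoI)
      fix a assume a: "a < \<phi> q"
      have "\<phi> q \<le> ereal (?f k q)" for k
      proof -
        obtain w where w: "w \<in> \<tau>" "\<And>t. t \<in> \<tau> \<Longrightarrow> ?f k q = ?F k (z + w + t)"
          using far[of k] by blast
        have 0: "0 \<in> \<tau>" by (rule convex_cone_contains_0[OF fan_convex_cone[OF fan \<tau>(1)]])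
        have zw: "z + w \<in> \<Omega>' + \<sigma>" by (rule shift[OF z w(1) \<tau>(2)])
        have "q = quot \<tau> (z + w)"
          using span_neg[OF span_base[OF w(1)]] by (simp add: q quot_eq_iff)
        then have "\<phi> q \<le> \<phi> (incl (z + w))"
          using psh_boundary_le[OF loc \<tau>(2,1), of "z + w"] zw W'W by blast
        also have "\<dots> \<le> ereal (?F k (z + w))" using approx zw unfolding \<Omega>'_def by blast
        finally show ?thesis using w(2)[OF 0] by simp
      qed
      then show "\<forall>\<^sub>F k in sequentially. a < ereal (?f k q)"
        using a less_le_trans by (intro always_eventually) blast
    next
      fix a assume "\<phi> q < a"
      then obtain a' where a': "\<phi> q < ereal a'" "ereal a' < a" using ereal_dense2 by blast
      then have "\<phi> (quot \<tau> z) < ereal a'" "quot \<tau> z \<in> U" using q V_U qV by auto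
      then obtain t where t: "t \<in> \<tau>" "\<phi> (incl (z + t)) < ereal a'"
        using psh_boundary_approx[OF loc \<tau>(1)] by metis
      have "?f k q \<le> ?F k (z + t)" for k
      proof -
        have "quot \<tau> z = quot \<tau> (z + t)"
          using span_neg[OF span_base[OF t(1)]] by (simp add: quot_eq_iff)
        then have "?f k q = ?f k (quot \<tau> (z + t))" by (simp only: q)
        also have "\<dots> \<le> ?F k (z + t)"
          by (subst toric_reg_max_quot) (auto intro: lin reg_max_filter_le[OF \<epsilon>])
        finally show ?thesis .
      qed
      moreover have "z + t \<in> \<Omega> \<inter> ball \<omega> \<eta> + \<sigma>"
        using shift[OF z t(1) \<tau>(2)] by (simp add: \<Omega>'_def)
      then have "\<forall>\<^sub>F k in sequentially. ?F k (z + t) < a'" using approx t(2) by blast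
      ultimately have "\<forall>\<^sub>F k in sequentially. ?f k q < a'"
        by (auto elim!: eventually_mono intro: le_less_trans)
      then show "\<forall>\<^sub>F k in sequentially. ereal (?f k q) < a"
        by eventually_elim (rule less_trans[OF _ a'(2)], simp)
    qed
    ultimately show ?thesis ..
  qed
  moreover have "smooth_on \<Sigma> ?V (?f k) \<and> psh_on \<Sigma> ?V (\<lambda>p. ereal (?f k p))" for k
    by (intro conjI smooth_toric_reg_max[OF fan \<sigma> \<Omega>' \<epsilon>] psh_toric_reg_max[OF fan \<sigma> \<Omega>' \<epsilon>])
      (auto intro: bl slopes)
  ultimately have "decreasing_limit_of_smooth_psh \<Sigma> ?V \<phi>"
    unfolding decreasing_limit_of_smooth_psh_def by (intro exI[of _ ?f]) blast
  moreover have "openin (NS_topology \<Sigma>) ?V" by (rule openin_basic_nbhd[OF \<sigma> \<Omega>'])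
  moreover have "p \<in> ?V"
  proof -
    have "\<omega> + 0 \<in> \<Omega>' + \<sigma>"
      using \<omega>(1) \<eta> convex_cone_contains_0[OF fan_convex_cone[OF fan \<sigma>]]
      by (intro set_plus_intro) (auto simp: \<Omega>'_def)
    moreover have "p = quot \<sigma> \<omega>" using \<omega>(2) by (simp add: x quot_eq_iff)
    ultimately show ?thesis using \<sigma> fan_face_refl[OF fan \<sigma>] by (auto simp: basic_nbhd_def)
  qed
  ultimately show ?thesis using V_U by blast
qed

theorem theorem3p3p4:
  fixes N :: "'a::real_normed_vector set" and \<Sigma> :: "'a set set"
    and U :: "'a point set" and \<phi> :: "'a point \<Rightarrow> ereal"
  assumes "full_lattice N"
    and "fan N \<Sigma>"
    and "openin (NS_topology \<Sigma>) U"
    and "\<forall>p\<in>U. \<phi> p < \<infinity>"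
  shows "psh_on \<Sigma> U \<phi> \<longleftrightarrow>
    (\<forall>p\<in>U. \<exists>V. openin (NS_topology \<Sigma>) V \<and> p \<in> V \<and> V \<subseteq> U \<and>
       decreasing_limit_of_smooth_psh \<Sigma> V \<phi>)"
  using psh_imp_locally_decreasing_limit[OF assms(1-3)]
    psh_on_if_locally_decreasing_limit[OF assms(2-4)] by blast

end
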